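(* Let $(M,\mathcal T,\varepsilon,\eta)$ be a weighted triangulated connected closed surface with weights $\varepsilon:V\to\{0,1\}$ and $\eta:E\to\mathbb R$ satisfying the structure conditions $$\varepsilon_s\varepsilon_t+\eta_{st}>0\quad\text{for all }\{st\}\in E,$$ $$\varepsilon_q\eta_{st}+\eta_{qs}\eta_{qt}\ge 0\quad\text{for all }\{ijk\}\in F\text{ and all }\{q,s,t\}=\{i,j,k\}.$$ (a) For any initial discrete conformal factor on $(M,\mathcal T,\varepsilon,\eta)$, the solution of the normalized combinatorial Ricci flow $\frac{du_i}{dt}=K_{av}-K_i$ in the Euclidean background geometry, and the solution of the combinatorial Ricci flow $\frac{du_i}{dt}=-K_i$ in the hyperbolic background geometry, can be extended (as solutions of the corresponding extended flows) to exist for all time $t\ge 0$. (b) The solution of the extended combinatorial Ricci flow (Euclidean normalized, respectively hyperbolic) is unique for any initial discrete conformal factor. (c) If there exists a Euclidean discrete conformal factor with constant combinatorial curvature on $(M,\mathcal T,\varepsilon,\eta)$, then the solution of the extended normalized Euclidean combinatorial Ricci flow converges exponentially fast for any initial Euclidean discrete conformal factor. If there exists a hyperbolic discrete conformal factor with zero combinatorial curvature on $(M,\mathcal T,\varepsilon,\eta)$, then the solution of the extended hyperbolic combinatorial Ricci flow converges exponentially fast for any initial hyperbolic discrete conformal factor.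
   Context: A triangulated closed surface $(M,\mathcal T)$ is the quotient of a finite disjoint union of triangles by identifying all edges of the triangles in pairs by homeomorphisms; $V,E,F$ are its sets of vertices, unoriented edges and faces, $N=|V|$. A vertex is denoted $i$, an edge $\{ij\}$, a face $\{ijk\}$; $f_i,\varepsilon_i$ are values at vertices, $\eta_{ij},l_{ij}$ values on edges. A weighted triangulated surface $(M,\mathcal T,\varepsilon,\eta)$ is one with weights $\varepsilon:V\to\{0,1\}$ on vertices and $\eta:E\to\mathbb R$ on edges. Edge lengths: for $f:V\to\mathbb R$, in the Euclidean background geometry $l_{ij}=\sqrt{\varepsilon_i e^{2f_i}+\varepsilon_j e^{2f_j}+2\eta_{ij}e^{f_i+f_j}}$; in the hyperbolic background geometry $l_{ij}=\cosh^{-1}\left(\sqrt{(1+\varepsilon_ie^{2f_i})(1+\varepsilon_je^{2f_j})}+\eta_{ij}e^{f_i+f_j}\right)$. Under the structure condition $\varepsilon_s\varepsilon_t+\eta_{st}>0$ for all $\{st\}\in E$, these are well defined and positive for every $f\in\mathbb R^N$. A function $f$ is a (nondegenerate) Euclidean (resp. hyperbolic) discrete conformal factor if for every face $\{ijk\}$ the lengths $l_{ij},l_{ik},l_{jk}$ satisfy the strict triangle inequalities. Coordinates: in the Euclidean case $u_i=f_i$. In the hyperbolic case $u_i=f_i$ if $\varepsilon_i=0$ and $u_i=\frac12\log\frac{\sqrt{1+e^{2f_i}}-1}{\sqrt{1+e^{2f_i}}+1}\in(-\infty,0)$ if $\varepsilon_i=1$ (a bijection $\mathbb R\to(-\infty,0)$).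 The function $u$ is also called a discrete conformal factor. The phase space of $u$ is $\mathbb R^N$ in the Euclidean case, and in the hyperbolic case the product over vertices of $\mathbb R$ (if $\varepsilon_i=0$) or $(-\infty,0)$ (if $\varepsilon_i=1$). Curvature: for a discrete conformal factor, $\theta_i^{jk}$ is the inner angle at $i$ of the Euclidean (resp. hyperbolic) triangle $\{ijk\}$ with edge lengths $l_{ij},l_{ik},l_{jk}$, where $l_{st}=\sqrt{\varepsilon_s e^{2f_s}+\varepsilon_t e^{2f_t}+2\eta_{st}e^{f_s+f_t}}$ in the Euclidean case (resp. $l_{st}=\cosh^{-1}\left(\sqrt{(1+\varepsilon_se^{2f_s})(1+\varepsilon_te^{2f_t})}+\eta_{st}e^{f_s+f_t}\right)$ in the hyperbolic case) for each edge $\{st\}$ of the triangle, and $K_i=2\pi-\sum_{\{ijk\}\in F}\theta_i^{jk}$ (sum over faces at $i$) is the combinatorial curvature. $K_{av}=\frac{2\pi\chi(M)}{N}$. Extension: for a face $\{ijk\}$ and arbitrary $f\in\mathbb R^N$, the extended angle $\widetilde\theta_i^{jk}$ equals $\theta_i^{jk}$ if the strict triangle inequalities hold; equals $\pi$ if $l_{jk}\ge l_{ij}+l_{ik}$; and equals $0$ otherwise. These are continuous functions of $f$ (equivalently of $u$). The extended curvature is $\widetilde K_i=2\pi-\sum_{\{ijk\}\in F}\widetilde\theta_i^{jk}$. The extended normalized Euclidean combinatorial Ricci flow is $\frac{du_i}{dt}=K_{av}-\widetilde K_i$; the extended hyperbolic combinatorial Ricci flow is $\frac{du_i}{dt}=-\widetilde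 K_i$; solutions are $C^1$ curves in the phase space. "Converges exponentially fast" means that there are a point $u^*$ of the phase space and constants $C,c>0$ with $\|u(t)-u^*\|\le Ce^{-ct}$ for all $t\ge0$. *)

theory Defs
  imports "HOL-Analysis.Analysis"
begin

text \<open>
  A closed surface glued from finitely many triangles along their edges, as combinatorial data.
  The corners of a triangle \<open>t\<close> are \<open>(t, 0)\<close>, \<open>(t, 1)\<close>, \<open>(t, 2)\<close>, and \<open>(t, i, j)\<close> with \<open>i \<noteq> j\<close> is the
  side of \<open>t\<close> between the corners \<open>i\<close> and \<open>j\<close>, oriented from \<open>i\<close> to \<open>j\<close>.  Up to isotopy, an
  identification of two sides by a homeomorphism is a bijection of their two orientations, so the
  gluing of the sides in pairs is an involution of the oriented sides that commutes with reversal
  and never relates a side to itself.  Vertices and edges are the classes of corners and of oriented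
  sides under the gluing.  Loops, multiple edges and triangles with repeated vertices are allowed.
\<close>

type_synonym 'a corner = "'a \<times> nat"
type_synonym 'a oside = "'a \<times> nat \<times> nat"

record 'a weighted_surface =
  faces :: "'a set"
  glue :: "'a oside \<Rightarrow> 'a oside"
  vweight :: "'a corner set \<Rightarrow> real"
  eweight :: "'a oside set \<Rightarrow> real"

fun tail :: "'a oside \<Rightarrow> 'a corner" where
  "tail (t, i, j) = (t, i)"

fun flip :: "'a oside \<Rightarrow> 'a oside" where
  "flip (t, i, j) = (t, j, i)"

definition corners :: "'a weighted_surface \<Rightarrow> 'a corner set" where
  "corners S = faces S \<times> {..<3}"

definition osides :: "'a weighted_surface \<Rightarrow> 'a oside set" where
  "osides S = {(t, i, j). t \<in> faces S \<and> i < 3 \<and> j < 3 \<and> i \<noteq> j}"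

definition triangulated_closed_surface :: "'a weighted_surface \<Rightarrow> bool" where
  "triangulated_closed_surface S \<longleftrightarrow>
     finite (faces S) \<and> faces S \<noteq> {} \<and>
     (\<forall>d\<in>osides S. glue S d \<in> osides S \<and> glue S (glue S d) = d \<and>
        glue S (flip d) = flip (glue S d) \<and> glue S d \<noteq> d \<and> glue S d \<noteq> flip d)"

definition connected_surface :: "'a weighted_surface \<Rightarrow> bool" where
  "connected_surface S \<longleftrightarrow>
     (\<forall>s\<in>faces S. \<forall>t\<in>faces S. (s, t) \<in> ((\<lambda>d. (fst d, fst (glue S d))) ` osides S)\<^sup>*)"

definition vertex_rel :: "'a weighted_surface \<Rightarrow> 'a corner rel" where
  "vertex_rel S =
     ((\<lambda>d. (tail d, tail (glue S d))) ` osides S)\<^sup>* \<inter> corners S \<times> corners S"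

definition edge_rel :: "'a weighted_surface \<Rightarrow> 'a oside rel" where
  "edge_rel S =
     ((\<lambda>d. (d, glue S d)) ` osides S \<union> (\<lambda>d. (d, flip d)) ` osides S)\<^sup>* \<inter> osides S \<times> osides S"

definition vertices :: "'a weighted_surface \<Rightarrow> 'a corner set set" where
  "vertices S = corners S // vertex_rel S"

definition edges :: "'a weighted_surface \<Rightarrow> 'a oside set set" where
  "edges S = osides S // edge_rel S"

definition vertex_class :: "'a weighted_surface \<Rightarrow> 'a corner \<Rightarrow> 'a corner set" where
  "vertex_class S c = vertex_rel S `` {c}"

definition edge_class :: "'a weighted_surface \<Rightarrow> 'a oside \<Rightarrow> 'a oside set" where
  "edge_class S d = edge_rel S `` {d}"

definition euler_char :: "'a weighted_surface \<Rightarrow> int" where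
  "euler_char S = int (card (vertices S)) - int (card (edges S)) + int (card (faces S))"

definition structure_conditions :: "'a weighted_surface \<Rightarrow> bool" where
  "structure_conditions S \<longleftrightarrow>
     (\<forall>d\<in>osides S. vweight S (vertex_class S (tail d)) * vweight S (vertex_class S (tail (flip d)))
         + eweight S (edge_class S d) > 0) \<and>
     (\<forall>x\<in>faces S. \<forall>q s t. {q, s, t} = {0, 1, 2} \<longrightarrow>
         vweight S (vertex_class S (x, q)) * eweight S (edge_class S (x, s, t))
         + eweight S (edge_class S (x, q, s)) * eweight S (edge_class S (x, q, t)) \<ge> 0)"


datatype geometry = Euclidean | Hyperbolic

fun edge_length :: "geometry \<Rightarrow> real \<Rightarrow> real \<Rightarrow> real \<Rightarrow> real \<Rightarrow> real \<Rightarrow> real" where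
  "edge_length Euclidean \<epsilon>\<^sub>i \<epsilon>\<^sub>j \<eta> x y =
     sqrt (\<epsilon>\<^sub>i * exp (2 * x) + \<epsilon>\<^sub>j * exp (2 * y) + 2 * \<eta> * exp (x + y))"
| "edge_length Hyperbolic \<epsilon>\<^sub>i \<epsilon>\<^sub>j \<eta> x y =
     arcosh (sqrt ((1 + \<epsilon>\<^sub>i * exp (2 * x)) * (1 + \<epsilon>\<^sub>j * exp (2 * y))) + \<eta> * exp (x + y))"

definition side_length ::
  "geometry \<Rightarrow> 'a weighted_surface \<Rightarrow> ('a corner set \<Rightarrow> real) \<Rightarrow> 'a oside \<Rightarrow> real" where
  "side_length G S f d =
     (let v = vertex_class S (tail d); w = vertex_class S (tail (flip d)) in
      edge_length G (vweight S v) (vweight S w) (eweight S (edge_class S d)) (f v) (f w))"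

definition strict_triangle :: "real \<Rightarrow> real \<Rightarrow> real \<Rightarrow> bool" where
  "strict_triangle a b c \<longleftrightarrow> a < b + c \<and> b < a + c \<and> c < a + b"

definition discrete_conformal_factor ::
  "geometry \<Rightarrow> 'a weighted_surface \<Rightarrow> ('a corner set \<Rightarrow> real) \<Rightarrow> bool" where
  "discrete_conformal_factor G S f \<longleftrightarrow>
     (\<forall>t\<in>faces S. strict_triangle (side_length G S f (t, 0, 1)) (side_length G S f (t, 0, 2))
        (side_length G S f (t, 1, 2)))"

text \<open>
  The angle opposite to the side \<open>a\<close> in a triangle with sides \<open>a, b, c\<close>, given by the law of cosines.
\<close>

fun inner_angle :: "geometry \<Rightarrow> real \<Rightarrow> real \<Rightarrow> real \<Rightarrow> real" where
  "inner_angle Euclidean a b c = arccos ((b\<^sup>2 + c\<^sup>2 - a\<^sup>2) / (2 * b * c))"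
| "inner_angle Hyperbolic a b c = arccos ((cosh b * cosh c - cosh a) / (sinh b * sinh c))"

definition ext_angle :: "geometry \<Rightarrow> real \<Rightarrow> real \<Rightarrow> real \<Rightarrow> real" where
  "ext_angle G a b c =
     (if strict_triangle a b c then inner_angle G a b c
      else if a \<ge> b + c then pi else 0)"

definition at_corner ::
  "(real \<Rightarrow> real \<Rightarrow> real \<Rightarrow> real) \<Rightarrow> geometry \<Rightarrow> 'a weighted_surface \<Rightarrow>
   ('a corner set \<Rightarrow> real) \<Rightarrow> 'a corner \<Rightarrow> real" where
  "at_corner angle G S f c =
     (let t = fst c; i = snd c; j = (i + 1) mod 3; k = (i + 2) mod 3 in
      angle (side_length G S f (t, j, k)) (side_length G S f (t, i, j)) (side_length G S f (t, i, k)))"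

text \<open>
  A vertex is the set of its corners, so the sum of the angles at a vertex \<open>v\<close> runs over \<open>c \<in> v\<close>;
  a face with several corners at \<open>v\<close> contributes the angle at each of them.
\<close>

definition curvature ::
  "geometry \<Rightarrow> 'a weighted_surface \<Rightarrow> ('a corner set \<Rightarrow> real) \<Rightarrow> 'a corner set \<Rightarrow> real" where
  "curvature G S f v = 2 * pi - (\<Sum>c\<in>v. at_corner (inner_angle G) G S f c)"

definition ext_curvature ::
  "geometry \<Rightarrow> 'a weighted_surface \<Rightarrow> ('a corner set \<Rightarrow> real) \<Rightarrow> 'a corner set \<Rightarrow> real" where
  "ext_curvature G S f v = 2 * pi - (\<Sum>c\<in>v. at_corner (ext_angle G) G S f c)"

fun target_curvature :: "geometry \<Rightarrow> 'a weighted_surface \<Rightarrow> real" where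
  "target_curvature Euclidean S = 2 * pi * real_of_int (euler_char S) / real (card (vertices S))"
| "target_curvature Hyperbolic S = 0"

definition u_coord :: "geometry \<Rightarrow> real \<Rightarrow> real \<Rightarrow> real" where
  "u_coord G \<epsilon> x =
     (if G = Hyperbolic \<and> \<epsilon> = 1
      then 1 / 2 * ln ((sqrt (1 + exp (2 * x)) - 1) / (sqrt (1 + exp (2 * x)) + 1))
      else x)"

definition phase_space :: "geometry \<Rightarrow> 'a weighted_surface \<Rightarrow> ('a corner set \<Rightarrow> real) set" where
  "phase_space G S = {u. G = Hyperbolic \<longrightarrow> (\<forall>i\<in>vertices S. vweight S i = 1 \<longrightarrow> u i < 0)}"

text \<open>The \<open>f\<close> with \<open>u\<^sub>i = u_coord G \<epsilon>\<^sub>i f\<^sub>i\<close>; meaningful for \<open>u\<close> in the phase space.\<close>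

definition f_of_u ::
  "geometry \<Rightarrow> 'a weighted_surface \<Rightarrow> ('a corner set \<Rightarrow> real) \<Rightarrow> 'a corner set \<Rightarrow> real" where
  "f_of_u G S u i = inv (u_coord G (vweight S i)) (u i)"

definition dcf_u :: "geometry \<Rightarrow> 'a weighted_surface \<Rightarrow> ('a corner set \<Rightarrow> real) \<Rightarrow> bool" where
  "dcf_u G S u \<longleftrightarrow> u \<in> phase_space G S \<and> discrete_conformal_factor G S (f_of_u G S u)"

definition C1_solution ::
  "'a weighted_surface \<Rightarrow> (('a corner set \<Rightarrow> real) \<Rightarrow> 'a corner set \<Rightarrow> real) \<Rightarrow> real set \<Rightarrow>
   (real \<Rightarrow> 'a corner set \<Rightarrow> real) \<Rightarrow> bool" where
  "C1_solution S X I u \<longleftrightarrow>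
     (\<forall>i\<in>vertices S.
        (\<forall>t\<in>I. ((\<lambda>s. u s i) has_real_derivative X (u t) i) (at t within I)) \<and>
        continuous_on I (\<lambda>t. X (u t) i))"

definition ricci_flow_solution ::
  "geometry \<Rightarrow> 'a weighted_surface \<Rightarrow> real set \<Rightarrow> (real \<Rightarrow> 'a corner set \<Rightarrow> real) \<Rightarrow> bool" where
  "ricci_flow_solution G S I u \<longleftrightarrow>
     (\<forall>t\<in>I. dcf_u G S (u t)) \<and>
     C1_solution S (\<lambda>w i. target_curvature G S - curvature G S (f_of_u G S w) i) I u"

definition ext_ricci_flow_solution ::
  "geometry \<Rightarrow> 'a weighted_surface \<Rightarrow> real set \<Rightarrow> (real \<Rightarrow> 'a corner set \<Rightarrow> real) \<Rightarrow> bool" where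
  "ext_ricci_flow_solution G S I u \<longleftrightarrow>
     (\<forall>t\<in>I. u t \<in> phase_space G S) \<and>
     C1_solution S (\<lambda>w i. target_curvature G S - ext_curvature G S (f_of_u G S w) i) I u"

definition time_interval :: "real set \<Rightarrow> bool" where
  "time_interval I \<longleftrightarrow> is_interval I \<and> 0 \<in> I \<and> I \<subseteq> {0..}"

definition converges_exponentially ::
  "geometry \<Rightarrow> 'a weighted_surface \<Rightarrow> (real \<Rightarrow> 'a corner set \<Rightarrow> real) \<Rightarrow> bool" where
  "converges_exponentially G S u \<longleftrightarrow>
     (\<exists>w\<in>phase_space G S. \<exists>C>0. \<exists>c>0. \<forall>t\<ge>0.
        L2_set (\<lambda>i. u t i - w i) (vertices S) \<le> C * exp (- c * t))"

end

theory Submission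
  imports Defs
begin

text \<open>
  In the coordinates \<open>u\<close> the extended angles \<open>\<theta>\<close> of one triangle form a monotone map:
  \<open>\<langle>\<theta>(x) - \<theta>(y), x - y\<rangle> \<le> 0\<close>.  Along a segment the pairing is differentiable wherever the triangle is
  nondegenerate, and it takes finitely many values elsewhere, so this reduces to the definiteness of
  the Jacobian.  Its determinant is a positive multiple of a cubic in the radii that the structure
  conditions make positive (AM-GM).  In the Euclidean case a trace identity then excludes the wrong
  signature.  In the hyperbolic case all radii are scaled up: the triangle stays nondegenerate, the
  determinant never vanishes, and in the limit the matrix becomes diagonally dominant.

  Summing over the faces, the flow field is dissipative.  Hence explicit Euler schemes converge
  (existence), squared distances of solutions decrease (uniqueness), and near an equilibrium the
  strict definiteness gives exponential contraction, which monotonicity along rays extends to balls.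
  In hyperbolic geometry the angle at a vertex tends to zero uniformly as its radius grows, which
  keeps solutions inside the phase space; in Euclidean geometry the Gauss--Bonnet formula confines the
  flow to a hyperplane on which connectedness gives a Poincare inequality.
\<close>

section \<open>Positivity of the conformal cubic\<close>

text \<open>Two obstacles shape the proof. The extended angles are continuous but not Lipschitz
  where a triangle degenerates, because \<open>arccos\<close> has infinite slope at the ends of its
  domain, so Picard iteration gives neither existence nor uniqueness. And a solution may run through
  degenerate triangles, so no argument may rely on the nondegenerate factors forming a convex set.
  Monotonicity on the whole convex phase space answers both. The coordinates u are those in which
  the Jacobian of the angles of a triangle is symmetric, which makes its definiteness a question
  about quadratic forms. One cubic in the radii does double duty: it is a factor of the Jacobian
  determinant, and up to positive factors it is also the derivative of the normalised nondegeneracy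
  determinant when hyperbolic radii are scaled up. This is why the scaling ray never leaves the
  nondegenerate region, and why the shape of that region need not be studied.\<close>

definition structure_triple ::
  "real \<Rightarrow> real \<Rightarrow> real \<Rightarrow> real \<Rightarrow> real \<Rightarrow> real \<Rightarrow> bool" where
  "structure_triple e1 e2 e3 n12 n13 n23 \<longleftrightarrow>
     e1 \<in> {0, 1} \<and> e2 \<in> {0, 1} \<and> e3 \<in> {0, 1} \<and>
     e1 * e2 + n12 > 0 \<and> e1 * e3 + n13 > 0 \<and> e2 * e3 + n23 > 0 \<and>
     e1 * n23 + n12 * n13 \<ge> 0 \<and> e2 * n13 + n12 * n23 \<ge> 0 \<and> e3 * n12 + n13 * n23 \<ge> 0"

text \<open>Serves to read the angles at the second and third corner of a face from statements about
  the first.\<close>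

lemma structure_triple_rotate:
  "structure_triple e1 e2 e3 n12 n13 n23 \<Longrightarrow> structure_triple e2 e3 e1 n23 n12 n13"
  unfolding structure_triple_def by (auto simp: mult.commute add.commute)

lemma mult_sq_sum_ge:
  fixes g x y z :: real
  assumes "g \<ge> 0" "x > 0"
  shows "g * (x * (y\<^sup>2 + z\<^sup>2)) \<ge> 2 * g * (x * y * z)"
proof -
  have "0 \<le> g * (x * (y - z)\<^sup>2)" using assms by simp
  then show ?thesis by (simp add: power2_eq_square algebra_simps)
qed

text \<open>Every coefficient other than that of \<open>t1 * t2 * t3\<close> is a vertex weight
  times one of the \<open>g\<close>, which the second structure condition makes nonnegative; only
  the mixed monomial can have a negative coefficient.\<close>

lemma structure_cubic_expand:
  fixes t1 t2 t3 :: real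
  assumes "structure_triple e1 e2 e3 n12 n13 n23"
  defines "g1 \<equiv> e1 * n23 + n12 * n13" and "g2 \<equiv> e2 * n13 + n12 * n23" and "g3 \<equiv> e3 * n12 + n13 * n23"
  shows "(e1 * t1 + n12 * t2) * (e2 * t2 + n23 * t3) * (e3 * t3 + n13 * t1)
     + (e2 * t2 + n12 * t1) * (e3 * t3 + n23 * t2) * (e1 * t1 + n13 * t3)
     = 2 * (e1 * e2 * e3 + n12 * n13 * n23) * (t1 * t2 * t3)
     + e2 * g1 * t2\<^sup>2 * t1 + e3 * g1 * t3\<^sup>2 * t1 + e1 * g2 * t1\<^sup>2 * t2 + e3 * g2 * t3\<^sup>2 * t2
     + e1 * g3 * t1\<^sup>2 * t3 + e2 * g3 * t2\<^sup>2 * t3"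
  using assms(1) unfolding structure_triple_def g1_def g2_def g3_def
  by (auto simp: power2_eq_square algebra_simps)

text \<open>AM-GM moves the nonnegative monomials into the mixed one until its coefficient factors:
  into twice \<open>(1 + n12) * (1 + n13) * (1 + n23)\<close> if all vertex weights are 1, and into
  twice \<open>n12 * n13 * (1 + n23)\<close> if only \<open>e1\<close> vanishes. The first structure
  condition makes these factors positive. With two vanishing vertex weights the mixed coefficient is
  already twice a product of three positive edge weights.\<close>

lemma structure_cubic_pos:
  fixes t1 t2 t3 :: real
  assumes "structure_triple e1 e2 e3 n12 n13 n23" and t: "t1 > 0" "t2 > 0" "t3 > 0"
  shows "(e1 * t1 + n12 * t2) * (e2 * t2 + n23 * t3) * (e3 * t3 + n13 * t1)
       + (e2 * t2 + n12 * t1) * (e3 * t3 + n23 * t2) * (e1 * t1 + n13 * t3) > 0" (is "?X > 0")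
proof -
  define g1 where "g1 = e1 * n23 + n12 * n13"
  define g2 where "g2 = e2 * n13 + n12 * n23"
  define g3 where "g3 = e3 * n12 + n13 * n23"
  note A = assms(1)[unfolded structure_triple_def, folded g1_def g2_def g3_def]
  note X = structure_cubic_expand[OF assms(1), of t1 t2 t3, folded g1_def g2_def g3_def]
  have ttt: "t1 * t2 * t3 > 0" using t by simp
  have b1: "g1 * (t1 * (t2\<^sup>2 + t3\<^sup>2)) \<ge> 2 * g1 * (t1 * t2 * t3)"
    using A t by (intro mult_sq_sum_ge) auto
  have b2: "g2 * (t2 * (t1\<^sup>2 + t3\<^sup>2)) \<ge> 2 * g2 * (t2 * t1 * t3)"
    using A t by (intro mult_sq_sum_ge) auto
  have b3: "g3 * (t3 * (t1\<^sup>2 + t2\<^sup>2)) \<ge> 2 * g3 * (t3 * t1 * t2)"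
    using A t by (intro mult_sq_sum_ge) auto
  have p: "g1 * t2\<^sup>2 * t1 \<ge> 0" "g1 * t3\<^sup>2 * t1 \<ge> 0" "g2 * t1\<^sup>2 * t2 \<ge> 0" "g2 * t3\<^sup>2 * t2 \<ge> 0"
    "g3 * t1\<^sup>2 * t3 \<ge> 0" "g3 * t2\<^sup>2 * t3 \<ge> 0" using A t by auto
  consider "e1 = 1" "e2 = 1" "e3 = 1" | "e1 = 0" "e2 = 1" "e3 = 1" | "e1 = 1" "e2 = 0" "e3 = 1"
    | "e1 = 1" "e2 = 1" "e3 = 0" | "e1 = 0" "e2 = 0" | "e1 = 0" "e3 = 0" | "e2 = 0" "e3 = 0"
    using A by auto
  then show ?thesis
  proof cases
    case 1
    have "0 < 2 * ((1 + n12) * (1 + n13) * (1 + n23)) * (t1 * t2 * t3)"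
      using A 1 ttt by simp
    also have "\<dots> = 2 * (1 + n12 * n13 * n23) * (t1 * t2 * t3) + 2 * g1 * (t1 * t2 * t3)
      + 2 * g2 * (t2 * t1 * t3) + 2 * g3 * (t3 * t1 * t2)"
      unfolding g1_def g2_def g3_def using 1 by (simp add: algebra_simps)
    also have "\<dots> \<le> ?X" unfolding X using b1 b2 b3 1 by (simp add: algebra_simps)
    finally show ?thesis .
  next
    case 2
    have "0 < 2 * (n12 * n13 * (1 + n23)) * (t1 * t2 * t3)" using A 2 ttt by simp
    also have "\<dots> = 2 * (n12 * n13 * n23) * (t1 * t2 * t3) + 2 * g1 * (t1 * t2 * t3)"
      unfolding g1_def using 2 by (simp add: algebra_simps)
    also have "\<dots> \<le> ?X" unfolding X using b1 p 2 by (simp add: algebra_simps)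
    finally show ?thesis .
  next
    case 3
    have "0 < 2 * (n12 * n23 * (1 + n13)) * (t1 * t2 * t3)" using A 3 ttt by simp
    also have "\<dots> = 2 * (n12 * n13 * n23) * (t1 * t2 * t3) + 2 * g2 * (t2 * t1 * t3)"
      unfolding g2_def using 3 by (simp add: algebra_simps)
    also have "\<dots> \<le> ?X" unfolding X using b2 p 3 by (simp add: algebra_simps)
    finally show ?thesis .
  next
    case 4
    have "0 < 2 * (n13 * n23 * (1 + n12)) * (t1 * t2 * t3)" using A 4 ttt by simp
    also have "\<dots> = 2 * (n12 * n13 * n23) * (t1 * t2 * t3) + 2 * g3 * (t3 * t1 * t2)"
      unfolding g3_def using 4 by (simp add: algebra_simps)
    also have "\<dots> \<le> ?X" unfolding X using b3 p 4 by (simp add: algebra_simps)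
    finally show ?thesis .
  next
    case 5
    then have "0 < 2 * (n12 * n13 * n23) * (t1 * t2 * t3)" using A ttt by simp
    then show ?thesis unfolding X using p 5 A by auto
  next
    case 6
    then have "0 < 2 * (n12 * n13 * n23) * (t1 * t2 * t3)" using A ttt by simp
    then show ?thesis unfolding X using p 6 A by auto
  next
    case 7
    then have "0 < 2 * (n12 * n13 * n23) * (t1 * t2 * t3)" using A ttt by simp
    then show ?thesis unfolding X using p 7 A by auto
  qed
qed

text \<open>The form with edge weights w on a triangle has determinant W on differences, hence a
  definite sign, and S plays the role of a trace that excludes the negative one. If
  \<open>w1 + w2\<close> were negative, S and W would make a quadratic form in \<open>w1\<close>,
  \<open>w2\<close> negative whose discriminant is minus the left-hand side of A, although such a
  form is positive. For squared side lengths q, A says by Heron's formula that the triangle has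
  positive area.\<close>

lemma weighted_triangle_pair_sum_pos:
  fixes w1 w2 w3 q1 q2 q3 :: real
  assumes S: "w1 * q1 + w2 * q2 + w3 * q3 > 0" and W: "w1 * w2 + w1 * w3 + w2 * w3 > 0"
    and q: "q1 > 0" "q2 > 0" "q3 > 0"
    and A: "2 * q1 * q2 + 2 * q1 * q3 + 2 * q2 * q3 - q1\<^sup>2 - q2\<^sup>2 - q3\<^sup>2 > 0"
  shows "w1 + w2 > 0"
proof (rule ccontr)
  assume "\<not> w1 + w2 > 0"
  moreover have "w1 + w2 \<noteq> 0"
  proof
    assume "w1 + w2 = 0"
    then have "w2 = - w1" by simp
    with W show False by (simp add: algebra_simps)
  qed
  ultimately have neg: "w1 + w2 < 0" by simp
  have "q3 * (w1 * w2 + w1 * w3 + w2 * w3) > 0" using W q by simp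
  moreover have "(w1 + w2) * (w1 * q1 + w2 * q2 + w3 * q3) < 0"
    using neg S by (simp add: mult_neg_pos)
  ultimately have "w1\<^sup>2 * q1 + w2\<^sup>2 * q2 + w1 * w2 * (q1 + q2 - q3) < 0"
    by (simp add: algebra_simps power2_eq_square)
  moreover have "4 * q1 * (w1\<^sup>2 * q1 + w2\<^sup>2 * q2 + w1 * w2 * (q1 + q2 - q3)) =
     (2 * q1 * w1 + w2 * (q1 + q2 - q3))\<^sup>2
     + w2\<^sup>2 * (2 * q1 * q2 + 2 * q1 * q3 + 2 * q2 * q3 - q1\<^sup>2 - q2\<^sup>2 - q3\<^sup>2)"
    by (simp add: algebra_simps power2_eq_square)
  ultimately show False using q A
    by (smt (verit) mult_nonneg_nonneg mult_pos_neg zero_le_power2)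
qed

text \<open>Completing the square bounds the form below by \<open>W' / (w1 + w2)\<close> times
  \<open>(x - y)\<^sup>2\<close>; this quotient is the effective conductance between two vertices of
  a triangle with edge conductances w. Averaging the three bounds of this kind is the origin of the
  division by 3 in \<open>c\<close>.\<close>

lemma weighted_triangle_coercive:
  fixes w1 w2 w3 q1 q2 q3 :: real
  assumes S: "w1 * q1 + w2 * q2 + w3 * q3 > 0" and W: "w1 * w2 + w1 * w3 + w2 * w3 > 0"
    and q: "q1 > 0" "q2 > 0" "q3 > 0"
    and A: "2 * q1 * q2 + 2 * q1 * q3 + 2 * q2 * q3 - q1\<^sup>2 - q2\<^sup>2 - q3\<^sup>2 > 0"
  shows "\<exists>c>0. \<forall>x y z. w1 * (y - z)\<^sup>2 + w2 * (x - z)\<^sup>2 + w3 * (x - y)\<^sup>2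
           \<ge> c * ((x - y)\<^sup>2 + (x - z)\<^sup>2 + (y - z)\<^sup>2)"
proof -
  have bound: "b1 * (y - z)\<^sup>2 + b2 * (x - z)\<^sup>2 + b3 * (x - y)\<^sup>2
      \<ge> (b1 * b2 + b1 * b3 + b2 * b3) / (b1 + b2) * (x - y)\<^sup>2"
    if "b1 + b2 > 0" for b1 b2 b3 x y z :: real
  proof -
    have "(b1 + b2) * (b1 * (y - z)\<^sup>2 + b2 * (x - z)\<^sup>2 + b3 * (x - y)\<^sup>2)
       = (b1 * (y - z) + b2 * (x - z))\<^sup>2 + (b1 * b2 + b1 * b3 + b2 * b3) * (x - y)\<^sup>2"
      by (simp add: algebra_simps power2_eq_square)
    then have "(b1 + b2) * (b1 * (y - z)\<^sup>2 + b2 * (x - z)\<^sup>2 + b3 * (x - y)\<^sup>2)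
       \<ge> (b1 * b2 + b1 * b3 + b2 * b3) * (x - y)\<^sup>2"
      using zero_le_power2[of "b1 * (y - z) + b2 * (x - z)"] by linarith
    then show ?thesis using that by (simp add: divide_simps mult.commute)
  qed
  define W' where "W' = w1 * w2 + w1 * w3 + w2 * w3"
  have s12: "w1 + w2 > 0" using weighted_triangle_pair_sum_pos[OF S W q A] .
  have s13: "w1 + w3 > 0"
    by (rule weighted_triangle_pair_sum_pos[of w1 q1 w3 q3 w2 q2])
      (use S W q A in \<open>simp_all add: algebra_simps\<close>)
  have s23: "w2 + w3 > 0"
    by (rule weighted_triangle_pair_sum_pos[of w2 q2 w3 q3 w1 q1])
      (use S W q A in \<open>simp_all add: algebra_simps\<close>)
  define c where "c = Min {W' / (w1 + w2), W' / (w1 + w3), W' / (w2 + w3)} / 3"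
  have c: "c > 0" "3 * c \<le> W' / (w1 + w2)" "3 * c \<le> W' / (w1 + w3)" "3 * c \<le> W' / (w2 + w3)"
    unfolding c_def using s12 s13 s23 W by (auto simp: W'_def)
  show ?thesis
  proof (intro exI[of _ c] conjI allI)
    fix x y z
    let ?E = "w1 * (y - z)\<^sup>2 + w2 * (x - z)\<^sup>2 + w3 * (x - y)\<^sup>2"
    have "W' / (w1 + w2) * (x - y)\<^sup>2 \<le> ?E" using bound[OF s12, where x = x and y = y and z = z and ?b3.0 = w3] by (simp add: W'_def)
    moreover have "W' / (w1 + w3) * (x - z)\<^sup>2 \<le> ?E"
      using bound[OF s13, where x = x and y = z and z = y and ?b3.0 = w2]
      by (simp add: W'_def algebra_simps power2_commute)
    moreover have "W' / (w2 + w3) * (y - z)\<^sup>2 \<le> ?E"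
      using bound[OF s23, where x = y and y = z and z = x and ?b3.0 = w1]
      by (simp add: W'_def algebra_simps power2_commute)
    moreover have "3 * c * (x - y)\<^sup>2 \<le> W' / (w1 + w2) * (x - y)\<^sup>2"
      "3 * c * (x - z)\<^sup>2 \<le> W' / (w1 + w3) * (x - z)\<^sup>2"
      "3 * c * (y - z)\<^sup>2 \<le> W' / (w2 + w3) * (y - z)\<^sup>2"
      by (rule mult_right_mono[OF c(2) zero_le_power2], rule mult_right_mono[OF c(3) zero_le_power2],
        rule mult_right_mono[OF c(4) zero_le_power2])
    ultimately show "?E \<ge> c * ((x - y)\<^sup>2 + (x - z)\<^sup>2 + (y - z)\<^sup>2)"
      by (simp add: distrib_left)
  qed (fact c)
qed

section \<open>The Euclidean angle form\<close>

text \<open>With q the squared length of an edge and d the difference of the other two, this is the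
  part of the angle form that is divided by q. Only the multiple of \<open>(h - k)\<^sup>2\<close>
  keeps a quotient; the polynomial rest combines with the other edges in
  \<open>euclidean_form_neg\<close>.\<close>

lemma euclidean_edge_term:
  fixes q :: real
  assumes "q = D + D'" "q \<noteq> 0"
  shows "(D * h + D' * k) * (h * (q + d) + k * (q - d)) / q =
    h * (q * (h + k) + d * (h - k)) - D' * (h\<^sup>2 - k\<^sup>2) - D' * d / q * (h - k)\<^sup>2"
proof -
  have "(D * h + D' * k) * (h * (q + d) + k * (q - d)) =
    q * (h * (q * (h + k) + d * (h - k)) - D' * (h\<^sup>2 - k\<^sup>2)) - D' * d * (h - k)\<^sup>2"
    unfolding assms(1) by (simp add: algebra_simps power2_eq_square)
  then show ?thesis using assms(2) by (simp add: divide_simps)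
qed

text \<open>The relation between \<open>x, \<dots>, v\<close> is the concurrency of the three radical axes of the vertex circles.\<close>

lemma euclidean_weight_product:
  fixes x y z w v u :: real
  assumes "u = v + x - y + z - w" and q: "q12 = x + y" "q13 = u + v" "q23 = z + w"
    and k: "k1 = 2 * q23 * v - w * (q23 + q13 - q12)" "k2 = 2 * q13 * x - u * (q13 + q12 - q23)"
      "k3 = 2 * q12 * z - y * (q12 + q23 - q13)"
  shows "k1 * k2 * q12 + k1 * k3 * q13 + k2 * k3 * q23 =
   (2 * q12 * q13 + 2 * q12 * q23 + 2 * q13 * q23 - q12\<^sup>2 - q13\<^sup>2 - q23\<^sup>2) * (x * z * v + y * w * u)"
  unfolding k q assms(1) by (simp add: algebra_simps power2_eq_square)

text \<open>Here q are squared lengths and y their variations in the direction h; divided by the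
  square root of the expression in A, the brackets are the variations of the angles. The form is
  minus a weighted Laplacian of the triangle with weights \<open>k1 / q23\<close>,
  \<open>k2 / q13\<close>, \<open>k3 / q12\<close>. Weighted by q these sum to half of that
  expression, and their pairwise products sum to it times the cubic in X over
  \<open>q12 * q13 * q23\<close>, which is what \<open>weighted_triangle_coercive\<close> asks
  for.\<close>

lemma euclidean_form_neg:
  fixes a1 a2 a3 m12 m13 m23 :: real
  defines "q12 \<equiv> a1 + a2 + 2 * m12" and "q13 \<equiv> a1 + a3 + 2 * m13" and "q23 \<equiv> a2 + a3 + 2 * m23"
  assumes q: "q12 > 0" "q13 > 0" "q23 > 0"
    and A: "2 * q12 * q13 + 2 * q12 * q23 + 2 * q13 * q23 - q12\<^sup>2 - q13\<^sup>2 - q23\<^sup>2 > 0"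
    and X: "(a1 + m12) * (a2 + m23) * (a3 + m13) + (a2 + m12) * (a3 + m23) * (a1 + m13) > 0"
  shows "\<exists>c>0. \<forall>h1 h2 h3 y12 y13 y23.
    y12 = 2 * ((a1 + m12) * h1 + (a2 + m12) * h2) \<longrightarrow>
    y13 = 2 * ((a1 + m13) * h1 + (a3 + m13) * h3) \<longrightarrow>
    y23 = 2 * ((a2 + m23) * h2 + (a3 + m23) * h3) \<longrightarrow>
      h1 * (y23 - y12 * (q12 - q13 + q23) / (2 * q12) - y13 * (q13 - q12 + q23) / (2 * q13))
    + h2 * (y13 - y23 * (q23 - q12 + q13) / (2 * q23) - y12 * (q12 - q23 + q13) / (2 * q12))
    + h3 * (y12 - y13 * (q13 - q23 + q12) / (2 * q13) - y23 * (q23 - q13 + q12) / (2 * q23))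
    \<le> - c * ((h1 - h2)\<^sup>2 + (h1 - h3)\<^sup>2 + (h2 - h3)\<^sup>2)"
proof -
  define k1 where "k1 = 2 * q23 * (a3 + m13) - (a3 + m23) * (q23 + q13 - q12)"
  define k2 where "k2 = 2 * q13 * (a1 + m12) - (a1 + m13) * (q13 + q12 - q23)"
  define k3 where "k3 = 2 * q12 * (a2 + m23) - (a2 + m12) * (q12 + q23 - q13)"
  let ?A = "2 * q12 * q13 + 2 * q12 * q23 + 2 * q13 * q23 - q12\<^sup>2 - q13\<^sup>2 - q23\<^sup>2"
  let ?X = "(a1 + m12) * (a2 + m23) * (a3 + m13) + (a2 + m12) * (a3 + m23) * (a1 + m13)"
  have "2 * (k1 + k2 + k3) = ?A"
    unfolding k1_def k2_def k3_def q12_def q13_def q23_def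
    by (simp add: algebra_simps power2_eq_square)
  then have S: "(k1 / q23) * q23 + (k2 / q13) * q13 + (k3 / q12) * q12 > 0" using A q by simp
  have "k1 * k2 * q12 + k1 * k3 * q13 + k2 * k3 * q23 = ?A * ?X"
    by (rule euclidean_weight_product[OF _ _ _ _ k1_def k2_def k3_def])
       (simp_all add: q12_def q13_def q23_def)
  moreover have "?A * ?X > 0" using A X by simp
  moreover have "(k1 / q23) * (k2 / q13) + (k1 / q23) * (k3 / q12) + (k2 / q13) * (k3 / q12)
      = (k1 * k2 * q12 + k1 * k3 * q13 + k2 * k3 * q23) / (q12 * q13 * q23)"
    using q by (simp add: divide_simps)
  ultimately have W: "(k1 / q23) * (k2 / q13) + (k1 / q23) * (k3 / q12) + (k2 / q13) * (k3 / q12) > 0"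
    using q by simp
  obtain c where c: "c > 0" and le: "\<And>x y z. (k1 / q23) * (y - z)\<^sup>2 + (k2 / q13) * (x - z)\<^sup>2
      + (k3 / q12) * (x - y)\<^sup>2 \<ge> c * ((x - y)\<^sup>2 + (x - z)\<^sup>2 + (y - z)\<^sup>2)"
    using weighted_triangle_coercive[OF S W] q A by (auto simp: algebra_simps)
  show ?thesis
  proof (intro exI[of _ c] conjI allI impI)
    fix h1 h2 h3 y12 y13 y23
    assume y: "y12 = 2 * ((a1 + m12) * h1 + (a2 + m12) * h2)"
      "y13 = 2 * ((a1 + m13) * h1 + (a3 + m13) * h3)"
      "y23 = 2 * ((a2 + m23) * h2 + (a3 + m23) * h3)"
    have e12: "y12 / 2 * (h1 * (q12 + (q23 - q13)) + h2 * (q12 - (q23 - q13))) / q12 =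
      h1 * (q12 * (h1 + h2) + (q23 - q13) * (h1 - h2)) - (a2 + m12) * (h1\<^sup>2 - h2\<^sup>2)
       - (a2 + m12) * (q23 - q13) / q12 * (h1 - h2)\<^sup>2"
    proof -
      have "y12 / 2 = (a1 + m12) * h1 + (a2 + m12) * h2" by (simp add: y)
      then show ?thesis using q by (simp only:) (rule euclidean_edge_term, simp_all add: q12_def)
    qed
    have e13: "y13 / 2 * (h3 * (q13 + (q12 - q23)) + h1 * (q13 - (q12 - q23))) / q13 =
      h3 * (q13 * (h3 + h1) + (q12 - q23) * (h3 - h1)) - (a1 + m13) * (h3\<^sup>2 - h1\<^sup>2)
       - (a1 + m13) * (q12 - q23) / q13 * (h3 - h1)\<^sup>2"
    proof -
      have "y13 / 2 = (a3 + m13) * h3 + (a1 + m13) * h1" by (simp add: y)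
      then show ?thesis using q by (simp only:) (rule euclidean_edge_term, simp_all add: q13_def)
    qed
    have e23: "y23 / 2 * (h2 * (q23 + (q13 - q12)) + h3 * (q23 - (q13 - q12))) / q23 =
      h2 * (q23 * (h2 + h3) + (q13 - q12) * (h2 - h3)) - (a3 + m23) * (h2\<^sup>2 - h3\<^sup>2)
       - (a3 + m23) * (q13 - q12) / q23 * (h2 - h3)\<^sup>2"
    proof -
      have "y23 / 2 = (a2 + m23) * h2 + (a3 + m23) * h3" by (simp add: y)
      then show ?thesis using q by (simp only:) (rule euclidean_edge_term, simp_all add: q23_def)
    qed
    have k: "k3 / q12 = 2 * (a2 + m23) - (a2 + m12) - (a2 + m12) * (q23 - q13) / q12"
      "k2 / q13 = 2 * (a1 + m12) - (a1 + m13) - (a1 + m13) * (q12 - q23) / q13"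
      "k1 / q23 = 2 * (a3 + m13) - (a3 + m23) - (a3 + m23) * (q13 - q12) / q23"
      unfolding k1_def k2_def k3_def using q by (auto simp: field_simps)
    \<comment> \<open>Opaque names for the remaining quotients leave a polynomial identity.\<close>
    define z12 where "z12 = (a2 + m12) * (q23 - q13) / q12"
    define z13 where "z13 = (a1 + m13) * (q12 - q23) / q13"
    define z23 where "z23 = (a3 + m23) * (q13 - q12) / q23"
    have "h1 * (y23 - y12 * (q12 - q13 + q23) / (2 * q12) - y13 * (q13 - q12 + q23) / (2 * q13))
      + h2 * (y13 - y23 * (q23 - q12 + q13) / (2 * q23) - y12 * (q12 - q23 + q13) / (2 * q12))
      + h3 * (y12 - y13 * (q13 - q23 + q12) / (2 * q13) - y23 * (q23 - q13 + q12) / (2 * q23))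
      = h1 * y23 + h2 * y13 + h3 * y12
       - y12 / 2 * (h1 * (q12 + (q23 - q13)) + h2 * (q12 - (q23 - q13))) / q12
       - y13 / 2 * (h3 * (q13 + (q12 - q23)) + h1 * (q13 - (q12 - q23))) / q13
       - y23 / 2 * (h2 * (q23 + (q13 - q12)) + h3 * (q23 - (q13 - q12))) / q23"
      using q by (simp add: add_divide_distrib diff_divide_distrib algebra_simps)
    also have "\<dots> = - ((k1 / q23) * (h2 - h3)\<^sup>2 + (k2 / q13) * (h1 - h3)\<^sup>2 + (k3 / q12) * (h1 - h2)\<^sup>2)"
      unfolding e12 e13 e23 k
      unfolding z12_def[symmetric] z13_def[symmetric] z23_def[symmetric]
      unfolding y q12_def q13_def q23_def
      by (simp add: algebra_simps power2_eq_square)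
    also have "\<dots> \<le> - c * ((h1 - h2)\<^sup>2 + (h1 - h3)\<^sup>2 + (h2 - h3)\<^sup>2)" using le[where x = h1 and y = h2 and z = h3] by simp
    finally show "h1 * (y23 - y12 * (q12 - q13 + q23) / (2 * q12) - y13 * (q13 - q12 + q23) / (2 * q13))
      + h2 * (y13 - y23 * (q23 - q12 + q13) / (2 * q23) - y12 * (q12 - q23 + q13) / (2 * q12))
      + h3 * (y12 - y13 * (q13 - q23 + q12) / (2 * q13) - y23 * (q23 - q13 + q12) / (2 * q23))
      \<le> - c * ((h1 - h2)\<^sup>2 + (h1 - h3)\<^sup>2 + (h2 - h3)\<^sup>2)" .
  qed (fact c)
qed

section \<open>Quadratic forms in three variables\<close>

definition quad3 :: "real \<Rightarrow> real \<Rightarrow> real \<Rightarrow> real \<Rightarrow> real \<Rightarrow> real \<Rightarrow> real \<Rightarrow> real \<Rightarrow> real \<Rightarrow> real" where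
  "quad3 a b c f g h x y z = a * x\<^sup>2 + b * y\<^sup>2 + c * z\<^sup>2 + 2 * f * x * y + 2 * g * x * z + 2 * h * y * z"

lemma quad3_scale: "quad3 a b c f g h (s * x) (s * y) (s * z) = s\<^sup>2 * quad3 a b c f g h x y z"
  unfolding quad3_def by (simp add: algebra_simps power2_eq_square)

text \<open>The form attains a positive minimum on the compact unit sphere, and homogeneity of
  degree two carries it to all vectors.\<close>

lemma quad3_coercive:
  assumes pos: "\<And>x y z. (x, y, z) \<noteq> (0, 0, 0) \<Longrightarrow> quad3 a b c f g h x y z > 0"
  shows "\<exists>d>0. \<forall>x y z. quad3 a b c f g h x y z \<ge> d * (x\<^sup>2 + y\<^sup>2 + z\<^sup>2)"
proof -
  let ?S = "sphere (0 :: real \<times> real \<times> real) 1"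
  have nrm: "(norm (x, y, z))\<^sup>2 = x\<^sup>2 + y\<^sup>2 + z\<^sup>2" for x y z :: real
    by (simp add: norm_Pair)
  have "(1, 0, 0) \<in> ?S" by (simp add: norm_Pair)
  then have ne: "?S \<noteq> {}" by blast
  have cont: "continuous_on ?S (\<lambda>p. quad3 a b c f g h (fst p) (fst (snd p)) (snd (snd p)))"
    unfolding quad3_def by (intro continuous_intros)
  obtain p where p: "p \<in> ?S" and min: "\<And>q. q \<in> ?S \<Longrightarrow>
     quad3 a b c f g h (fst p) (fst (snd p)) (snd (snd p))
     \<le> quad3 a b c f g h (fst q) (fst (snd q)) (snd (snd q))"
    using continuous_attains_inf[OF compact_sphere ne cont] by blast
  define d where "d = quad3 a b c f g h (fst p) (fst (snd p)) (snd (snd p))"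
  have d: "d > 0" unfolding d_def using p by (intro pos) (cases p, auto)
  show ?thesis
  proof (intro exI[of _ d] conjI allI)
    fix x y z :: real
    define n where "n = norm (x, y, z)"
    show "quad3 a b c f g h x y z \<ge> d * (x\<^sup>2 + y\<^sup>2 + z\<^sup>2)"
    proof (cases "n = 0")
      case True
      then show ?thesis by (auto simp: n_def quad3_def zero_prod_def)
    next
      case False
      have "inverse n *\<^sub>R (x, y, z) \<in> ?S" using False by (simp add: n_def[symmetric] del: scaleR_Pair)
         (simp add: n_def)
      from min[OF this] have "d \<le> quad3 a b c f g h (inverse n * x) (inverse n * y) (inverse n * z)"
        by (simp add: d_def)
      then have "d * n\<^sup>2 \<le> (inverse n)\<^sup>2 * quad3 a b c f g h x y z * n\<^sup>2"
        unfolding quad3_scale by (rule mult_right_mono) simp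
      also have "\<dots> = quad3 a b c f g h x y z"
        using False by (simp add: power_inverse)
      finally show ?thesis by (simp add: n_def nrm)
    qed
  qed (fact d)
qed

text \<open>A zero of a nonnegative form is a minimum, so the gradient vanishes there.\<close>

lemma quad3_semidefinite_kernel:
  assumes nonneg: "\<And>x y z. quad3 a b c f g h x y z \<ge> 0" and zero: "quad3 a b c f g h x y z = 0"
  shows "a * x + f * y + g * z = 0" "f * x + b * y + h * z = 0" "g * x + h * y + c * z = 0"
proof -
  have lin: "u = 0" if "\<And>s. 2 * s * u + s\<^sup>2 * v \<ge> 0" for u v :: real
  proof (rule ccontr)
    assume u: "u \<noteq> 0"
    \<comment> \<open>At \<open>s = - u / w\<close> the linear term outweighs the quadratic one,
      since w exceeds v.\<close>
    define w where "w = \<bar>v\<bar> + 1"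
    have w: "w > 0" "v < w" by (auto simp: w_def)
    have "2 * (- u / w) * u + (- u / w)\<^sup>2 * v = u\<^sup>2 / w * (v / w - 2)"
      using w by (simp add: field_simps power2_eq_square)
    moreover have "v / w - 2 < 0" using w by (simp add: divide_simps)
    moreover have "u\<^sup>2 / w > 0" using u w by simp
    ultimately have "2 * (- u / w) * u + (- u / w)\<^sup>2 * v < 0" by (metis mult_pos_neg)
    with that[of "- u / w"] show False by simp
  qed
  have ex: "quad3 a b c f g h (x + s * x') (y + s * y') (z + s * z') = quad3 a b c f g h x y z
     + 2 * s * ((a * x + f * y + g * z) * x' + (f * x + b * y + h * z) * y' + (g * x + h * y + c * z) * z')
     + s\<^sup>2 * quad3 a b c f g h x' y' z'" for s x' y' z'
    unfolding quad3_def by (simp add: algebra_simps power2_eq_square)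
  have *: "(a * x + f * y + g * z) * x' + (f * x + b * y + h * z) * y' + (g * x + h * y + c * z) * z' = 0"
    for x' y' z'
    by (rule lin[of _ "quad3 a b c f g h x' y' z'"]) (use nonneg ex zero in \<open>metis add_0\<close>)
  show "a * x + f * y + g * z = 0" "f * x + b * y + h * z = 0" "g * x + h * y + c * z = 0"
    using *[of 1 0 0] *[of 0 1 0] *[of 0 0 1] by auto
qed

text \<open>Each diagonal entry is shared equally between its two mixed terms; the factor 4 is what
  makes the 2 by 2 blocks with halved diagonal definite.\<close>

lemma quad3_diag_dominant:
  fixes a b c f g h x y z :: real
  assumes d: "a > 0" "b > 0" "c > 0" and o: "4 * f\<^sup>2 < a * b" "4 * g\<^sup>2 < a * c" "4 * h\<^sup>2 < b * c"
    and ne: "(x, y, z) \<noteq> (0, 0, 0)"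
  shows "quad3 a b c f g h x y z > 0"
proof -
  have le: "2 * k * s * t \<ge> - (u * s\<^sup>2 + v * t\<^sup>2) / 2" if "u > 0" "v > 0" "4 * k\<^sup>2 < u * v" for k u v s t :: real
  proof -
    have "(u * s + 2 * k * t)\<^sup>2 + (u * v - 4 * k\<^sup>2) * t\<^sup>2 \<ge> 0" using that by simp
    then have "u * (u * s\<^sup>2 + 4 * k * s * t + v * t\<^sup>2) \<ge> 0" by (simp add: algebra_simps power2_eq_square)
    then show ?thesis using that(1) by (simp add: zero_le_mult_iff)
  qed
  have lt: "2 * k * s * t > - (u * s\<^sup>2 + v * t\<^sup>2) / 2"
    if "u > 0" "v > 0" "4 * k\<^sup>2 < u * v" "(s, t) \<noteq> (0, 0)" for k u v s t :: real
  proof -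
    have "(u * s + 2 * k * t)\<^sup>2 + (u * v - 4 * k\<^sup>2) * t\<^sup>2 > 0"
    proof (cases "t = 0")
      case False
      then have "(u * v - 4 * k\<^sup>2) * t\<^sup>2 > 0" using that by simp
      then show ?thesis by (simp add: add_nonneg_pos)
    qed (use that in auto)
    then have "u * (u * s\<^sup>2 + 4 * k * s * t + v * t\<^sup>2) > 0" by (simp add: algebra_simps power2_eq_square)
    then show ?thesis using that(1) by (simp add: zero_less_mult_iff)
  qed
  have "2 * f * x * y \<ge> - (a * x\<^sup>2 + b * y\<^sup>2) / 2" "2 * g * x * z \<ge> - (a * x\<^sup>2 + c * z\<^sup>2) / 2"
    "2 * h * y * z \<ge> - (b * y\<^sup>2 + c * z\<^sup>2) / 2"
    using le d o by auto
  \<comment> \<open>One strict inequality suffices: a nonzero vector has a nonzero entry in the pair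
    (x, y) or in the pair (x, z).\<close>
  moreover have "2 * f * x * y > - (a * x\<^sup>2 + b * y\<^sup>2) / 2 \<or> 2 * g * x * z > - (a * x\<^sup>2 + c * z\<^sup>2) / 2"
    using ne lt[of a b f x y] lt[of a c g x z] d o by auto
  ultimately show ?thesis unfolding quad3_def by argo
qed

section \<open>Continuation of positive definiteness\<close>

text \<open>Each coordinate enters one square and two mixed terms, so perturbations below
  \<open>d / 4\<close> consume at most three quarters of the coercivity constant d.\<close>

lemma quad3_pos_eventually:
  fixes a b c f g h :: "'x \<Rightarrow> real"
  assumes lim: "(a \<longlongrightarrow> a0) F" "(b \<longlongrightarrow> b0) F" "(c \<longlongrightarrow> c0) F"
      "(f \<longlongrightarrow> f0) F" "(g \<longlongrightarrow> g0) F" "(h \<longlongrightarrow> h0) F"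
    and pos: "\<And>x y z. (x, y, z) \<noteq> (0, 0, 0) \<Longrightarrow> quad3 a0 b0 c0 f0 g0 h0 x y z > 0"
  shows "\<forall>\<^sub>F m in F. \<forall>x y z. (x, y, z) \<noteq> (0, 0, 0) \<longrightarrow>
    quad3 (a m) (b m) (c m) (f m) (g m) (h m) x y z > 0"
proof -
  obtain d where d: "d > 0" and co: "\<And>x y z. quad3 a0 b0 c0 f0 g0 h0 x y z \<ge> d * (x\<^sup>2 + y\<^sup>2 + z\<^sup>2)"
    using quad3_coercive[OF pos] by blast
  have ev: "\<forall>\<^sub>F m in F. \<bar>k m - k0\<bar> < d / 4" if "(k \<longlongrightarrow> k0) F" for k k0
    using tendstoD[OF that, of "d / 4"] d by (simp add: dist_real_def)
  have "\<forall>\<^sub>F m in F. \<bar>a m - a0\<bar> < d / 4 \<and> \<bar>b m - b0\<bar> < d / 4 \<and> \<bar>c m - c0\<bar> < d / 4 \<and>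
      \<bar>f m - f0\<bar> < d / 4 \<and> \<bar>g m - g0\<bar> < d / 4 \<and> \<bar>h m - h0\<bar> < d / 4"
    by (intro eventually_conj ev lim)
  then show ?thesis
  proof (rule eventually_mono, intro allI impI)
    fix m x y z
    assume m: "\<bar>a m - a0\<bar> < d / 4 \<and> \<bar>b m - b0\<bar> < d / 4 \<and> \<bar>c m - c0\<bar> < d / 4 \<and>
      \<bar>f m - f0\<bar> < d / 4 \<and> \<bar>g m - g0\<bar> < d / 4 \<and> \<bar>h m - h0\<bar> < d / 4"
      and ne: "(x, y, z) \<noteq> ((0::real), (0::real), (0::real))"
    have sq: "k * t\<^sup>2 \<ge> - (d / 4) * t\<^sup>2" if "\<bar>k\<bar> < d / 4" for k t :: real
      using that by (intro mult_right_mono) auto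
    have pr: "2 * k * s * t \<ge> - (d / 4) * (s\<^sup>2 + t\<^sup>2)" if "\<bar>k\<bar> < d / 4" for k s t :: real
    proof -
      have "2 * \<bar>s * t\<bar> \<le> s\<^sup>2 + t\<^sup>2"
        using sum_squares_bound[of s t] sum_squares_bound[of s "- t"] by (auto simp: abs_if)
      then have "\<bar>k\<bar> * (2 * \<bar>s * t\<bar>) \<le> d / 4 * (s\<^sup>2 + t\<^sup>2)" using that by (intro mult_mono) auto
      moreover have "2 * k * s * t \<ge> - (\<bar>k\<bar> * (2 * \<bar>s * t\<bar>))"
        using abs_ge_minus_self[of "2 * k * s * t"] by (simp add: abs_mult ac_simps)
      ultimately show ?thesis by simp
    qed
    have "quad3 (a m) (b m) (c m) (f m) (g m) (h m) x y z = quad3 a0 b0 c0 f0 g0 h0 x y z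
      + (a m - a0) * x\<^sup>2 + (b m - b0) * y\<^sup>2 + (c m - c0) * z\<^sup>2 + 2 * (f m - f0) * x * y
      + 2 * (g m - g0) * x * z + 2 * (h m - h0) * y * z"
      unfolding quad3_def by (simp add: algebra_simps)
    moreover have "d * (x\<^sup>2 + y\<^sup>2 + z\<^sup>2) > 0" using d ne
      by (auto simp: zero_less_mult_iff add_pos_nonneg add_nonneg_pos)
    moreover note co[of x y z] sq[of "a m - a0" x] sq[of "b m - b0" y] sq[of "c m - c0" z]
      pr[of "f m - f0" x y] pr[of "g m - g0" x z] pr[of "h m - h0" y z]
    ultimately show "quad3 (a m) (b m) (c m) (f m) (g m) (h m) x y z > 0"
      using m by (simp add: algebra_simps)
  qed
qed

text \<open>Definiteness in a continuous family can be lost only at a degenerate member.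
  \<open>B\<close> collects the parameters without positivity. At its infimum the form is a limit of
  positive forms from the left, hence semidefinite, and by \<open>nondeg\<close> definite; then
  positivity persists a little further to the right, against the choice of the infimum.\<close>

lemma quad3_pos_continuation:
  fixes a b c f g h :: "real \<Rightarrow> real"
  assumes cont: "\<And>m. 0 < m \<Longrightarrow> m \<le> 1 \<Longrightarrow> isCont a m \<and> isCont b m \<and> isCont c m \<and>
      isCont f m \<and> isCont g m \<and> isCont h m"
    and small: "\<forall>\<^sub>F m in at_right 0. \<forall>x y z. (x, y, z) \<noteq> (0, 0, 0) \<longrightarrow>
        quad3 (a m) (b m) (c m) (f m) (g m) (h m) x y z > 0"
    and nondeg: "\<And>m x y z. 0 < m \<Longrightarrow> m \<le> 1 \<Longrightarrow> a m * x + f m * y + g m * z = 0 \<Longrightarrow>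
        f m * x + b m * y + h m * z = 0 \<Longrightarrow> g m * x + h m * y + c m * z = 0 \<Longrightarrow>
        (x, y, z) = (0, 0, 0)"
    and ne: "(x, y, z) \<noteq> (0, 0, 0)"
  shows "quad3 (a 1) (b 1) (c 1) (f 1) (g 1) (h 1) x y z > 0"
proof -
  define Q where "Q m x y z = quad3 (a m) (b m) (c m) (f m) (g m) (h m) x y z" for m x y z
  define B where "B = {m. 0 < m \<and> m \<le> 1 \<and> \<not> (\<forall>x y z. (x, y, z) \<noteq> (0, 0, 0) \<longrightarrow> Q m x y z > 0)}"
  obtain m1 where m1: "m1 > 0" "\<And>m. 0 < m \<Longrightarrow> m < m1 \<Longrightarrow> m \<notin> B"
  proof -
    from small obtain k where "k > 0" "\<forall>m>0. m < k \<longrightarrow> (\<forall>x y z. (x, y, z) \<noteq> (0, 0, 0) \<longrightarrow> Q m x y z > 0)"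
      unfolding eventually_at_right_field Q_def[symmetric] by auto
    then show ?thesis by (intro that[of k]) (auto simp: B_def)
  qed
  have "B = {}"
  proof (rule ccontr)
    assume "B \<noteq> {}"
    then obtain b0 where b0: "b0 \<in> B" by blast
    have bdd: "bdd_below B" by (auto simp: B_def intro!: bdd_belowI[of _ 0])
    define m where "m = Inf B"
    have "m1 \<le> s" if "s \<in> B" for s
      using that m1(2)[of s] by (cases "s < m1") (auto simp: B_def)
    then have "m1 \<le> m" unfolding m_def
      by (rule cInf_greatest[OF \<open>B \<noteq> {}\<close>])
    then have m: "m > 0" "m \<le> 1" using m1 cInf_lower[OF b0 bdd] b0 by (auto simp: m_def B_def)
    have below: "Q s x y z > 0" if "0 < s" "s < m" "(x, y, z) \<noteq> (0, 0, 0)" for s x y z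
    proof -
      have "s \<notin> B" using that(2) cInf_lower[OF _ bdd, of s] unfolding m_def by linarith
      then show ?thesis using that m unfolding B_def by auto
    qed
    have nonneg: "Q m x y z \<ge> 0" for x y z
    proof (rule tendsto_lowerbound)
      show "((\<lambda>s. Q s x y z) \<longlongrightarrow> Q m x y z) (at_left m)"
        unfolding Q_def quad3_def using cont[OF m]
        by (intro tendsto_intros) (auto simp: isCont_def intro: filterlim_mono[OF _ order_refl at_le])
      have "\<forall>\<^sub>F s in at_left m. s \<in> {0<..<m}" using m eventually_at_left_real by blast
      then show "\<forall>\<^sub>F s in at_left m. 0 \<le> Q s x y z"
      proof (rule eventually_mono)
        fix s assume "s \<in> {0<..<m}"
        then show "0 \<le> Q s x y z"
          using below[of s x y z] by (cases "(x, y, z) = (0, 0, 0)") (auto simp: Q_def quad3_def)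
      qed
    qed simp
    have pos: "Q m x y z > 0" if "(x, y, z) \<noteq> (0, 0, 0)" for x y z
    proof (rule ccontr)
      assume "\<not> Q m x y z > 0"
      then have "Q m x y z = 0" using nonneg[of x y z] by simp
      from nondeg[OF m quad3_semidefinite_kernel[OF nonneg[unfolded Q_def] this[unfolded Q_def]]]
      show False using that by simp
    qed
    have "\<forall>\<^sub>F s in at m. \<forall>x y z. (x, y, z) \<noteq> (0, 0, 0) \<longrightarrow> Q s x y z > 0"
      unfolding Q_def by (rule quad3_pos_eventually)
        (use cont[OF m] pos in \<open>auto simp: isCont_def Q_def\<close>)
    then obtain d where d: "d > 0" and D: "\<And>s x y z. \<lbrakk>s \<noteq> m; dist s m < d; (x, y, z) \<noteq> (0, 0, 0)\<rbrakk>
        \<Longrightarrow> Q s x y z > 0"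
      unfolding eventually_at by blast
    have "m + d \<le> Inf B"
    proof (rule cInf_greatest[OF \<open>B \<noteq> {}\<close>])
      fix s assume s: "s \<in> B"
      show "m + d \<le> s"
      proof (rule ccontr)
        assume "\<not> m + d \<le> s"
        moreover have "m \<le> s" using cInf_lower[OF s bdd] by (simp add: m_def)
        ultimately have "s = m \<or> (s \<noteq> m \<and> dist s m < d)" by (auto simp: dist_real_def)
        then show False using s pos D by (auto simp: B_def)
      qed
    qed
    then show False using d by (simp add: m_def)
  qed
  moreover have "1 \<in> B" if "\<not> Q 1 x y z > 0"
    unfolding B_def by (intro CollectI conjI zero_less_one order_refl) (use ne that in blast)
  ultimately show ?thesis unfolding Q_def by blast
qed

section \<open>The hyperbolic angle form\<close>

text \<open>\<open>C1\<close>, \<open>C2\<close>, \<open>C3\<close> stand for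
  \<open>sqrt (1 + e * r\<^sup>2)\<close> at the vertices and \<open>c12\<close>,
  \<open>c13\<close>, \<open>c23\<close> for the hyperbolic cosines of the edge lengths.
  \<open>hyp_diag\<close> and \<open>hyp_off\<close> are the entries of minus the Jacobian of the
  angles, multiplied by the square root of \<open>hyp_det\<close>.\<close>

definition hyp_diag :: "real \<Rightarrow> real \<Rightarrow> real \<Rightarrow> real \<Rightarrow> real \<Rightarrow> real \<Rightarrow> real" where
  "hyp_diag C1 C2 C3 c12 c13 c23 =
     (c13 * c23 - c12) * (C1 * c13 - C3) / (c13\<^sup>2 - 1) + (c12 * c23 - c13) * (C1 * c12 - C2) / (c12\<^sup>2 - 1)"

text \<open>Written symmetrically in the vertices 1 and 2, so that the symmetry of the Jacobian can
  be read off; \<open>hyp_row\<close> shows that its rows have these entries.\<close>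

definition hyp_off :: "real \<Rightarrow> real \<Rightarrow> real \<Rightarrow> real \<Rightarrow> real \<Rightarrow> real \<Rightarrow> real" where
  "hyp_off C1 C2 C3 c12 c13 c23 =
     C3 - (C1 * (c12 * c23 - c13) + C2 * (c12 * c13 - c23)) / (c12\<^sup>2 - 1)"

text \<open>The determinant of the symmetric 3 by 3 matrix with unit diagonal and the c as
  off-diagonal entries. For edges of positive length it is positive exactly under the strict
  triangle inequalities.\<close>

definition hyp_det :: "real \<Rightarrow> real \<Rightarrow> real \<Rightarrow> real" where
  "hyp_det c12 c13 c23 = 1 + 2 * c12 * c13 * c23 - c12\<^sup>2 - c13\<^sup>2 - c23\<^sup>2"

lemma hyp_off_swap: "hyp_off C2 C1 C3 c12 c23 c13 = hyp_off C1 C2 C3 c12 c13 c23"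
  unfolding hyp_off_def by (simp add: mult.commute add.commute)

lemma hyp_row:
  assumes "c12\<^sup>2 \<noteq> 1" "c13\<^sup>2 \<noteq> 1"
  shows "((C1 * c12 - C2) * h1 + (C2 * c12 - C1) * h2) * (c12 * c23 - c13) / (c12\<^sup>2 - 1)
     + ((C1 * c13 - C3) * h1 + (C3 * c13 - C1) * h3) * (c13 * c23 - c12) / (c13\<^sup>2 - 1)
     - ((C2 * c23 - C3) * h2 + (C3 * c23 - C2) * h3)
   = hyp_diag C1 C2 C3 c12 c13 c23 * h1 + hyp_off C1 C2 C3 c12 c13 c23 * h2 + hyp_off C1 C3 C2 c13 c12 c23 * h3"
proof -
  have off: "hyp_off C1 C2 C3 c12 c13 c23 = (C2 * c12 - C1) * (c12 * c23 - c13) / (c12\<^sup>2 - 1) - (C2 * c23 - C3)"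
    if "c12\<^sup>2 \<noteq> 1" for C1 C2 C3 c12 c13 c23 :: real
  proof -
    define q where "q = c12\<^sup>2 - 1"
    have q: "q \<noteq> 0" using that by (simp add: q_def)
    then have "u - v / q = (u * q - v) / q" "v / q - u = (v - u * q) / q" for u v :: real
      by (simp_all add: diff_divide_distrib)
    moreover have "C3 * q - (C1 * (c12 * c23 - c13) + C2 * (c12 * c13 - c23))
        = (C2 * c12 - C1) * (c12 * c23 - c13) - (C2 * c23 - C3) * q"
      unfolding q_def by (simp add: algebra_simps power2_eq_square)
    ultimately show ?thesis
      unfolding hyp_off_def q_def[symmetric] by (simp only:)
  qed
  show ?thesis
    unfolding off[OF assms(1)] off[OF assms(2)] hyp_diag_def
    by (simp add: algebra_simps add_divide_distrib diff_divide_distrib)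
qed

text \<open>The Jacobian factors through the variations of the three edges. From these to the rows
  leads the adjugate of the matrix behind \<open>hyp_det\<close>, and from h to them a matrix whose
  determinant is minus the cubic in X, up to the nonzero divisors; both are invertible.\<close>

lemma hyp_nondegenerate:
  fixes C1 C2 C3 c12 c13 c23 h1 h2 h3 :: real
  assumes c: "c12\<^sup>2 \<noteq> 1" "c13\<^sup>2 \<noteq> 1" "c23\<^sup>2 \<noteq> 1" and det: "hyp_det c12 c13 c23 \<noteq> 0"
    and X: "(C1 * c12 - C2) * (C2 * c23 - C3) * (C3 * c13 - C1)
          + (C2 * c12 - C1) * (C3 * c23 - C2) * (C1 * c13 - C3) \<noteq> 0"
    and rows:
      "hyp_diag C1 C2 C3 c12 c13 c23 * h1 + hyp_off C1 C2 C3 c12 c13 c23 * h2 + hyp_off C1 C3 C2 c13 c12 c23 * h3 = 0"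
      "hyp_diag C2 C1 C3 c12 c23 c13 * h2 + hyp_off C2 C1 C3 c12 c23 c13 * h1 + hyp_off C2 C3 C1 c23 c12 c13 * h3 = 0"
      "hyp_diag C3 C1 C2 c13 c23 c12 * h3 + hyp_off C3 C1 C2 c13 c23 c12 * h1 + hyp_off C3 C2 C1 c23 c13 c12 * h2 = 0"
  shows "h1 = 0" "h2 = 0" "h3 = 0"
proof -
  define y12 where "y12 = ((C1 * c12 - C2) * h1 + (C2 * c12 - C1) * h2) / (c12\<^sup>2 - 1)"
  define y13 where "y13 = ((C1 * c13 - C3) * h1 + (C3 * c13 - C1) * h3) / (c13\<^sup>2 - 1)"
  define y23 where "y23 = ((C2 * c23 - C3) * h2 + (C3 * c23 - C2) * h3) / (c23\<^sup>2 - 1)"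
  have r1: "y12 * (c12 * c23 - c13) + y13 * (c13 * c23 - c12) - y23 * (c23\<^sup>2 - 1) = 0"
    using hyp_row[of c12 c13 C1 C2 h1 h2 c23 C3 h3] rows(1) c unfolding y12_def y13_def y23_def by simp
  have r2: "y12 * (c12 * c13 - c23) + y23 * (c23 * c13 - c12) - y13 * (c13\<^sup>2 - 1) = 0"
    using hyp_row[of c12 c23 C2 C1 h2 h1 c13 C3 h3] rows(2) c unfolding y12_def y13_def y23_def
    by (simp add: add.commute)
  have r3: "y13 * (c13 * c12 - c23) + y23 * (c23 * c12 - c13) - y12 * (c12\<^sup>2 - 1) = 0"
    using hyp_row[of c13 c23 C3 C1 h3 h1 c12 C2 h2] rows(3) c unfolding y12_def y13_def y23_def
    by (simp add: add.commute)
  \<comment> \<open>The weights 1, \<open>c12\<close>, \<open>c13\<close> are a row of the matrix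
    behind \<open>hyp_det\<close>, so multiplying the adjugate by it isolates one edge
    variation.\<close>
  have "hyp_det c12 c13 c23 * y23
    = (y12 * (c12 * c23 - c13) + y13 * (c13 * c23 - c12) - y23 * (c23\<^sup>2 - 1))
    + c12 * (y12 * (c12 * c13 - c23) + y23 * (c23 * c13 - c12) - y13 * (c13\<^sup>2 - 1))
    + c13 * (y13 * (c13 * c12 - c23) + y23 * (c23 * c12 - c13) - y12 * (c12\<^sup>2 - 1))"
    unfolding hyp_det_def by (simp add: algebra_simps power2_eq_square)
  then have y23: "y23 = 0" using r1 r2 r3 det by simp
  have "hyp_det c12 c13 c23 * y13
    = c12 * (y12 * (c12 * c23 - c13) + y13 * (c13 * c23 - c12) - y23 * (c23\<^sup>2 - 1))
    + (y12 * (c12 * c13 - c23) + y23 * (c23 * c13 - c12) - y13 * (c13\<^sup>2 - 1))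
    + c23 * (y13 * (c13 * c12 - c23) + y23 * (c23 * c12 - c13) - y12 * (c12\<^sup>2 - 1))"
    unfolding hyp_det_def by (simp add: algebra_simps power2_eq_square)
  then have y13: "y13 = 0" using r1 r2 r3 det by simp
  have "hyp_det c12 c13 c23 * y12
    = c13 * (y12 * (c12 * c23 - c13) + y13 * (c13 * c23 - c12) - y23 * (c23\<^sup>2 - 1))
    + c23 * (y12 * (c12 * c13 - c23) + y23 * (c23 * c13 - c12) - y13 * (c13\<^sup>2 - 1))
    + (y13 * (c13 * c12 - c23) + y23 * (c23 * c12 - c13) - y12 * (c12\<^sup>2 - 1))"
    unfolding hyp_det_def by (simp add: algebra_simps power2_eq_square)
  then have y12: "y12 = 0" using r1 r2 r3 det by simp
  define D12 D21 D13 D31 D23 D32 where D: "D12 = C1 * c12 - C2" "D21 = C2 * c12 - C1"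
    "D13 = C1 * c13 - C3" "D31 = C3 * c13 - C1" "D23 = C2 * c23 - C3" "D32 = C3 * c23 - C2"
  have e: "D12 * h1 + D21 * h2 = 0" "D13 * h1 + D31 * h3 = 0" "D23 * h2 + D32 * h3 = 0"
    using y12 y13 y23 c unfolding y12_def y13_def y23_def D by auto
  have X': "D12 * D23 * D31 + D21 * D32 * D13 \<noteq> 0" using X unfolding D .
  have "(D12 * D23 * D31 + D21 * D32 * D13) * h1 = D23 * D31 * (D12 * h1 + D21 * h2)
     + D21 * D32 * (D13 * h1 + D31 * h3) - D21 * D31 * (D23 * h2 + D32 * h3)"
    by (simp add: algebra_simps)
  then show "h1 = 0" using X' e by simp
  have "(D12 * D23 * D31 + D21 * D32 * D13) * h2 = D32 * D13 * (D12 * h1 + D21 * h2)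
     + D12 * D31 * (D23 * h2 + D32 * h3) - D12 * D32 * (D13 * h1 + D31 * h3)"
    by (simp add: algebra_simps)
  then show "h2 = 0" using X' e by simp
  have "(D12 * D23 * D31 + D21 * D32 * D13) * h3 = D12 * D23 * (D13 * h1 + D31 * h3)
     + D21 * D13 * (D23 * h2 + D32 * h3) - D23 * D13 * (D12 * h1 + D21 * h2)"
    by (simp add: algebra_simps)
  then show "h3 = 0" using X' e by simp
qed

section \<open>Hyperbolic edge quantities as functions of the radii\<close>

definition hyp_C :: "real \<Rightarrow> real \<Rightarrow> real" where
  "hyp_C e x = sqrt (1 + e * x\<^sup>2)"

definition hyp_c :: "real \<Rightarrow> real \<Rightarrow> real \<Rightarrow> real \<Rightarrow> real \<Rightarrow> real" where
  "hyp_c e e' n x y = hyp_C e x * hyp_C e' y + n * x * y"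

lemma hyp_c_commute: "hyp_c e e' n x y = hyp_c e' e n y x"
  by (simp add: hyp_c_def mult.commute mult.left_commute)

lemma hyp_C_facts:
  assumes "e \<in> {0, 1}"
  shows "(hyp_C e x)\<^sup>2 = 1 + e * x\<^sup>2" "hyp_C e x \<ge> 1" "hyp_C e x > 0"
proof -
  have "0 \<le> e * x\<^sup>2" using assms by auto
  then show "(hyp_C e x)\<^sup>2 = 1 + e * x\<^sup>2" "hyp_C e x \<ge> 1" by (auto simp: hyp_C_def)
  then show "hyp_C e x > 0" by linarith
qed

text \<open>By Cauchy-Schwarz the product of the two \<open>hyp_C\<close> is at least
  \<open>1 + e * e' * x * y\<close>; the first structure condition then leaves a positive multiple
  of \<open>x * y\<close> above 1.\<close>

lemma hyp_c_gt_1: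
  assumes "e \<in> {0, 1}" "e' \<in> {0, 1}" "e * e' + n > 0" "x > 0" "y > 0"
  shows "hyp_c e e' n x y > 1"
proof -
  have "(1 + e * e' * x * y)\<^sup>2 \<le> (hyp_C e x * hyp_C e' y)\<^sup>2"
  proof -
    have "(x - y)\<^sup>2 \<ge> 0" by simp
    then show ?thesis
      unfolding power_mult_distrib hyp_C_facts(1)[OF assms(1)] hyp_C_facts(1)[OF assms(2)]
      using assms(1,2) by (auto simp: power2_eq_square algebra_simps)
  qed
  then have "1 + e * e' * x * y \<le> hyp_C e x * hyp_C e' y"
    by (rule power2_le_imp_le) (use hyp_C_facts(3)[OF assms(1), of x] hyp_C_facts(3)[OF assms(2), of y] in simp)
  moreover have "(e * e' + n) * (x * y) > 0" using assms by simp
  ultimately show ?thesis by (simp add: hyp_c_def algebra_simps)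
qed

lemma hyp_D_eq:
  assumes "e \<in> {0, 1}"
  shows "hyp_C e x * hyp_c e e' n x y - hyp_C e' y = x * (e * x * hyp_C e' y + n * y * hyp_C e x)"
proof -
  have "hyp_C e x * hyp_c e e' n x y = (1 + e * x\<^sup>2) * hyp_C e' y + n * x * y * hyp_C e x"
    unfolding hyp_C_facts(1)[OF assms, symmetric] by (simp add: hyp_c_def algebra_simps power2_eq_square)
  then show ?thesis by (simp add: algebra_simps power2_eq_square)
qed

text \<open>Once the squares of \<open>hyp_C\<close> are eliminated, square roots survive only
  beside the three combinations that the second structure condition makes nonnegative. In this form
  the determinant can be differentiated along a scaling of the radii.\<close>

lemma hyp_det_eq:
  assumes "e1 \<in> {0, 1}" "e2 \<in> {0, 1}" "e3 \<in> {0, 1}"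
  shows "hyp_det (hyp_c e1 e2 n12 x1 x2) (hyp_c e1 e3 n13 x1 x3) (hyp_c e2 e3 n23 x2 x3) =
    (e2 * e3 - n23\<^sup>2) * (x2 * x3)\<^sup>2 + (e1 * e3 - n13\<^sup>2) * (x1 * x3)\<^sup>2 + (e1 * e2 - n12\<^sup>2) * (x1 * x2)\<^sup>2
    + 2 * (x1 * x2 * x3) * ((e1 * n23 + n12 * n13) * x1 * hyp_C e2 x2 * hyp_C e3 x3
       + (e2 * n13 + n12 * n23) * x2 * hyp_C e1 x1 * hyp_C e3 x3
       + (e3 * n12 + n13 * n23) * x3 * hyp_C e1 x1 * hyp_C e2 x2)
    + 2 * (x1 * x2 * x3)\<^sup>2 * (e1 * e2 * e3 + n12 * n13 * n23)"
proof -
  define C1 C2 C3 where C: "C1 = hyp_C e1 x1" "C2 = hyp_C e2 x2" "C3 = hyp_C e3 x3"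
  have exp: "hyp_det (C1 * C2 + n12 * x1 * x2) (C1 * C3 + n13 * x1 * x3) (C2 * C3 + n23 * x2 * x3) =
    1 + 2 * C1\<^sup>2 * C2\<^sup>2 * C3\<^sup>2 - C1\<^sup>2 * C2\<^sup>2 - C1\<^sup>2 * C3\<^sup>2 - C2\<^sup>2 * C3\<^sup>2
    + 2 * x1 * x2 * n12 * C1 * C2 * (C3\<^sup>2 - 1) + 2 * x1 * x3 * n13 * C1 * C3 * (C2\<^sup>2 - 1)
    + 2 * x2 * x3 * n23 * C2 * C3 * (C1\<^sup>2 - 1)
    + 2 * x1 * x2 * x3 * (n12 * n13 * x1 * C2 * C3 + n12 * n23 * x2 * C1 * C3 + n13 * n23 * x3 * C1 * C2)
    + 2 * n12 * n13 * n23 * (x1 * x2 * x3)\<^sup>2 - (n12 * x1 * x2)\<^sup>2 - (n13 * x1 * x3)\<^sup>2 - (n23 * x2 * x3)\<^sup>2"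
    unfolding hyp_det_def by (simp add: algebra_simps power2_eq_square)
  have sq: "C1\<^sup>2 = 1 + e1 * x1\<^sup>2" "C2\<^sup>2 = 1 + e2 * x2\<^sup>2" "C3\<^sup>2 = 1 + e3 * x3\<^sup>2"
    unfolding C using assms by (auto simp: hyp_C_facts)
  show ?thesis unfolding hyp_c_def C[symmetric] exp sq
    by (simp add: algebra_simps power2_eq_square)
qed

text \<open>In the variables \<open>x1 / C1\<close>, \<open>x2 / C2\<close>, \<open>x3 / C3\<close>
  every factor is a positive multiple of a factor of the structure cubic.\<close>

lemma hyp_cubic_pos:
  assumes st: "structure_triple e1 e2 e3 n12 n13 n23" and x: "x1 > 0" "x2 > 0" "x3 > 0"
  defines "C1 \<equiv> hyp_C e1 x1" and "C2 \<equiv> hyp_C e2 x2" and "C3 \<equiv> hyp_C e3 x3"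
  defines "c12 \<equiv> hyp_c e1 e2 n12 x1 x2" and "c13 \<equiv> hyp_c e1 e3 n13 x1 x3" and "c23 \<equiv> hyp_c e2 e3 n23 x2 x3"
  shows "(C1 * c12 - C2) * (C2 * c23 - C3) * (C3 * c13 - C1)
       + (C2 * c12 - C1) * (C3 * c23 - C2) * (C1 * c13 - C3) > 0"
proof -
  have e: "e1 \<in> {0, 1}" "e2 \<in> {0, 1}" "e3 \<in> {0, 1}" using st by (auto simp: structure_triple_def)
  have C: "C1 > 0" "C2 > 0" "C3 > 0" unfolding assms using e hyp_C_facts(3) by auto
  have D: "C1 * c12 - C2 = x1 * (C1 * C2) * (e1 * (x1 / C1) + n12 * (x2 / C2))"
    "C2 * c12 - C1 = x2 * (C1 * C2) * (e2 * (x2 / C2) + n12 * (x1 / C1))"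
    "C1 * c13 - C3 = x1 * (C1 * C3) * (e1 * (x1 / C1) + n13 * (x3 / C3))"
    "C3 * c13 - C1 = x3 * (C1 * C3) * (e3 * (x3 / C3) + n13 * (x1 / C1))"
    "C2 * c23 - C3 = x2 * (C2 * C3) * (e2 * (x2 / C2) + n23 * (x3 / C3))"
    "C3 * c23 - C2 = x3 * (C2 * C3) * (e3 * (x3 / C3) + n23 * (x2 / C2))"
    using C hyp_D_eq[OF e(1), of x1 e2 n12 x2] hyp_D_eq[OF e(2), of x2 e1 n12 x1]
      hyp_D_eq[OF e(1), of x1 e3 n13 x3] hyp_D_eq[OF e(3), of x3 e1 n13 x1]
      hyp_D_eq[OF e(2), of x2 e3 n23 x3] hyp_D_eq[OF e(3), of x3 e2 n23 x2]
    unfolding c12_def c13_def c23_def C1_def[symmetric] C2_def[symmetric] C3_def[symmetric]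
    by (simp_all add: hyp_c_commute[of e2 e1] hyp_c_commute[of e3 e1] hyp_c_commute[of e3 e2]
        C1_def[symmetric] C2_def[symmetric] C3_def[symmetric] field_simps)
  let ?t1 = "x1 / C1" and ?t2 = "x2 / C2" and ?t3 = "x3 / C3"
  have prod: "(x1 * (C1 * C2) * d12) * (x2 * (C2 * C3) * d23) * (x3 * (C1 * C3) * d31)
      + (x2 * (C1 * C2) * d21) * (x3 * (C2 * C3) * d32) * (x1 * (C1 * C3) * d13)
    = (x1 * x2 * x3 * (C1 * C2 * C3)\<^sup>2) * (d12 * d23 * d31 + d21 * d32 * d13)"
    for d12 d21 d13 d31 d23 d32 :: real
    by (simp add: algebra_simps power2_eq_square)
  have "x1 * x2 * x3 * (C1 * C2 * C3)\<^sup>2 > 0" using C x by simp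
  then show ?thesis unfolding D prod
    using structure_cubic_pos[OF st, of ?t1 ?t2 ?t3] C x by (intro mult_pos_pos) auto
qed

text \<open>Divided by the fourth power of the scale, the determinant is a function \<open>G\<close>
  of the squared scale whose derivative is a positive multiple of the structure cubic at
  \<open>x1 / L1\<close>, \<open>x2 / L2\<close>, \<open>x3 / L3\<close>. Enlarging all radii by a
  common factor therefore cannot make a triangle degenerate.\<close>

lemma hyp_det_pos_scaled:
  assumes st: "structure_triple e1 e2 e3 n12 n13 n23" and x: "x1 > 0" "x2 > 0" "x3 > 0"
    and s: "s \<ge> 1"
    and det: "hyp_det (hyp_c e1 e2 n12 x1 x2) (hyp_c e1 e3 n13 x1 x3) (hyp_c e2 e3 n23 x2 x3) > 0"
  shows "hyp_det (hyp_c e1 e2 n12 (s * x1) (s * x2)) (hyp_c e1 e3 n13 (s * x1) (s * x3))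
           (hyp_c e2 e3 n23 (s * x2) (s * x3)) > 0"
proof -
  have e: "e1 \<in> {0, 1}" "e2 \<in> {0, 1}" "e3 \<in> {0, 1}" using st by (auto simp: structure_triple_def)
  define g1 where "g1 = e1 * n23 + n12 * n13"
  define g2 where "g2 = e2 * n13 + n12 * n23"
  define g3 where "g3 = e3 * n12 + n13 * n23"
  define L where "L e x t = sqrt (1 + t * (e * x\<^sup>2))" for e x t :: real
  define R where "R = x1 * x2 * x3"
  define G where "G t = (e2 * e3 - n23\<^sup>2) * (x2 * x3)\<^sup>2 + (e1 * e3 - n13\<^sup>2) * (x1 * x3)\<^sup>2 + (e1 * e2 - n12\<^sup>2) * (x1 * x2)\<^sup>2
    + 2 * R * (g1 * x1 * (L e2 x2 t * L e3 x3 t) + g2 * x2 * (L e1 x1 t * L e3 x3 t)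
       + g3 * x3 * (L e1 x1 t * L e2 x2 t))
    + t * (2 * R\<^sup>2 * (e1 * e2 * e3 + n12 * n13 * n23))" for t
  have scaled: "hyp_det (hyp_c e1 e2 n12 (r * x1) (r * x2)) (hyp_c e1 e3 n13 (r * x1) (r * x3))
           (hyp_c e2 e3 n23 (r * x2) (r * x3)) = r ^ 4 * G (r\<^sup>2)" for r
  proof -
    have LC: "hyp_C e (r * x) = L e x (r\<^sup>2)" for e x
      by (simp add: hyp_C_def L_def power_mult_distrib mult.left_commute)
    show ?thesis unfolding hyp_det_eq[OF e] G_def g1_def[symmetric] g2_def[symmetric] g3_def[symmetric] LC R_def
      by (simp add: algebra_simps power2_eq_square power4_eq_xxxx)
  qed
  have "G 1 \<le> G (s\<^sup>2)"
  proof (rule DERIV_nonneg_imp_nondecreasing[where f = G and a = 1 and b = "s\<^sup>2"])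
    show "1 \<le> s\<^sup>2" using s by simp
    fix t :: real assume t: "1 \<le> t" "t \<le> s\<^sup>2"
    have pos: "1 + t * (e * x\<^sup>2) > 0" if "e \<in> {0, 1}" for e x :: real
      using that t by (auto intro: add_pos_nonneg)
    have Lpos: "L e x t > 0" if "e \<in> {0, 1}" for e x using pos[OF that] by (simp add: L_def)
    have dL: "((\<lambda>t. L e x t) has_real_derivative e * x\<^sup>2 / (2 * L e x t)) (at t)" if "e \<in> {0, 1}" for e x
      unfolding L_def using pos[OF that, of x]
      by (auto intro!: derivative_eq_intros simp: divide_simps)
    define L1 L2 L3 where LL: "L1 = L e1 x1 t" "L2 = L e2 x2 t" "L3 = L e3 x3 t"
    have Lp: "L1 > 0" "L2 > 0" "L3 > 0" unfolding LL using e Lpos by auto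
    define d1 d2 d3 where d: "d1 = e1 * x1\<^sup>2 / (2 * L1)" "d2 = e2 * x2\<^sup>2 / (2 * L2)" "d3 = e3 * x3\<^sup>2 / (2 * L3)"
    have "(G has_real_derivative
       2 * R * (g1 * x1 * (d2 * L3 + d3 * L2) + g2 * x2 * (d1 * L3 + d3 * L1) + g3 * x3 * (d1 * L2 + d2 * L1))
       + 2 * R\<^sup>2 * (e1 * e2 * e3 + n12 * n13 * n23)) (at t)"
      unfolding G_def d LL
      by (auto intro!: derivative_eq_intros dL[OF e(1)] dL[OF e(2)] dL[OF e(3)] simp: algebra_simps)
    moreover have "2 * R * (g1 * x1 * (d2 * L3 + d3 * L2) + g2 * x2 * (d1 * L3 + d3 * L1) + g3 * x3 * (d1 * L2 + d2 * L1))
       + 2 * R\<^sup>2 * (e1 * e2 * e3 + n12 * n13 * n23)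
      = R * (L1 * L2 * L3) * (2 * (e1 * e2 * e3 + n12 * n13 * n23) * (x1 / L1 * (x2 / L2) * (x3 / L3))
     + e2 * g1 * (x2 / L2)\<^sup>2 * (x1 / L1) + e3 * g1 * (x3 / L3)\<^sup>2 * (x1 / L1)
     + e1 * g2 * (x1 / L1)\<^sup>2 * (x2 / L2) + e3 * g2 * (x3 / L3)\<^sup>2 * (x2 / L2)
     + e1 * g3 * (x1 / L1)\<^sup>2 * (x3 / L3) + e2 * g3 * (x2 / L2)\<^sup>2 * (x3 / L3))"
      using Lp unfolding d R_def by (simp add: field_simps power2_eq_square)
    moreover have "\<dots> > 0"
      using structure_cubic_pos[OF st, of "x1 / L1" "x2 / L2" "x3 / L3"] Lp x
      unfolding structure_cubic_expand[OF st] g1_def[symmetric] g2_def[symmetric] g3_def[symmetric]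
      by (intro mult_pos_pos) (auto simp: R_def)
    ultimately show "\<exists>y. (G has_real_derivative y) (at t) \<and> 0 \<le> y" by (metis less_imp_le)
  qed
  moreover have "G 1 > 0" using det scaled[of 1] by simp
  ultimately show ?thesis unfolding scaled using s by simp
qed

section \<open>Asymptotics of the hyperbolic angle form for large radii\<close>

definition hyp_L :: "real \<Rightarrow> real \<Rightarrow> real \<Rightarrow> real" where
  "hyp_L e r m = sqrt (m\<^sup>2 / r\<^sup>2 + e)"

lemma hyp_C_scaled: "r > 0 \<Longrightarrow> m > 0 \<Longrightarrow> hyp_C e (r / m) = hyp_L e r m * r / m"
proof -
  assume rm: "r > 0" "m > 0"
  have "1 + e * (r / m)\<^sup>2 = (m\<^sup>2 / r\<^sup>2 + e) * (r / m)\<^sup>2"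
    using rm by (simp add: field_simps)
  then show "hyp_C e (r / m) = hyp_L e r m * r / m"
    using rm by (simp add: hyp_C_def hyp_L_def real_sqrt_mult)
qed

lemma hyp_c_scaled: "r > 0 \<Longrightarrow> r' > 0 \<Longrightarrow> m > 0 \<Longrightarrow>
    hyp_c e e' n (r / m) (r' / m) = (hyp_L e r m * hyp_L e' r' m + n) * r * r' / m\<^sup>2"
  by (simp add: hyp_c_def hyp_C_scaled field_simps power2_eq_square)

lemma hyp_L_pos: "r > 0 \<Longrightarrow> m > 0 \<Longrightarrow> e \<in> {0, 1} \<Longrightarrow> hyp_L e r m > 0"
  by (auto simp: hyp_L_def intro!: add_pos_nonneg)

lemma tendsto_hyp_L:
  assumes "e \<in> {0, 1}"
  shows "((\<lambda>m. hyp_L e r m) \<longlongrightarrow> e) (at_right 0)"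
proof -
  have "((\<lambda>m. hyp_L e r m) \<longlongrightarrow> sqrt (0\<^sup>2 / r\<^sup>2 + e)) (at_right 0)"
    unfolding hyp_L_def divide_inverse by (intro tendsto_intros)
  then show ?thesis using assms by auto
qed

text \<open>For weight 1 the denominator tends to 1, but for weight 0 it vanishes like
  \<open>m / r\<close> itself; comparison with \<open>m / r\<close> covers both.\<close>

lemma tendsto_sq_over_hyp_L:
  assumes "e \<in> {0, 1}" "r > 0"
  shows "((\<lambda>m. m\<^sup>2 / r\<^sup>2 / hyp_L e r m) \<longlongrightarrow> 0) (at_right 0)"
proof (rule tendsto_sandwich)
  have pos: "\<forall>\<^sub>F m :: real in at_right 0. m > 0" by (simp add: eventually_at_right_less)
  show "\<forall>\<^sub>F m in at_right 0. 0 \<le> m\<^sup>2 / r\<^sup>2 / hyp_L e r m"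
    using pos by (rule eventually_mono) (use hyp_L_pos assms in \<open>auto intro!: divide_nonneg_pos\<close>)
  show "\<forall>\<^sub>F m in at_right 0. m\<^sup>2 / r\<^sup>2 / hyp_L e r m \<le> m / r"
    using pos
  proof (rule eventually_mono)
    fix m :: real assume m: "m > 0"
    have "m / r = sqrt (m\<^sup>2 / r\<^sup>2)" using m assms by (simp add: real_sqrt_divide)
    also have "\<dots> \<le> hyp_L e r m" unfolding hyp_L_def using assms by auto
    finally have "m / r * (m / r) \<le> m / r * hyp_L e r m" using m assms by (intro mult_left_mono) auto
    then show "m\<^sup>2 / r\<^sup>2 / hyp_L e r m \<le> m / r"
      unfolding pos_divide_le_eq[OF hyp_L_pos[OF assms(2) m assms(1)]] by (simp add: power2_eq_square)
  qed
  have "((\<lambda>m. m / r) \<longlongrightarrow> 0 / r) (at_right 0)" using assms by (intro tendsto_intros) auto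
  then show "((\<lambda>m. m / r) \<longlongrightarrow> 0) (at_right 0)" by simp
qed simp

context
  fixes e1 e2 e3 n12 n13 n23 r1 r2 r3 :: real
  assumes e: "e1 \<in> {0, 1}" "e2 \<in> {0, 1}" "e3 \<in> {0, 1}"
    and n: "e1 * e2 + n12 > 0" "e1 * e3 + n13 > 0" "e2 * e3 + n23 > 0"
    and r: "r1 > 0" "r2 > 0" "r3 > 0"
begin

text \<open>The division by \<open>hyp_C e1 (r1 / m)\<close> makes one limit serve both vertex
  weights: for \<open>e1 = 1\<close> the entry grows like the third power of \<open>1 / m\<close>,
  for \<open>e1 = 0\<close> only like the second.\<close>

lemma hyp_diag_limit:
  "((\<lambda>m. m\<^sup>2 * hyp_diag (hyp_C e1 (r1 / m)) (hyp_C e2 (r2 / m)) (hyp_C e3 (r3 / m))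
       (hyp_c e1 e2 n12 (r1 / m) (r2 / m)) (hyp_c e1 e3 n13 (r1 / m) (r3 / m))
       (hyp_c e2 e3 n23 (r2 / m) (r3 / m)) / hyp_C e1 (r1 / m))
     \<longlongrightarrow> r2 * r3 * (2 * (e2 * e3 + n23))) (at_right 0)"
proof -
  define L1 where "L1 = hyp_L e1 r1"
  define L2 where "L2 = hyp_L e2 r2"
  define L3 where "L3 = hyp_L e3 r3"
  define T where "T m = r2 * r3 *
    (((L1 m * L3 m + n13) * (L2 m * L3 m + n23) - m\<^sup>2 / r3\<^sup>2 * (L1 m * L2 m + n12)) *
       ((L1 m * L3 m + n13) - m\<^sup>2 / r1\<^sup>2 / L1 m * L3 m) /
       ((L1 m * L3 m + n13)\<^sup>2 - m\<^sup>2 / r1\<^sup>2 * (m\<^sup>2 / r3\<^sup>2))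
    + ((L1 m * L2 m + n12) * (L2 m * L3 m + n23) - m\<^sup>2 / r2\<^sup>2 * (L1 m * L3 m + n13)) *
       ((L1 m * L2 m + n12) - m\<^sup>2 / r1\<^sup>2 / L1 m * L2 m) /
       ((L1 m * L2 m + n12)\<^sup>2 - m\<^sup>2 / r1\<^sup>2 * (m\<^sup>2 / r2\<^sup>2)))" for m
  have diag_term: "m\<^sup>2 * ((c13 * c23 - c12) * (C1 * c13 - C3) / (c13\<^sup>2 - 1)) / C1 =
     ra * rb * ((u13 * u23 - m\<^sup>2 / rb\<^sup>2 * u12) * (u13 - m\<^sup>2 / r1\<^sup>2 / l1 * l3) / (u13\<^sup>2 - m\<^sup>2 / r1\<^sup>2 * (m\<^sup>2 / rb\<^sup>2)))"
    if "m > 0" "ra > 0" "rb > 0" "l1 > 0" and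
      C: "C1 = l1 * r1 / m" "C3 = l3 * rb / m" "c12 = u12 * r1 * ra / m\<^sup>2" "c13 = u13 * r1 * rb / m\<^sup>2"
        "c23 = u23 * ra * rb / m\<^sup>2"
    for m ra rb l1 l3 u12 u13 u23 C1 C3 c12 c13 c23 :: real
  proof -
    have a: "c13 * c23 - c12 = (r1 * ra * rb\<^sup>2 / m ^ 4) * (u13 * u23 - m\<^sup>2 / rb\<^sup>2 * u12)"
      unfolding C using that(1-4) r by (simp add: field_simps power2_eq_square power4_eq_xxxx)
    have b: "C1 * c13 - C3 = (l1 * r1\<^sup>2 * rb / m ^ 3) * (u13 - m\<^sup>2 / r1\<^sup>2 / l1 * l3)"
      unfolding C using that(1-4) r by (simp add: field_simps power2_eq_square power3_eq_cube)
    have c: "c13\<^sup>2 - 1 = (r1\<^sup>2 * rb\<^sup>2 / m ^ 4) * (u13\<^sup>2 - m\<^sup>2 / r1\<^sup>2 * (m\<^sup>2 / rb\<^sup>2))"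
      unfolding C using that(1-4) r by (simp add: field_simps power2_eq_square power4_eq_xxxx)
    have k: "m\<^sup>2 * ((\<alpha> * x) * (\<beta> * y) / (\<gamma> * z)) / C1 = (m\<^sup>2 * \<alpha> * \<beta> / \<gamma> / C1) * (x * y / z)"
      for \<alpha> \<beta> \<gamma> x y z :: real by (simp add: ac_simps)
    have "m\<^sup>2 * (r1 * ra * rb\<^sup>2 / m ^ 4) * (l1 * r1\<^sup>2 * rb / m ^ 3) / (r1\<^sup>2 * rb\<^sup>2 / m ^ 4) / C1 = ra * rb"
      unfolding C(1) using that(1-4) r by (simp add: field_simps power2_eq_square power3_eq_cube)
    then show ?thesis unfolding a b c k by simp
  qed
  have lims: "(L1 \<longlongrightarrow> e1) (at_right 0)" "(L2 \<longlongrightarrow> e2) (at_right 0)" "(L3 \<longlongrightarrow> e3) (at_right 0)"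
    "((\<lambda>m. m\<^sup>2 / r1\<^sup>2 / L1 m) \<longlongrightarrow> 0) (at_right 0)"
    unfolding L1_def L2_def L3_def using tendsto_hyp_L e tendsto_sq_over_hyp_L r by auto
  have k: "((\<lambda>m. m\<^sup>2 / r\<^sup>2) \<longlongrightarrow> 0) (at_right 0)" for r :: real
  proof -
    have "((\<lambda>m. m\<^sup>2 * inverse (r\<^sup>2)) \<longlongrightarrow> 0\<^sup>2 * inverse (r\<^sup>2)) (at_right 0)" by (intro tendsto_intros)
    then show ?thesis by (simp add: divide_inverse)
  qed
  have t1: "(T \<longlongrightarrow> r2 * r3 *
    (((e1 * e3 + n13) * (e2 * e3 + n23) - 0 * (e1 * e2 + n12)) *
       ((e1 * e3 + n13) - 0 * e3) / ((e1 * e3 + n13)\<^sup>2 - 0 * 0)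
    + ((e1 * e2 + n12) * (e2 * e3 + n23) - 0 * (e1 * e3 + n13)) *
       ((e1 * e2 + n12) - 0 * e2) / ((e1 * e2 + n12)\<^sup>2 - 0 * 0))) (at_right 0)"
    unfolding T_def using n by (intro tendsto_intros lims k) auto
  have t2: "r2 * r3 *
    (((e1 * e3 + n13) * (e2 * e3 + n23) - 0 * (e1 * e2 + n12)) *
       ((e1 * e3 + n13) - 0 * e3) / ((e1 * e3 + n13)\<^sup>2 - 0 * 0)
    + ((e1 * e2 + n12) * (e2 * e3 + n23) - 0 * (e1 * e3 + n13)) *
       ((e1 * e2 + n12) - 0 * e2) / ((e1 * e2 + n12)\<^sup>2 - 0 * 0)) = r2 * r3 * (2 * (e2 * e3 + n23))"
  proof -
    have "x * y * x / x\<^sup>2 = y" if "x > 0" for x y :: real using that by (simp add: power2_eq_square)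
    then show ?thesis using n by simp
  qed
  have t3: "\<forall>\<^sub>F m in at_right 0. T m = m\<^sup>2 * hyp_diag (hyp_C e1 (r1 / m)) (hyp_C e2 (r2 / m)) (hyp_C e3 (r3 / m))
       (hyp_c e1 e2 n12 (r1 / m) (r2 / m)) (hyp_c e1 e3 n13 (r1 / m) (r3 / m))
       (hyp_c e2 e3 n23 (r2 / m) (r3 / m)) / hyp_C e1 (r1 / m)"
  proof (rule eventually_mono[OF eventually_at_right_less])
    fix m :: real assume m: "0 < m"
    have L: "L1 m > 0" using hyp_L_pos e r m by (simp add: L1_def)
    note c = hyp_C_scaled[OF r(1) m, of e1, folded L1_def] hyp_C_scaled[OF r(2) m, of e2, folded L2_def]
      hyp_C_scaled[OF r(3) m, of e3, folded L3_def]
      hyp_c_scaled[OF r(1) r(2) m, of e1 e2 n12, folded L1_def L2_def]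
      hyp_c_scaled[OF r(1) r(3) m, of e1 e3 n13, folded L1_def L3_def]
      hyp_c_scaled[OF r(2) r(3) m, of e2 e3 n23, folded L2_def L3_def]
    have c': "hyp_c e2 e3 n23 (r2 / m) (r3 / m) = (L2 m * L3 m + n23) * r3 * r2 / m\<^sup>2"
      using c(6) by (simp add: mult.commute mult.left_commute)
    show "T m = m\<^sup>2 * hyp_diag (hyp_C e1 (r1 / m)) (hyp_C e2 (r2 / m)) (hyp_C e3 (r3 / m))
       (hyp_c e1 e2 n12 (r1 / m) (r2 / m)) (hyp_c e1 e3 n13 (r1 / m) (r3 / m))
       (hyp_c e2 e3 n23 (r2 / m) (r3 / m)) / hyp_C e1 (r1 / m)"
      unfolding hyp_diag_def distrib_left add_divide_distrib
        diag_term[OF m r(2) r(3) L c(1) c(3) c(4) c(5) c(6)] diag_term[OF m r(3) r(2) L c(1) c(2) c(5) c(4) c']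
        T_def
      by (simp add: mult.commute)
  qed
  show ?thesis by (rule Lim_transform_eventually[OF t1[unfolded t2] t3])
qed

text \<open>The value of the limit is irrelevant. Off-diagonal entries grow at most like
  \<open>1 / m\<close>, so their squares are negligible against products of two diagonal entries,
  which grow at least like the fourth power of \<open>1 / m\<close>.\<close>

lemma hyp_off_limit:
  "\<exists>l. ((\<lambda>m. m * hyp_off (hyp_C e1 (r1 / m)) (hyp_C e2 (r2 / m)) (hyp_C e3 (r3 / m))
       (hyp_c e1 e2 n12 (r1 / m) (r2 / m)) (hyp_c e1 e3 n13 (r1 / m) (r3 / m))
       (hyp_c e2 e3 n23 (r2 / m) (r3 / m))) \<longlongrightarrow> l) (at_right 0)"
proof -
  define L1 where "L1 = hyp_L e1 r1"
  define L2 where "L2 = hyp_L e2 r2"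
  define L3 where "L3 = hyp_L e3 r3"
  define T where "T m = r3 * (L3 m -
    (L1 m * ((L1 m * L2 m + n12) * (L2 m * L3 m + n23) - m\<^sup>2 / r2\<^sup>2 * (L1 m * L3 m + n13))
     + L2 m * ((L1 m * L2 m + n12) * (L1 m * L3 m + n13) - m\<^sup>2 / r1\<^sup>2 * (L2 m * L3 m + n23))) /
       ((L1 m * L2 m + n12)\<^sup>2 - m\<^sup>2 / r1\<^sup>2 * (m\<^sup>2 / r2\<^sup>2)))" for m
  have lims: "(L1 \<longlongrightarrow> e1) (at_right 0)" "(L2 \<longlongrightarrow> e2) (at_right 0)" "(L3 \<longlongrightarrow> e3) (at_right 0)"
    unfolding L1_def L2_def L3_def using tendsto_hyp_L e by auto
  have k: "((\<lambda>m. m\<^sup>2 / r\<^sup>2) \<longlongrightarrow> 0) (at_right 0)" for r :: real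
  proof -
    have "((\<lambda>m. m\<^sup>2 * inverse (r\<^sup>2)) \<longlongrightarrow> 0\<^sup>2 * inverse (r\<^sup>2)) (at_right 0)" by (intro tendsto_intros)
    then show ?thesis by (simp add: divide_inverse)
  qed
  have t1: "(T \<longlongrightarrow> r3 * (e3 -
    (e1 * ((e1 * e2 + n12) * (e2 * e3 + n23) - 0 * (e1 * e3 + n13))
     + e2 * ((e1 * e2 + n12) * (e1 * e3 + n13) - 0 * (e2 * e3 + n23))) /
       ((e1 * e2 + n12)\<^sup>2 - 0 * 0))) (at_right 0)"
    unfolding T_def using n by (intro tendsto_intros lims k) auto
  have t3: "\<forall>\<^sub>F m in at_right 0. T m = m * hyp_off (hyp_C e1 (r1 / m)) (hyp_C e2 (r2 / m)) (hyp_C e3 (r3 / m))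
       (hyp_c e1 e2 n12 (r1 / m) (r2 / m)) (hyp_c e1 e3 n13 (r1 / m) (r3 / m))
       (hyp_c e2 e3 n23 (r2 / m) (r3 / m))"
  proof (rule eventually_mono[OF eventually_at_right_less])
    fix m :: real assume m: "0 < m"
    define u12 where "u12 = L1 m * L2 m + n12"
    define u13 where "u13 = L1 m * L3 m + n13"
    define u23 where "u23 = L2 m * L3 m + n23"
    have c: "hyp_C e1 (r1 / m) = L1 m * r1 / m" "hyp_C e2 (r2 / m) = L2 m * r2 / m"
      "hyp_C e3 (r3 / m) = L3 m * r3 / m" "hyp_c e1 e2 n12 (r1 / m) (r2 / m) = u12 * r1 * r2 / m\<^sup>2"
      "hyp_c e1 e3 n13 (r1 / m) (r3 / m) = u13 * r1 * r3 / m\<^sup>2"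
      "hyp_c e2 e3 n23 (r2 / m) (r3 / m) = u23 * r2 * r3 / m\<^sup>2"
      using hyp_C_scaled hyp_c_scaled r m by (simp_all add: L1_def L2_def L3_def u12_def u13_def u23_def)
    have num: "L1 m * r1 / m * (u12 * r1 * r2 / m\<^sup>2 * (u23 * r2 * r3 / m\<^sup>2) - u13 * r1 * r3 / m\<^sup>2) +
        L2 m * r2 / m * (u12 * r1 * r2 / m\<^sup>2 * (u13 * r1 * r3 / m\<^sup>2) - u23 * r2 * r3 / m\<^sup>2)
      = (r1\<^sup>2 * r2\<^sup>2 * r3 / m ^ 5) * (L1 m * (u12 * u23 - m\<^sup>2 / r2\<^sup>2 * u13) + L2 m * (u12 * u13 - m\<^sup>2 / r1\<^sup>2 * u23))"
      using m r by (simp add: field_simps power2_eq_square power_numeral_reduce)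
    have den: "(u12 * r1 * r2 / m\<^sup>2)\<^sup>2 - 1 = (r1\<^sup>2 * r2\<^sup>2 / m ^ 4) * (u12\<^sup>2 - m\<^sup>2 / r1\<^sup>2 * (m\<^sup>2 / r2\<^sup>2))"
      using m r by (simp add: field_simps power2_eq_square power4_eq_xxxx)
    have fin: "r3 * (l - q) = m * (l * r3 / m - r3 / m * q)" for l q
      using m by (simp add: field_simps)
    have quot: "(r1\<^sup>2 * r2\<^sup>2 * r3 / m ^ 5) / (r1\<^sup>2 * r2\<^sup>2 / m ^ 4) = r3 / m"
      using m r by (simp add: field_simps power_numeral_reduce)
    show "T m = m * hyp_off (hyp_C e1 (r1 / m)) (hyp_C e2 (r2 / m)) (hyp_C e3 (r3 / m))
       (hyp_c e1 e2 n12 (r1 / m) (r2 / m)) (hyp_c e1 e3 n13 (r1 / m) (r3 / m))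
       (hyp_c e2 e3 n23 (r2 / m) (r3 / m))"
      unfolding hyp_off_def c num den times_divide_times_eq[symmetric] quot T_def
        u12_def[symmetric] u13_def[symmetric] u23_def[symmetric] by (rule fin)
  qed
  show ?thesis by (rule exI) (rule Lim_transform_eventually[OF t1 t3])
qed

end

lemma hyp_dominance_eventually:
  fixes p q f A B :: "real \<Rightarrow> real"
  assumes lim: "((\<lambda>m. m\<^sup>2 * p m / A m) \<longlongrightarrow> p0) (at_right 0)" "((\<lambda>m. m\<^sup>2 * q m / B m) \<longlongrightarrow> q0) (at_right 0)"
      "((\<lambda>m. m * f m) \<longlongrightarrow> l) (at_right 0)"
    and pos: "p0 > 0" "q0 > 0" and A: "\<And>m. A m \<ge> 1" "\<And>m. B m \<ge> 1"
  shows "\<forall>\<^sub>F m in at_right 0. p m > 0 \<and> 4 * (f m)\<^sup>2 < p m * q m"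
proof -
  have "((\<lambda>m. (m\<^sup>2 * p m / A m) * (m\<^sup>2 * q m / B m) - 4 * (m * f m)\<^sup>2 * m\<^sup>2) \<longlongrightarrow> p0 * q0 - 4 * l\<^sup>2 * 0\<^sup>2) (at_right 0)"
    by (intro tendsto_intros lim)
  then have "\<forall>\<^sub>F m in at_right 0. (m\<^sup>2 * p m / A m) * (m\<^sup>2 * q m / B m) - 4 * (m * f m)\<^sup>2 * m\<^sup>2 > 0"
    by (rule order_tendstoD(1)) (use pos in simp)
  moreover have "\<forall>\<^sub>F m in at_right 0. m\<^sup>2 * p m / A m > 0" by (rule order_tendstoD(1)[OF lim(1) pos(1)])
  moreover have "\<forall>\<^sub>F m :: real in at_right 0. m > 0" by (simp add: eventually_at_right_less)
  ultimately show ?thesis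
  proof eventually_elim
    case (elim m)
    have AB: "A m > 0" "B m > 0" using A[of m] by linarith+
    then have "p m > 0" using elim by (simp add: zero_less_divide_iff zero_less_mult_iff)
    have "1 \<le> A m * B m" using A(1)[of m] A(2)[of m] mult_mono[of 1 "A m" 1 "B m"] by simp
    have eq1: "(m\<^sup>2 * p m / A m) * (m\<^sup>2 * q m / B m) = m ^ 4 * (p m * q m / (A m * B m))"
      by (simp add: power2_eq_square power4_eq_xxxx)
    have eq2: "4 * (m * f m)\<^sup>2 * m\<^sup>2 = m ^ 4 * (4 * (f m)\<^sup>2)"
      by (simp add: power2_eq_square power4_eq_xxxx)
    have "m ^ 4 * (p m * q m / (A m * B m) - 4 * (f m)\<^sup>2) > 0"
      using elim(1) unfolding eq1 eq2 right_diff_distrib .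
    then have lt: "4 * (f m)\<^sup>2 < p m * q m / (A m * B m)" using elim by (simp add: zero_less_mult_iff)
    moreover have "0 \<le> 4 * (f m)\<^sup>2" by simp
    ultimately have "0 < p m * q m / (A m * B m)" by linarith
    then have "0 < p m * q m" using pos_less_divide_eq[OF mult_pos_pos[OF AB], of 0] by simp
    then have "p m * q m / (A m * B m) \<le> p m * q m"
      using \<open>1 \<le> A m * B m\<close> AB mult_left_mono[of 1 "A m * B m" "p m * q m"] by (simp add: pos_divide_le_eq)
    with lt \<open>p m > 0\<close> show ?case by simp
  qed
qed

lemma hyp_continuous:
  assumes e: "e1 \<in> {0, 1}" "e2 \<in> {0, 1}" "e3 \<in> {0, 1}" and n: "e1 * e2 + n12 > 0" "e1 * e3 + n13 > 0"
    and r: "r1 > 0" "r2 > 0" "r3 > 0" and m: "m > 0"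
  shows "isCont (\<lambda>m. hyp_diag (hyp_C e1 (r1 / m)) (hyp_C e2 (r2 / m)) (hyp_C e3 (r3 / m))
       (hyp_c e1 e2 n12 (r1 / m) (r2 / m)) (hyp_c e1 e3 n13 (r1 / m) (r3 / m))
       (hyp_c e2 e3 n23 (r2 / m) (r3 / m))) m"
    and "isCont (\<lambda>m. hyp_off (hyp_C e1 (r1 / m)) (hyp_C e2 (r2 / m)) (hyp_C e3 (r3 / m))
       (hyp_c e1 e2 n12 (r1 / m) (r2 / m)) (hyp_c e1 e3 n13 (r1 / m) (r3 / m))
       (hyp_c e2 e3 n23 (r2 / m) (r3 / m))) m"
proof -
  have C: "isCont (\<lambda>m. hyp_C e (r / m)) m" for e r
    unfolding hyp_C_def using m by (intro continuous_intros) auto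
  have c: "isCont (\<lambda>m. hyp_c e e' n (r / m) (r' / m)) m" for e e' n r r'
    unfolding hyp_c_def using m by (intro continuous_intros C) auto
  have "hyp_c e1 e2 n12 (r1 / m) (r2 / m) > 1" "hyp_c e1 e3 n13 (r1 / m) (r3 / m) > 1"
    using e n r m by (auto intro!: hyp_c_gt_1)
  then have "(hyp_c e1 e2 n12 (r1 / m) (r2 / m))\<^sup>2 - 1 \<noteq> 0" "(hyp_c e1 e3 n13 (r1 / m) (r3 / m))\<^sup>2 - 1 \<noteq> 0"
    by (auto simp: power2_eq_1_iff)
  note nz = this
  show "isCont (\<lambda>m. hyp_diag (hyp_C e1 (r1 / m)) (hyp_C e2 (r2 / m)) (hyp_C e3 (r3 / m))
       (hyp_c e1 e2 n12 (r1 / m) (r2 / m)) (hyp_c e1 e3 n13 (r1 / m) (r3 / m))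
       (hyp_c e2 e3 n23 (r2 / m) (r3 / m))) m"
    unfolding hyp_diag_def by (intro continuous_intros C c nz)
  show "isCont (\<lambda>m. hyp_off (hyp_C e1 (r1 / m)) (hyp_C e2 (r2 / m)) (hyp_C e3 (r3 / m))
       (hyp_c e1 e2 n12 (r1 / m) (r2 / m)) (hyp_c e1 e3 n13 (r1 / m) (r3 / m))
       (hyp_c e2 e3 n23 (r2 / m) (r3 / m))) m"
    unfolding hyp_off_def by (intro continuous_intros C c nz)
qed

text \<open>The radii \<open>r1 / m\<close>, \<open>r2 / m\<close>, \<open>r3 / m\<close> join the
  given triangle at \<open>m = 1\<close> to triangles with huge radii. Diagonal dominance settles
  small m, and \<open>hyp_det_pos_scaled\<close> with \<open>hyp_cubic_pos\<close> excludes a kernel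
  on the way.\<close>

lemma hyp_form_pos:
  assumes st: "structure_triple e1 e2 e3 n12 n13 n23" and r: "r1 > 0" "r2 > 0" "r3 > 0"
  defines "C1 \<equiv> hyp_C e1 r1" and "C2 \<equiv> hyp_C e2 r2" and "C3 \<equiv> hyp_C e3 r3"
  defines "c12 \<equiv> hyp_c e1 e2 n12 r1 r2" and "c13 \<equiv> hyp_c e1 e3 n13 r1 r3" and "c23 \<equiv> hyp_c e2 e3 n23 r2 r3"
  assumes det: "hyp_det c12 c13 c23 > 0" and h: "(h1, h2, h3) \<noteq> (0, 0, 0)"
  shows "quad3 (hyp_diag C1 C2 C3 c12 c13 c23) (hyp_diag C2 C1 C3 c12 c23 c13) (hyp_diag C3 C1 C2 c13 c23 c12)
     (hyp_off C1 C2 C3 c12 c13 c23) (hyp_off C1 C3 C2 c13 c12 c23) (hyp_off C2 C3 C1 c23 c12 c13) h1 h2 h3 > 0"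
proof -
  have e: "e1 \<in> {0, 1}" "e2 \<in> {0, 1}" "e3 \<in> {0, 1}"
    and n: "e1 * e2 + n12 > 0" "e1 * e3 + n13 > 0" "e2 * e3 + n23 > 0"
    using st by (auto simp: structure_triple_def)
  have n': "e2 * e1 + n12 > 0" "e3 * e1 + n13 > 0" "e3 * e2 + n23 > 0" using n by (simp_all add: mult.commute)
  define a where "a m = hyp_diag (hyp_C e1 (r1 / m)) (hyp_C e2 (r2 / m)) (hyp_C e3 (r3 / m))
       (hyp_c e1 e2 n12 (r1 / m) (r2 / m)) (hyp_c e1 e3 n13 (r1 / m) (r3 / m))
       (hyp_c e2 e3 n23 (r2 / m) (r3 / m))" for m
  define b where "b m = hyp_diag (hyp_C e2 (r2 / m)) (hyp_C e1 (r1 / m)) (hyp_C e3 (r3 / m))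
       (hyp_c e2 e1 n12 (r2 / m) (r1 / m)) (hyp_c e2 e3 n23 (r2 / m) (r3 / m))
       (hyp_c e1 e3 n13 (r1 / m) (r3 / m))" for m
  define c where "c m = hyp_diag (hyp_C e3 (r3 / m)) (hyp_C e1 (r1 / m)) (hyp_C e2 (r2 / m))
       (hyp_c e3 e1 n13 (r3 / m) (r1 / m)) (hyp_c e3 e2 n23 (r3 / m) (r2 / m))
       (hyp_c e1 e2 n12 (r1 / m) (r2 / m))" for m
  define f where "f m = hyp_off (hyp_C e1 (r1 / m)) (hyp_C e2 (r2 / m)) (hyp_C e3 (r3 / m))
       (hyp_c e1 e2 n12 (r1 / m) (r2 / m)) (hyp_c e1 e3 n13 (r1 / m) (r3 / m))
       (hyp_c e2 e3 n23 (r2 / m) (r3 / m))" for m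
  define g where "g m = hyp_off (hyp_C e1 (r1 / m)) (hyp_C e3 (r3 / m)) (hyp_C e2 (r2 / m))
       (hyp_c e1 e3 n13 (r1 / m) (r3 / m)) (hyp_c e1 e2 n12 (r1 / m) (r2 / m))
       (hyp_c e3 e2 n23 (r3 / m) (r2 / m))" for m
  define k where "k m = hyp_off (hyp_C e2 (r2 / m)) (hyp_C e3 (r3 / m)) (hyp_C e1 (r1 / m))
       (hyp_c e2 e3 n23 (r2 / m) (r3 / m)) (hyp_c e2 e1 n12 (r2 / m) (r1 / m))
       (hyp_c e3 e1 n13 (r3 / m) (r1 / m))" for m
  note comm = hyp_c_commute[of e2 e1] hyp_c_commute[of e3 e1] hyp_c_commute[of e3 e2]
  have "quad3 (a 1) (b 1) (c 1) (f 1) (g 1) (k 1) h1 h2 h3 > 0"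
  proof (rule quad3_pos_continuation[OF _ _ _ h])
    fix m :: real assume m: "0 < m" "m \<le> 1"
    show "isCont a m \<and> isCont b m \<and> isCont c m \<and> isCont f m \<and> isCont g m \<and> isCont k m"
      unfolding a_def b_def c_def f_def g_def k_def
      using hyp_continuous(1)[OF e(1,2,3) n(1,2) r(1,2,3) m(1), of n23]
        hyp_continuous(1)[OF e(2,1,3) n'(1) n(3) r(2,1,3) m(1), of n13]
        hyp_continuous(1)[OF e(3,1,2) n'(2,3) r(3,1,2) m(1), of n12]
        hyp_continuous(2)[OF e(1,2,3) n(1,2) r(1,2,3) m(1), of n23]
        hyp_continuous(2)[OF e(1,3,2) n(2,1) r(1,3,2) m(1), of n23]
        hyp_continuous(2)[OF e(2,3,1) n(3) n'(1) r(2,3,1) m(1), of n13]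
      by blast
    fix x y z
    assume z: "a m * x + f m * y + g m * z = 0" "f m * x + b m * y + k m * z = 0" "g m * x + k m * y + c m * z = 0"
    define C1' C2' C3' where C': "C1' = hyp_C e1 (r1 / m)" "C2' = hyp_C e2 (r2 / m)" "C3' = hyp_C e3 (r3 / m)"
    define c12' c13' c23' where c': "c12' = hyp_c e1 e2 n12 (r1 / m) (r2 / m)"
      "c13' = hyp_c e1 e3 n13 (r1 / m) (r3 / m)" "c23' = hyp_c e2 e3 n23 (r2 / m) (r3 / m)"
    have eqs: "a m = hyp_diag C1' C2' C3' c12' c13' c23'" "b m = hyp_diag C2' C1' C3' c12' c23' c13'"
      "c m = hyp_diag C3' C1' C2' c13' c23' c12'" "f m = hyp_off C1' C2' C3' c12' c13' c23'"
      "g m = hyp_off C1' C3' C2' c13' c12' c23'" "k m = hyp_off C2' C3' C1' c23' c12' c13'"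
      unfolding a_def b_def c_def f_def g_def k_def C' c' comm by (rule refl)+
    have rm: "r1 / m > 0" "r2 / m > 0" "r3 / m > 0" using r m by auto
    have "c12' > 1" "c13' > 1" "c23' > 1" unfolding c' using hyp_c_gt_1 e n rm by auto
    then have cc: "c12'\<^sup>2 \<noteq> 1" "c13'\<^sup>2 \<noteq> 1" "c23'\<^sup>2 \<noteq> 1" by (auto simp: power2_eq_1_iff)
    have "hyp_det c12' c13' c23' > 0"
      using hyp_det_pos_scaled[OF st r, of "1 / m"] det m unfolding c' c12_def c13_def c23_def by simp
    then have dd: "hyp_det c12' c13' c23' \<noteq> 0" by simp
    have X: "(C1' * c12' - C2') * (C2' * c23' - C3') * (C3' * c13' - C1')
          + (C2' * c12' - C1') * (C3' * c23' - C2') * (C1' * c13' - C3') \<noteq> 0"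
      using hyp_cubic_pos[OF st rm] unfolding C' c' by simp
    have rows: "hyp_diag C1' C2' C3' c12' c13' c23' * x + hyp_off C1' C2' C3' c12' c13' c23' * y + hyp_off C1' C3' C2' c13' c12' c23' * z = 0"
      "hyp_diag C2' C1' C3' c12' c23' c13' * y + hyp_off C2' C1' C3' c12' c23' c13' * x + hyp_off C2' C3' C1' c23' c12' c13' * z = 0"
      "hyp_diag C3' C1' C2' c13' c23' c12' * z + hyp_off C3' C1' C2' c13' c23' c12' * x + hyp_off C3' C2' C1' c23' c13' c12' * y = 0"
      using z unfolding eqs hyp_off_swap[of C2' C1'] hyp_off_swap[of C3' C1'] hyp_off_swap[of C3' C2'] by simp_all
    show "(x, y, z) = (0, 0, 0)" using hyp_nondegenerate[OF cc dd X rows] by simp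
  next
    obtain lf lg lk where lf: "((\<lambda>m. m * f m) \<longlongrightarrow> lf) (at_right 0)"
      and lg: "((\<lambda>m. m * g m) \<longlongrightarrow> lg) (at_right 0)" and lk: "((\<lambda>m. m * k m) \<longlongrightarrow> lk) (at_right 0)"
      using hyp_off_limit[OF e(1,2,3) n(1,2,3) r(1,2,3)] hyp_off_limit[OF e(1,3,2) n(2,1) n'(3) r(1,3,2)]
        hyp_off_limit[OF e(2,3,1) n(3) n'(1) n'(2) r(2,3,1)]
      unfolding f_def g_def k_def by blast
    have C1: "hyp_C e1 x \<ge> 1" "hyp_C e2 x \<ge> 1" "hyp_C e3 x \<ge> 1" for x using hyp_C_facts(2) e by auto
    note la = hyp_diag_limit[OF e(1,2,3) n(1,2,3) r(1,2,3), folded a_def]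
    note lb = hyp_diag_limit[OF e(2,1,3) n'(1) n(3,2) r(2,1,3), folded b_def]
    note lc = hyp_diag_limit[OF e(3,1,2) n'(2,3) n(1) r(3,1,2), folded c_def]
    have p: "r2 * r3 * (2 * (e2 * e3 + n23)) > 0" "r1 * r3 * (2 * (e1 * e3 + n13)) > 0"
      "r1 * r2 * (2 * (e1 * e2 + n12)) > 0" using r n by auto
    have "\<forall>\<^sub>F m in at_right 0. c m > 0 \<and> 4 * (g m)\<^sup>2 < c m * a m"
      by (rule hyp_dominance_eventually[OF lc la lg p(3) p(1)]) (rule C1)+
    with hyp_dominance_eventually[OF la lb lf p(1) p(2)] hyp_dominance_eventually[OF lb lc lk p(2) p(3)]
    have "\<forall>\<^sub>F m in at_right 0. a m > 0 \<and> b m > 0 \<and> c m > 0 \<and> 4 * (f m)\<^sup>2 < a m * b m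
       \<and> 4 * (g m)\<^sup>2 < a m * c m \<and> 4 * (k m)\<^sup>2 < b m * c m"
      using C1 by (simp add: eventually_conj_iff mult.commute)
    then show "\<forall>\<^sub>F m in at_right 0. \<forall>x y z. (x, y, z) \<noteq> (0, 0, 0) \<longrightarrow>
        quad3 (a m) (b m) (c m) (f m) (g m) (k m) x y z > 0"
      by (rule eventually_mono) (intro allI impI quad3_diag_dominant, auto)
  qed
  then show ?thesis unfolding a_def b_def c_def f_def g_def k_def comm div_by_1
      C1_def C2_def C3_def c12_def c13_def c23_def .
qed

lemma hyperbolic_form_neg:
  assumes st: "structure_triple e1 e2 e3 n12 n13 n23" and r: "r1 > 0" "r2 > 0" "r3 > 0"
  defines "C1 \<equiv> hyp_C e1 r1" and "C2 \<equiv> hyp_C e2 r2" and "C3 \<equiv> hyp_C e3 r3"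
  defines "c12 \<equiv> hyp_c e1 e2 n12 r1 r2" and "c13 \<equiv> hyp_c e1 e3 n13 r1 r3" and "c23 \<equiv> hyp_c e2 e3 n23 r2 r3"
  assumes det: "hyp_det c12 c13 c23 > 0"
  shows "\<exists>d>0. \<forall>h1 h2 h3 y12 y13 y23.
    y12 = (C1 * c12 - C2) * h1 + (C2 * c12 - C1) * h2 \<longrightarrow>
    y13 = (C1 * c13 - C3) * h1 + (C3 * c13 - C1) * h3 \<longrightarrow>
    y23 = (C2 * c23 - C3) * h2 + (C3 * c23 - C2) * h3 \<longrightarrow>
      h1 * (y23 - y12 * (c12 * c23 - c13) / (c12\<^sup>2 - 1) - y13 * (c13 * c23 - c12) / (c13\<^sup>2 - 1))
    + h2 * (y13 - y23 * (c23 * c13 - c12) / (c23\<^sup>2 - 1) - y12 * (c12 * c13 - c23) / (c12\<^sup>2 - 1))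
    + h3 * (y12 - y13 * (c13 * c12 - c23) / (c13\<^sup>2 - 1) - y23 * (c23 * c12 - c13) / (c23\<^sup>2 - 1))
    \<le> - d * (h1\<^sup>2 + h2\<^sup>2 + h3\<^sup>2)"
proof -
  have e: "e1 \<in> {0, 1}" "e2 \<in> {0, 1}" "e3 \<in> {0, 1}"
    and n: "e1 * e2 + n12 > 0" "e1 * e3 + n13 > 0" "e2 * e3 + n23 > 0"
    using st by (auto simp: structure_triple_def)
  let ?q = "quad3 (hyp_diag C1 C2 C3 c12 c13 c23) (hyp_diag C2 C1 C3 c12 c23 c13) (hyp_diag C3 C1 C2 c13 c23 c12)
     (hyp_off C1 C2 C3 c12 c13 c23) (hyp_off C1 C3 C2 c13 c12 c23) (hyp_off C2 C3 C1 c23 c12 c13)"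
  obtain d where d: "d > 0" and le: "\<And>x y z. ?q x y z \<ge> d * (x\<^sup>2 + y\<^sup>2 + z\<^sup>2)"
    using quad3_coercive[OF hyp_form_pos[OF st r det[unfolded c12_def c13_def c23_def]]]
    unfolding C1_def C2_def C3_def c12_def c13_def c23_def by blast
  have "c12 > 1" "c13 > 1" "c23 > 1" unfolding c12_def c13_def c23_def using hyp_c_gt_1 e n r by auto
  then have c: "c12\<^sup>2 \<noteq> 1" "c13\<^sup>2 \<noteq> 1" "c23\<^sup>2 \<noteq> 1" by (auto simp: power2_eq_1_iff)
  show ?thesis
  proof (intro exI[of _ d] conjI allI impI)
    fix h1 h2 h3 y12 y13 y23
    assume y: "y12 = (C1 * c12 - C2) * h1 + (C2 * c12 - C1) * h2"
      "y13 = (C1 * c13 - C3) * h1 + (C3 * c13 - C1) * h3"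
      "y23 = (C2 * c23 - C3) * h2 + (C3 * c23 - C2) * h3"
    have y': "y12 = (C2 * c12 - C1) * h2 + (C1 * c12 - C2) * h1"
      "y13 = (C3 * c13 - C1) * h3 + (C1 * c13 - C3) * h1"
      "y23 = (C3 * c23 - C2) * h3 + (C2 * c23 - C3) * h2" using y by auto
    have r1: "y23 - y12 * (c12 * c23 - c13) / (c12\<^sup>2 - 1) - y13 * (c13 * c23 - c12) / (c13\<^sup>2 - 1) =
        - (hyp_diag C1 C2 C3 c12 c13 c23 * h1 + hyp_off C1 C2 C3 c12 c13 c23 * h2 + hyp_off C1 C3 C2 c13 c12 c23 * h3)"
      using hyp_row[OF c(1,2), of C1 C2 h1 h2 c23 C3 h3, folded y] by linarith
    have r2: "y13 - y23 * (c23 * c13 - c12) / (c23\<^sup>2 - 1) - y12 * (c12 * c13 - c23) / (c12\<^sup>2 - 1) =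
        - (hyp_diag C2 C1 C3 c12 c23 c13 * h2 + hyp_off C1 C2 C3 c12 c13 c23 * h1 + hyp_off C2 C3 C1 c23 c12 c13 * h3)"
      using hyp_row[OF c(1,3), of C2 C1 h2 h1 c13 C3 h3, folded y(2,3) y'(1)]
      unfolding hyp_off_swap[of C2 C1] by linarith
    have r3: "y12 - y13 * (c13 * c12 - c23) / (c13\<^sup>2 - 1) - y23 * (c23 * c12 - c13) / (c23\<^sup>2 - 1) =
        - (hyp_diag C3 C1 C2 c13 c23 c12 * h3 + hyp_off C1 C3 C2 c13 c12 c23 * h1 + hyp_off C2 C3 C1 c23 c12 c13 * h2)"
      using hyp_row[OF c(2,3), of C3 C1 h3 h1 c12 C2 h2, folded y(1) y'(2,3)]
      unfolding hyp_off_swap[of C3 C1] hyp_off_swap[of C3 C2] by linarith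
    show "h1 * (y23 - y12 * (c12 * c23 - c13) / (c12\<^sup>2 - 1) - y13 * (c13 * c23 - c12) / (c13\<^sup>2 - 1))
      + h2 * (y13 - y23 * (c23 * c13 - c12) / (c23\<^sup>2 - 1) - y12 * (c12 * c13 - c23) / (c12\<^sup>2 - 1))
      + h3 * (y12 - y13 * (c13 * c12 - c23) / (c13\<^sup>2 - 1) - y23 * (c23 * c12 - c13) / (c23\<^sup>2 - 1))
      \<le> - d * (h1\<^sup>2 + h2\<^sup>2 + h3\<^sup>2)"
      unfolding r1 r2 r3 using le[of h1 h2 h3]
      by (simp add: quad3_def algebra_simps power2_eq_square)
  qed (fact d)
qed

section \<open>Lengths and angles in both geometries\<close>

text \<open>The value \<open>exp f\<close> at the coordinate u. In the case
  \<open>- 1 / sinh u\<close>, u is the logarithm of tanh of half the radius of the vertex circle,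
  and \<open>exp f\<close> is sinh of that radius.\<close>

definition radius :: "geometry \<Rightarrow> real \<Rightarrow> real \<Rightarrow> real" where
  "radius G e u = (if G = Hyperbolic \<and> e = 1 then - 1 / sinh u else exp u)"

definition u_domain :: "geometry \<Rightarrow> real \<Rightarrow> real set" where
  "u_domain G e = (if G = Hyperbolic \<and> e = 1 then {..<0} else UNIV)"

lemma radius_pos: "u \<in> u_domain G e \<Longrightarrow> radius G e u > 0"
  by (auto simp: radius_def u_domain_def divide_less_0_iff split: if_splits)

lemma u_coord_ln_radius:
  assumes "u \<in> u_domain G e"
  shows "u_coord G e (ln (radius G e u)) = u"
proof (cases "G = Hyperbolic \<and> e = 1")
  case True
  then have u: "u < 0" using assms by (simp add: u_domain_def)
  then have s: "sinh u < 0" by simp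
  have r: "- 1 / sinh u > 0" using s by (simp add: divide_neg_neg)
  then have "exp (2 * ln (- 1 / sinh u)) = (- 1 / sinh u)\<^sup>2"
    unfolding exp_double by (simp only: exp_ln)
  then have "1 + exp (2 * ln (- 1 / sinh u)) = (cosh u / sinh u)\<^sup>2"
    using s unfolding power_divide cosh_square_eq by (simp add: add_divide_distrib)
  then have C: "sqrt (1 + exp (2 * ln (- 1 / sinh u))) = - cosh u / sinh u"
    using s cosh_real_pos[of u] by (simp add: real_sqrt_abs abs_divide)
  have "- cosh u / sinh u - 1 = - (exp u / sinh u)" "- cosh u / sinh u + 1 = - (exp (- u) / sinh u)"
    using s by (simp_all add: cosh_plus_sinh[symmetric] cosh_minus_sinh[symmetric] field_simps)
  then have "(- cosh u / sinh u - 1) / (- cosh u / sinh u + 1) = exp u / exp (- u)"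
    using s by simp
  also have "\<dots> = exp (2 * u)" by (simp add: exp_diff[symmetric])
  finally have q: "(- cosh u / sinh u - 1) / (- cosh u / sinh u + 1) = exp (2 * u)" .
  have "u_coord G e (ln (radius G e u)) = 1 / 2 * (2 * u)"
    using True unfolding u_coord_def radius_def by (simp only: simp_thms if_True C q ln_exp)
  then show ?thesis by simp
qed (auto simp: u_coord_def radius_def)

lemma u_coord_in_domain: "u_coord G e x \<in> u_domain G e"
proof -
  have "(A - 1) / (A + 1) < 1 \<and> (A - 1) / (A + 1) > 0" if "A > 1" for A :: real
    using that by (simp add: divide_simps)
  from this[of "sqrt (1 + exp (2 * x))"] show ?thesis by (auto simp: u_coord_def u_domain_def)
qed

lemma inj_u_coord: "inj (u_coord G e)"
proof (cases "G = Hyperbolic \<and> e = 1")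
  case True
  show ?thesis
  proof (rule injI)
    fix x y assume eq: "u_coord G e x = u_coord G e y"
    define A where "A = sqrt (1 + exp (2 * x))"
    define B where "B = sqrt (1 + exp (2 * y))"
    have AB: "A > 1" "B > 1" unfolding A_def B_def by simp_all
    have "ln ((A - 1) / (A + 1)) = ln ((B - 1) / (B + 1))"
      using eq True by (simp add: u_coord_def A_def B_def)
    moreover have "(A - 1) / (A + 1) > 0" "(B - 1) / (B + 1) > 0" using AB by simp_all
    ultimately have "(A - 1) / (A + 1) = (B - 1) / (B + 1)" by simp
    then have "A = B" using AB by (simp add: field_simps)
    then show "x = y" unfolding A_def B_def by simp
  qed
qed (auto simp: u_coord_def inj_on_def)

lemma exp_inv_u_coord:
  assumes "u \<in> u_domain G e"
  shows "exp (inv (u_coord G e) u) = radius G e u"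
proof -
  have "inv (u_coord G e) u = ln (radius G e u)"
    using inv_f_f[OF inj_u_coord, of G e "ln (radius G e u)"] u_coord_ln_radius[OF assms] by simp
  then show ?thesis using radius_pos[OF assms] by simp
qed

text \<open>The squared length, respectively the hyperbolic cosine of the length: the function of
  the length in which the law of cosines becomes algebraic. \<open>quantity_bound\<close> is its
  value at length 0.\<close>

fun edge_quantity :: "geometry \<Rightarrow> real \<Rightarrow> real \<Rightarrow> real \<Rightarrow> real \<Rightarrow> real \<Rightarrow> real" where
  "edge_quantity Euclidean e e' n x y = e * x\<^sup>2 + e' * y\<^sup>2 + 2 * n * x * y"
| "edge_quantity Hyperbolic e e' n x y = hyp_c e e' n x y"

fun quantity_length :: "geometry \<Rightarrow> real \<Rightarrow> real" where
  "quantity_length Euclidean q = sqrt q"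
| "quantity_length Hyperbolic q = arcosh q"

fun quantity_bound :: "geometry \<Rightarrow> real" where
  "quantity_bound Euclidean = 0"
| "quantity_bound Hyperbolic = 1"

lemma edge_length_eq: "edge_length G e e' n f g = quantity_length G (edge_quantity G e e' n (exp f) (exp g))"
  by (cases G) (simp_all add: hyp_c_def hyp_C_def real_sqrt_mult exp_add exp_double mult.assoc)

lemma edge_quantity_commute: "edge_quantity G e e' n x y = edge_quantity G e' e n y x"
  by (cases G) (simp_all add: hyp_c_commute[of e e'])

lemma edge_quantity_gt:
  assumes "e \<in> {0, 1}" "e' \<in> {0, 1}" "e * e' + n > 0" "x > 0" "y > 0"
  shows "edge_quantity G e e' n x y > quantity_bound G"
proof (cases G)
  case Euclidean
  have "0 < 2 * (e * e' + n) * (x * y)" using assms by simp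
  also have "\<dots> \<le> e * x\<^sup>2 + e' * y\<^sup>2 + 2 * n * x * y"
    using assms sum_squares_bound[of x y] by (auto simp: algebra_simps power2_eq_square)
  finally show ?thesis using Euclidean by simp
qed (use hyp_c_gt_1[OF assms] in simp)

lemma quantity_length_pos: "q > quantity_bound G \<Longrightarrow> quantity_length G q > 0"
  by (cases G) auto

section \<open>The law of cosines and the triangle inequalities\<close>

fun cos_arg :: "geometry \<Rightarrow> real \<Rightarrow> real \<Rightarrow> real \<Rightarrow> real" where
  "cos_arg Euclidean a b c = (b + c - a) / (2 * sqrt b * sqrt c)"
| "cos_arg Hyperbolic a b c = (b * c - a) / (sqrt (b\<^sup>2 - 1) * sqrt (c\<^sup>2 - 1))"

text \<open>In the Euclidean case this is sixteen times the squared area, by Heron's formula in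
  squared side lengths.\<close>

fun quantity_det :: "geometry \<Rightarrow> real \<Rightarrow> real \<Rightarrow> real \<Rightarrow> real" where
  "quantity_det Euclidean a b c = 2 * a * b + 2 * a * c + 2 * b * c - a\<^sup>2 - b\<^sup>2 - c\<^sup>2"
| "quantity_det Hyperbolic a b c = hyp_det a b c"

lemma inner_angle_eq:
  assumes "a > quantity_bound G" "b > quantity_bound G" "c > quantity_bound G"
  shows "inner_angle G (quantity_length G a) (quantity_length G b) (quantity_length G c) = arccos (cos_arg G a b c)"
  using assms by (cases G) (simp_all add: sinh_arcosh_real)

lemma cos_arg_bounds:
  assumes "a > quantity_bound G" "b > quantity_bound G" "c > quantity_bound G"
  defines "x \<equiv> quantity_length G a" and "y \<equiv> quantity_length G b" and "z \<equiv> quantity_length G c"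
  shows "cos_arg G a b c < 1 \<longleftrightarrow> \<bar>y - z\<bar> < x" "- 1 < cos_arg G a b c \<longleftrightarrow> x < y + z"
proof -
  have pos: "x > 0" "y > 0" "z > 0" unfolding x_def y_def z_def using assms quantity_length_pos by auto
  show "cos_arg G a b c < 1 \<longleftrightarrow> \<bar>y - z\<bar> < x" "- 1 < cos_arg G a b c \<longleftrightarrow> x < y + z"
  proof (atomize (full), cases G)
    case Euclidean
    then have sq: "a = x\<^sup>2" "b = y\<^sup>2" "c = z\<^sup>2" using assms(1-3) by (auto simp: x_def y_def z_def)
    have 1: "cos_arg G a b c = (y\<^sup>2 + z\<^sup>2 - x\<^sup>2) / (2 * y * z)" using Euclidean pos by (simp add: sq)
    have "cos_arg G a b c < 1 \<longleftrightarrow> (y - z)\<^sup>2 < x\<^sup>2"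
      unfolding 1 using pos by (simp add: divide_less_eq power2_diff) linarith
    also have "\<dots> \<longleftrightarrow> \<bar>y - z\<bar> < x" using pos by (simp add: abs_square_less_1 flip: abs_le_square_iff not_le)
    finally have A: "cos_arg G a b c < 1 \<longleftrightarrow> \<bar>y - z\<bar> < x" .
    have "- 1 < cos_arg G a b c \<longleftrightarrow> x\<^sup>2 < (y + z)\<^sup>2"
      unfolding 1 using pos by (simp add: less_divide_eq power2_sum) linarith
    also have "\<dots> \<longleftrightarrow> x < y + z" using pos by (simp flip: abs_le_square_iff not_le)
    finally show "(cos_arg G a b c < 1) = (\<bar>y - z\<bar> < x) \<and> (- 1 < cos_arg G a b c) = (x < y + z)"
      using A by blast
  next
    case Hyperbolic
    then have ch: "a = cosh x" "b = cosh y" "c = cosh z" using assms(1-3) by (auto simp: x_def y_def z_def)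
    have "sqrt (b\<^sup>2 - 1) = sinh y" "sqrt (c\<^sup>2 - 1) = sinh z"
      using pos Hyperbolic assms(1-3) by (auto simp: y_def z_def sinh_arcosh_real)
    then have 1: "cos_arg G a b c = (cosh y * cosh z - cosh x) / (sinh y * sinh z)"
      using Hyperbolic by (simp add: ch)
    have s: "sinh y * sinh z > 0" using pos by simp
    have "cos_arg G a b c < 1 \<longleftrightarrow> cosh (y - z) < cosh x"
      unfolding 1 using s by (simp add: divide_less_eq cosh_diff) linarith
    also have "\<dots> \<longleftrightarrow> cosh \<bar>y - z\<bar> < cosh x" by (simp only: cosh_real_abs)
    also have "\<dots> \<longleftrightarrow> \<bar>y - z\<bar> < x" using pos by (intro cosh_real_nonneg_less_iff) auto
    finally have A: "cos_arg G a b c < 1 \<longleftrightarrow> \<bar>y - z\<bar> < x" .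
    have "- 1 < cos_arg G a b c \<longleftrightarrow> cosh x < cosh (y + z)"
      unfolding 1 using s by (simp add: less_divide_eq cosh_add) linarith
    also have "\<dots> \<longleftrightarrow> x < y + z" using pos by (intro cosh_real_nonneg_less_iff) auto
    finally show "(cos_arg G a b c < 1) = (\<bar>y - z\<bar> < x) \<and> (- 1 < cos_arg G a b c) = (x < y + z)"
      using A by blast
  qed
qed

text \<open>A violated triangle inequality pushes the expression of the law of cosines to or beyond
  1 or -1, so the extension by 0 and pi amounts to clamping the cosine. Continuity of the extended
  angles becomes plain.\<close>

lemma ext_angle_eq:
  assumes "a > quantity_bound G" "b > quantity_bound G" "c > quantity_bound G"
  shows "ext_angle G (quantity_length G a) (quantity_length G b) (quantity_length G c)
    = arccos (max (- 1) (min 1 (cos_arg G a b c)))"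
proof -
  have "\<bar>y - z\<bar> < x \<longleftrightarrow> y < x + z \<and> z < x + y" for x y z :: real by linarith
  then show ?thesis
    using cos_arg_bounds[OF assms] inner_angle_eq[OF assms]
    unfolding ext_angle_def strict_triangle_def
    by (auto simp: max_def min_def not_less)
qed

lemma one_minus_cos_arg_sq:
  assumes "b > quantity_bound G" "c > quantity_bound G"
  shows "1 - (cos_arg G a b c)\<^sup>2 = quantity_det G a b c /
     (case G of Euclidean \<Rightarrow> 4 * b * c | Hyperbolic \<Rightarrow> (b\<^sup>2 - 1) * (c\<^sup>2 - 1))"
proof (cases G)
  case Euclidean
  have "(2 * sqrt b * sqrt c)\<^sup>2 = 4 * b * c" using assms Euclidean by (simp add: power_mult_distrib)
  moreover have "4 * b * c \<noteq> 0" using assms Euclidean by simp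
  ultimately show ?thesis using Euclidean
    by (simp add: power_divide divide_simps) (simp add: algebra_simps power2_eq_square)
next
  case Hyperbolic
  then have "b\<^sup>2 > 1" "c\<^sup>2 > 1" using assms by (auto simp: one_less_power)
  then have nz: "(b\<^sup>2 - 1) * (c\<^sup>2 - 1) \<noteq> 0" and "(sqrt (b\<^sup>2 - 1) * sqrt (c\<^sup>2 - 1))\<^sup>2 = (b\<^sup>2 - 1) * (c\<^sup>2 - 1)"
    by (auto simp: power_mult_distrib)
  then have "1 - (cos_arg G a b c)\<^sup>2 = ((b\<^sup>2 - 1) * (c\<^sup>2 - 1) - (b * c - a)\<^sup>2) / ((b\<^sup>2 - 1) * (c\<^sup>2 - 1))"
    unfolding Hyperbolic cos_arg.simps power_divide by (simp add: diff_divide_distrib)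
  also have "(b\<^sup>2 - 1) * (c\<^sup>2 - 1) - (b * c - a)\<^sup>2 = hyp_det a b c"
    by (simp add: hyp_det_def algebra_simps power2_eq_square)
  finally show ?thesis using Hyperbolic by simp
qed

lemma cos_arg_less_iff:
  assumes "b > quantity_bound G" "c > quantity_bound G"
  shows "\<bar>cos_arg G a b c\<bar> < 1 \<longleftrightarrow> quantity_det G a b c > 0"
proof -
  have pos: "(case G of Euclidean \<Rightarrow> 4 * b * c | Hyperbolic \<Rightarrow> (b\<^sup>2 - 1) * (c\<^sup>2 - 1)) > 0"
    using assms by (cases G) (auto simp: one_less_power)
  have "\<bar>cos_arg G a b c\<bar> < 1 \<longleftrightarrow> 1 - (cos_arg G a b c)\<^sup>2 > 0"
    using abs_square_less_1[of "cos_arg G a b c"] by simp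
  also have "\<dots> \<longleftrightarrow> quantity_det G a b c > 0"
    unfolding one_minus_cos_arg_sq[OF assms] using pos_less_divide_eq[OF pos, of 0] by simp
  finally show ?thesis .
qed

text \<open>Nondegeneracy becomes positivity of one polynomial that is symmetric in the edges, so it
  is an open condition and the same at all three corners.\<close>

lemma strict_triangle_iff:
  assumes "a > quantity_bound G" "b > quantity_bound G" "c > quantity_bound G"
  shows "strict_triangle (quantity_length G a) (quantity_length G b) (quantity_length G c)
    \<longleftrightarrow> quantity_det G a b c > 0"
  unfolding cos_arg_less_iff[OF assms(2,3), symmetric] abs_less_iff strict_triangle_def
  using cos_arg_bounds[OF assms] by linarith

lemma quantity_det_rotate: "quantity_det G a b c = quantity_det G b c a"
  by (cases G) (simp_all add: hyp_det_def algebra_simps)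

lemma quantity_det_swap: "quantity_det G a b c = quantity_det G a c b"
  by (cases G) (simp_all add: hyp_det_def algebra_simps)

section \<open>Variation of the angles\<close>

text \<open>For squared lengths a, b, c of Euclidean sides, the ratio of the projection of the first
  side onto the second to the second side.\<close>

fun angle_coeff :: "geometry \<Rightarrow> real \<Rightarrow> real \<Rightarrow> real \<Rightarrow> real" where
  "angle_coeff Euclidean a b c = (b - c + a) / (2 * b)"
| "angle_coeff Hyperbolic a b c = (b * a - c) / (b\<^sup>2 - 1)"

text \<open>The denominator is the same for all three angles of a triangle, so the sign of their
  pairing with a direction is decided by the numerators.\<close>

lemma has_derivative_angle:
  fixes a b c :: "'b :: real_normed_vector \<Rightarrow> real"
  assumes d: "(a has_derivative a') (at p)" "(b has_derivative b') (at p)" "(c has_derivative c') (at p)"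
    and gt: "a p > quantity_bound G" "b p > quantity_bound G" "c p > quantity_bound G"
    and det: "quantity_det G (a p) (b p) (c p) > 0"
  shows "((\<lambda>p. arccos (cos_arg G (a p) (b p) (c p))) has_derivative
     (\<lambda>h. (a' h - b' h * angle_coeff G (a p) (b p) (c p) - c' h * angle_coeff G (a p) (c p) (b p))
        / sqrt (quantity_det G (a p) (b p) (c p)))) (at p)"
proof -
  define z where "z p = cos_arg G (a p) (b p) (c p)" for p
  define S where "S = sqrt (quantity_det G (a p) (b p) (c p))"
  have "\<bar>z p\<bar> < 1" unfolding z_def cos_arg_less_iff[OF gt(2,3)] by (rule det)
  then have z1: "-1 < z p" "z p < 1" by linarith+
  have S: "S > 0" using det by (simp add: S_def)
  \<comment> \<open>\<open>k\<close> is the denominator of \<open>cos_arg\<close> at p; after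
    multiplication by it both geometries have the same shape.\<close>
  have "\<exists>z' k. (z has_derivative z') (at p) \<and> k > 0 \<and> sqrt (1 - (z p)\<^sup>2) = S / k \<and>
     (\<forall>h. - z' h * k = a' h - b' h * angle_coeff G (a p) (b p) (c p) - c' h * angle_coeff G (a p) (c p) (b p))"
  proof (cases G)
    case Euclidean
    define sb where "sb = sqrt (b p)"
    define sc where "sc = sqrt (c p)"
    have s: "sb > 0" "sc > 0" "b p = sb\<^sup>2" "c p = sc\<^sup>2" using gt Euclidean by (auto simp: sb_def sc_def)
    have db: "((\<lambda>p. sqrt (b p)) has_derivative (\<lambda>h. b' h / (2 * sb))) (at p)"
      using has_derivative_real_sqrt[OF _ d(2)] gt Euclidean by (simp add: sb_def field_simps)
    have dc: "((\<lambda>p. sqrt (c p)) has_derivative (\<lambda>h. c' h / (2 * sc))) (at p)"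
      using has_derivative_real_sqrt[OF _ d(3)] gt Euclidean by (simp add: sc_def field_simps)
    define N where "N = b p + c p - a p"
    have dz: "((\<lambda>p. (b p + c p - a p) / (2 * sqrt (b p) * sqrt (c p))) has_derivative
      (\<lambda>h. ((b' h + c' h - a' h) * (2 * sb * sc) - N * (2 * sb * (c' h / (2 * sc)) + 2 * (b' h / (2 * sb)) * sc))
         / ((2 * sb * sc) * (2 * sb * sc)))) (at p)"
      using has_derivative_divide'[OF has_derivative_diff[OF has_derivative_add[OF d(2) d(3)] d(1)]
          has_derivative_mult[OF has_derivative_mult_right[OF db, of 2] dc]] s(1,2)
      unfolding sb_def[symmetric] sc_def[symmetric] N_def[symmetric] by simp
    have sq: "sqrt (1 - (z p)\<^sup>2) = S / (2 * sb * sc)"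
      unfolding z_def one_minus_cos_arg_sq[OF gt(2,3)] S_def using Euclidean s
      by (simp add: real_sqrt_divide real_sqrt_mult)
    show ?thesis
    proof (intro exI conjI allI)
      show "(z has_derivative (\<lambda>h. ((b' h + c' h - a' h) * (2 * sb * sc) - N * (2 * sb * (c' h / (2 * sc)) + 2 * (b' h / (2 * sb)) * sc))
         / ((2 * sb * sc) * (2 * sb * sc)))) (at p)"
        using dz unfolding z_def Euclidean cos_arg.simps .
      show "2 * sb * sc > 0" using s by simp
      show "sqrt (1 - (z p)\<^sup>2) = S / (2 * sb * sc)" by (rule sq)
      fix h
      show "- (((b' h + c' h - a' h) * (2 * sb * sc) - N * (2 * sb * (c' h / (2 * sc)) + 2 * (b' h / (2 * sb)) * sc))
         / ((2 * sb * sc) * (2 * sb * sc))) * (2 * sb * sc) =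
         a' h - b' h * angle_coeff G (a p) (b p) (c p) - c' h * angle_coeff G (a p) (c p) (b p)"
        unfolding Euclidean angle_coeff.simps N_def s(3,4) using s(1,2)
        by (simp add: field_simps power2_eq_square)
    qed
  next
    case Hyperbolic
    define sb where "sb = sqrt ((b p)\<^sup>2 - 1)"
    define sc where "sc = sqrt ((c p)\<^sup>2 - 1)"
    have gt1: "(b p)\<^sup>2 - 1 > 0" "(c p)\<^sup>2 - 1 > 0" using gt Hyperbolic by (auto simp: one_less_power)
    then have s: "sb > 0" "sc > 0" "(b p)\<^sup>2 - 1 = sb\<^sup>2" "(c p)\<^sup>2 - 1 = sc\<^sup>2" by (auto simp: sb_def sc_def)
    have db: "((\<lambda>p. sqrt ((b p)\<^sup>2 - 1)) has_derivative (\<lambda>h. b p * b' h / sb)) (at p)"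
      unfolding sb_def using gt1 by (auto intro!: derivative_eq_intros d simp: field_simps)
    have dc: "((\<lambda>p. sqrt ((c p)\<^sup>2 - 1)) has_derivative (\<lambda>h. c p * c' h / sc)) (at p)"
      unfolding sc_def using gt1 by (auto intro!: derivative_eq_intros d simp: field_simps)
    define N where "N = b p * c p - a p"
    have dz: "((\<lambda>p. (b p * c p - a p) / (sqrt ((b p)\<^sup>2 - 1) * sqrt ((c p)\<^sup>2 - 1))) has_derivative
      (\<lambda>h. ((b p * c' h + b' h * c p - a' h) * (sb * sc) - N * (sb * (c p * c' h / sc) + (b p * b' h / sb) * sc))
         / ((sb * sc) * (sb * sc)))) (at p)"
      using has_derivative_divide'[OF has_derivative_diff[OF has_derivative_mult[OF d(2) d(3)] d(1)]
          has_derivative_mult[OF db dc]] s(1,2)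
      unfolding sb_def[symmetric] sc_def[symmetric] N_def[symmetric] by simp
    have sq: "sqrt (1 - (z p)\<^sup>2) = S / (sb * sc)"
      unfolding z_def one_minus_cos_arg_sq[OF gt(2,3)] S_def using Hyperbolic s
      by (simp add: real_sqrt_divide real_sqrt_mult)
    show ?thesis
    proof (intro exI conjI allI)
      show "(z has_derivative (\<lambda>h. ((b p * c' h + b' h * c p - a' h) * (sb * sc) - N * (sb * (c p * c' h / sc) + (b p * b' h / sb) * sc))
         / ((sb * sc) * (sb * sc)))) (at p)"
        using dz unfolding z_def Hyperbolic cos_arg.simps .
      show "sb * sc > 0" using s by simp
      show "sqrt (1 - (z p)\<^sup>2) = S / (sb * sc)" by (rule sq)
      fix h
      have "- (((b p * c' h + b' h * c p - a' h) * (sb * sc) - N * (sb * (c p * c' h / sc) + (b p * b' h / sb) * sc))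
         / ((sb * sc) * (sb * sc))) * (sb * sc) =
         a' h - b' h * (c p * sb\<^sup>2 - N * b p) / sb\<^sup>2 - c' h * (b p * sc\<^sup>2 - N * c p) / sc\<^sup>2"
        using s(1,2) by (simp add: field_simps power2_eq_square)
      also have "c p * sb\<^sup>2 - N * b p = b p * a p - c p"
        unfolding s(3)[symmetric] N_def by (simp add: algebra_simps power2_eq_square)
      also have "b p * sc\<^sup>2 - N * c p = c p * a p - b p"
        unfolding s(4)[symmetric] N_def by (simp add: algebra_simps power2_eq_square)
      finally show "- (((b p * c' h + b' h * c p - a' h) * (sb * sc) - N * (sb * (c p * c' h / sc) + (b p * b' h / sb) * sc))
         / ((sb * sc) * (sb * sc))) * (sb * sc) =
         a' h - b' h * angle_coeff G (a p) (b p) (c p) - c' h * angle_coeff G (a p) (c p) (b p)"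
        unfolding Hyperbolic angle_coeff.simps s(3,4) by simp
    qed
  qed
  then obtain z' k where z': "(z has_derivative z') (at p)" and k: "k > 0" "sqrt (1 - (z p)\<^sup>2) = S / k"
    and eq: "\<And>h. - z' h * k = a' h - b' h * angle_coeff G (a p) (b p) (c p) - c' h * angle_coeff G (a p) (c p) (b p)"
    by blast
  have "((\<lambda>p. arccos (z p)) has_derivative (\<lambda>h. z' h * inverse (- sqrt (1 - (z p)\<^sup>2)))) (at p)"
    by (rule has_derivative_arccos[OF z1 z'])
  moreover have "z' h * inverse (- sqrt (1 - (z p)\<^sup>2)) = (- z' h * k) / S" for h
    unfolding k(2) using k(1) S by (simp add: field_simps)
  ultimately show ?thesis unfolding eq S_def z_def by simp
qed

section \<open>The angles of a triangle in the coordinates u\<close>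

definition quantity :: "geometry \<Rightarrow> real \<Rightarrow> real \<Rightarrow> real \<Rightarrow> real \<Rightarrow> real \<Rightarrow> real" where
  "quantity G e e' n x y = edge_quantity G e e' n (radius G e x) (radius G e' y)"

lemma quantity_commute: "quantity G e e' n x y = quantity G e' e n y x"
  unfolding quantity_def by (rule edge_quantity_commute)

text \<open>The partial derivative of the edge quantity in the coordinate u of its first vertex,
  expressed through the radii.\<close>

fun quantity_deriv :: "geometry \<Rightarrow> real \<Rightarrow> real \<Rightarrow> real \<Rightarrow> real \<Rightarrow> real \<Rightarrow> real" where
  "quantity_deriv Euclidean e e' n x y = 2 * x * (e * x + n * y)"
| "quantity_deriv Hyperbolic e e' n x y = hyp_C e x * hyp_c e e' n x y - hyp_C e' y"

text \<open>Since \<open>hyp_C\<close> is 1 for weight 0, the hyperbolic formula covers both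
  weights. The factor \<open>hyp_C\<close> for weight 1 is the effect of passing from f to u, and it
  is what makes the hyperbolic Jacobian symmetric.\<close>

lemma has_derivative_radius:
  assumes d: "(x has_derivative x') (at p)" and dom: "x p \<in> u_domain G e" and e: "e \<in> {0, 1}"
  shows "((\<lambda>p. radius G e (x p)) has_derivative
     (\<lambda>h. radius G e (x p) * (if G = Hyperbolic then hyp_C e (radius G e (x p)) else 1) * x' h)) (at p)"
proof (cases "G = Hyperbolic \<and> e = 1")
  case True
  define u where "u = x p"
  have u: "u < 0" using dom True by (simp add: u_domain_def u_def)
  then have s: "sinh u < 0" by simp
  have "hyp_C e (radius G e u) = sqrt (1 + 1 / (sinh u)\<^sup>2)"
    using True by (simp add: hyp_C_def radius_def power_divide)
  also have "1 + 1 / (sinh u)\<^sup>2 = (cosh u / sinh u)\<^sup>2"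
    using s unfolding power_divide cosh_square_eq by (simp add: add_divide_distrib)
  also have "sqrt \<dots> = - cosh u / sinh u"
    using s cosh_real_pos[of u] by (simp add: abs_divide)
  finally have C: "hyp_C e (radius G e u) = - cosh u / sinh u" .
  have "((\<lambda>p. - 1 / sinh (x p)) has_derivative (\<lambda>h. cosh u / (sinh u * sinh u) * x' h)) (at p)"
  proof -
    have "((\<lambda>u. - 1 / sinh u) has_real_derivative cosh u / (sinh u * sinh u)) (at (x p))"
      using s unfolding u_def by (auto intro!: derivative_eq_intros)
    from DERIV_compose_FDERIV[OF this d] show ?thesis by (simp add: mult.commute)
  qed
  moreover have "radius G e u * hyp_C e (radius G e u) * x' h = cosh u / (sinh u * sinh u) * x' h" for h
    unfolding C using True by (simp add: radius_def)
  ultimately show ?thesis using True by (simp add: radius_def u_def)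
next
  case False
  then have "(if G = Hyperbolic then hyp_C e (radius G e (x p)) else 1) = 1"
    using e by (auto simp: hyp_C_def)
  moreover have "((\<lambda>p. exp (x p)) has_derivative (\<lambda>h. exp (x p) * x' h)) (at p)"
    using d by (auto intro!: derivative_eq_intros)
  ultimately show ?thesis using False by (auto simp: radius_def)
qed

lemma has_derivative_quantity:
  assumes d: "(x has_derivative x') (at p)" "(y has_derivative y') (at p)"
    and dom: "x p \<in> u_domain G e" "y p \<in> u_domain G e'" and e: "e \<in> {0, 1}" "e' \<in> {0, 1}"
  shows "((\<lambda>p. quantity G e e' n (x p) (y p)) has_derivative
     (\<lambda>h. quantity_deriv G e e' n (radius G e (x p)) (radius G e' (y p)) * x' h
        + quantity_deriv G e' e n (radius G e' (y p)) (radius G e (x p)) * y' h)) (at p)"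
proof (cases G)
  case Euclidean
  note dr = has_derivative_radius[OF d(1) dom(1) e(1), unfolded Euclidean]
    has_derivative_radius[OF d(2) dom(2) e(2), unfolded Euclidean]
  show ?thesis unfolding quantity_def Euclidean edge_quantity.simps
    by (rule derivative_eq_intros dr refl)+ (simp add: fun_eq_iff algebra_simps power2_eq_square)
next
  case Hyperbolic
  define X where "X p = radius G e (x p)" for p
  define Y where "Y p = radius G e' (y p)" for p
  have dX: "(X has_derivative (\<lambda>h. X p * hyp_C e (X p) * x' h)) (at p)"
    using has_derivative_radius[OF d(1) dom(1) e(1)] Hyperbolic by (simp add: X_def[abs_def])
  have dY: "(Y has_derivative (\<lambda>h. Y p * hyp_C e' (Y p) * y' h)) (at p)"
    using has_derivative_radius[OF d(2) dom(2) e(2)] Hyperbolic by (simp add: Y_def[abs_def])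
  have dC: "((\<lambda>p. hyp_C k (Z p)) has_derivative (\<lambda>h. k * (Z p)\<^sup>2 * z' h)) (at p)"
    if "(Z has_derivative (\<lambda>h. Z p * hyp_C k (Z p) * z' h)) (at p)" "k \<in> {0, 1}" for Z z' k
  proof -
    have pos: "1 + k * (Z p)\<^sup>2 > 0" using that(2) by (auto intro: add_pos_nonneg)
    have C: "hyp_C k (Z p) > 0" using hyp_C_facts(3)[OF that(2)] .
    show ?thesis
      unfolding hyp_C_def using pos that(1)[unfolded hyp_C_def]
      by (auto intro!: derivative_eq_intros simp: fun_eq_iff power2_eq_square field_simps)
  qed
  have "((\<lambda>p. hyp_C e (X p) * hyp_C e' (Y p) + n * X p * Y p) has_derivative
     (\<lambda>h. hyp_C e (X p) * (e' * (Y p)\<^sup>2 * y' h) + e * (X p)\<^sup>2 * x' h * hyp_C e' (Y p) +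
        (n * X p * (Y p * hyp_C e' (Y p) * y' h) + n * (X p * hyp_C e (X p) * x' h) * Y p))) (at p)"
    by (intro derivative_intros dX dY dC e)
  then show ?thesis
    unfolding quantity_def Hyperbolic edge_quantity.simps quantity_deriv.simps hyp_D_eq[OF e(1)] hyp_D_eq[OF e(2)]
    unfolding hyp_c_def X_def Y_def
    by (simp add: Hyperbolic algebra_simps power2_eq_square)
qed

text \<open>Euclidean angles do not change when all coordinates of a triangle move by the same
  amount, so only differences can be controlled there; hyperbolic geometry has no such
  invariance.\<close>

fun dir_norm :: "geometry \<Rightarrow> real \<Rightarrow> real \<Rightarrow> real \<Rightarrow> real" where
  "dir_norm Euclidean x y z = (x - y)\<^sup>2 + (x - z)\<^sup>2 + (y - z)\<^sup>2"
| "dir_norm Hyperbolic x y z = x\<^sup>2 + y\<^sup>2 + z\<^sup>2"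

lemma dir_norm_nonneg: "dir_norm G x y z \<ge> 0"
  by (cases G) auto

lemma triangle_form_neg:
  fixes G :: geometry
  assumes st: "structure_triple e1 e2 e3 n12 n13 n23" and r: "r1 > 0" "r2 > 0" "r3 > 0"
  defines "q12 \<equiv> edge_quantity G e1 e2 n12 r1 r2" and "q13 \<equiv> edge_quantity G e1 e3 n13 r1 r3"
    and "q23 \<equiv> edge_quantity G e2 e3 n23 r2 r3"
  assumes det: "quantity_det G q23 q12 q13 > 0"
  shows "\<exists>d>0. \<forall>h1 h2 h3 y12 y13 y23.
    y12 = quantity_deriv G e1 e2 n12 r1 r2 * h1 + quantity_deriv G e2 e1 n12 r2 r1 * h2 \<longrightarrow>
    y13 = quantity_deriv G e1 e3 n13 r1 r3 * h1 + quantity_deriv G e3 e1 n13 r3 r1 * h3 \<longrightarrow>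
    y23 = quantity_deriv G e2 e3 n23 r2 r3 * h2 + quantity_deriv G e3 e2 n23 r3 r2 * h3 \<longrightarrow>
      h1 * (y23 - y12 * angle_coeff G q23 q12 q13 - y13 * angle_coeff G q23 q13 q12)
    + h2 * (y13 - y23 * angle_coeff G q13 q23 q12 - y12 * angle_coeff G q13 q12 q23)
    + h3 * (y12 - y13 * angle_coeff G q12 q13 q23 - y23 * angle_coeff G q12 q23 q13)
    \<le> - d * dir_norm G h1 h2 h3"
proof -
  have e: "e1 \<in> {0, 1}" "e2 \<in> {0, 1}" "e3 \<in> {0, 1}"
    and n: "e1 * e2 + n12 > 0" "e1 * e3 + n13 > 0" "e2 * e3 + n23 > 0"
    using st by (auto simp: structure_triple_def)
  have gt: "q12 > quantity_bound G" "q13 > quantity_bound G" "q23 > quantity_bound G"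
    unfolding q12_def q13_def q23_def using edge_quantity_gt e n r by auto
  show ?thesis
  proof (cases G)
    case Euclidean
    define a1 where "a1 = e1 * r1\<^sup>2"
    define a2 where "a2 = e2 * r2\<^sup>2"
    define a3 where "a3 = e3 * r3\<^sup>2"
    define m12 where "m12 = n12 * r1 * r2"
    define m13 where "m13 = n13 * r1 * r3"
    define m23 where "m23 = n23 * r2 * r3"
    note am = a1_def a2_def a3_def m12_def m13_def m23_def
    have q: "a1 + a2 + 2 * m12 = q12" "a1 + a3 + 2 * m13 = q13" "a2 + a3 + 2 * m23 = q23"
      unfolding q12_def q13_def q23_def am Euclidean by simp_all
    have D: "quantity_deriv G e1 e2 n12 r1 r2 = 2 * (a1 + m12)" "quantity_deriv G e2 e1 n12 r2 r1 = 2 * (a2 + m12)"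
      "quantity_deriv G e1 e3 n13 r1 r3 = 2 * (a1 + m13)" "quantity_deriv G e3 e1 n13 r3 r1 = 2 * (a3 + m13)"
      "quantity_deriv G e2 e3 n23 r2 r3 = 2 * (a2 + m23)" "quantity_deriv G e3 e2 n23 r3 r2 = 2 * (a3 + m23)"
      unfolding Euclidean am by (simp_all add: algebra_simps power2_eq_square)
    have "(a1 + m12) * (a2 + m23) * (a3 + m13) + (a2 + m12) * (a3 + m23) * (a1 + m13)
      = (r1 * r2 * r3) * ((e1 * r1 + n12 * r2) * (e2 * r2 + n23 * r3) * (e3 * r3 + n13 * r1)
       + (e2 * r2 + n12 * r1) * (e3 * r3 + n23 * r2) * (e1 * r1 + n13 * r3))"
      unfolding am by (simp add: algebra_simps power2_eq_square)
    then have X: "(a1 + m12) * (a2 + m23) * (a3 + m13) + (a2 + m12) * (a3 + m23) * (a1 + m13) > 0"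
      using structure_cubic_pos[OF st r] r by simp
    have A: "2 * q12 * q13 + 2 * q12 * q23 + 2 * q13 * q23 - q12\<^sup>2 - q13\<^sup>2 - q23\<^sup>2 > 0"
      using det unfolding Euclidean by (simp add: algebra_simps)
    have gt0: "q12 > 0" "q13 > 0" "q23 > 0" using gt Euclidean by auto
    note F = euclidean_form_neg[of a1 a2 m12 a3 m13 m23, unfolded q, OF gt0 A X]
    from F obtain d where "d > 0" and d: "\<And>h1 h2 h3 y12 y13 y23.
       y12 = 2 * ((a1 + m12) * h1 + (a2 + m12) * h2) \<Longrightarrow>
       y13 = 2 * ((a1 + m13) * h1 + (a3 + m13) * h3) \<Longrightarrow>
       y23 = 2 * ((a2 + m23) * h2 + (a3 + m23) * h3) \<Longrightarrow>
          h1 * (y23 - y12 * (q12 - q13 + q23) / (2 * q12) - y13 * (q13 - q12 + q23) / (2 * q13))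
        + h2 * (y13 - y23 * (q23 - q12 + q13) / (2 * q23) - y12 * (q12 - q23 + q13) / (2 * q12))
        + h3 * (y12 - y13 * (q13 - q23 + q12) / (2 * q13) - y23 * (q23 - q13 + q12) / (2 * q23))
        \<le> - d * ((h1 - h2)\<^sup>2 + (h1 - h3)\<^sup>2 + (h2 - h3)\<^sup>2)" by blast
    show ?thesis unfolding D unfolding Euclidean angle_coeff.simps dir_norm.simps times_divide_eq_right
      by (intro exI[of _ d] conjI allI impI \<open>d > 0\<close> d) (simp_all add: algebra_simps)
  next
    case Hyperbolic
    have h: "hyp_det (hyp_c e1 e2 n12 r1 r2) (hyp_c e1 e3 n13 r1 r3) (hyp_c e2 e3 n23 r2 r3) > 0"
      using det unfolding q12_def q13_def q23_def Hyperbolic by (simp add: hyp_det_def algebra_simps)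
    show ?thesis
      using hyperbolic_form_neg[OF st r h]
      unfolding q12_def q13_def q23_def Hyperbolic edge_quantity.simps quantity_deriv.simps angle_coeff.simps
        dir_norm.simps times_divide_eq_right hyp_c_commute[of e2 e1] hyp_c_commute[of e3 e1] hyp_c_commute[of e3 e2] .
  qed
qed

definition tri_angle ::
  "geometry \<Rightarrow> real \<Rightarrow> real \<Rightarrow> real \<Rightarrow> real \<Rightarrow> real \<Rightarrow> real \<Rightarrow> real \<Rightarrow> real \<Rightarrow> real \<Rightarrow> real" where
  "tri_angle G e1 e2 e3 n12 n13 n23 x1 x2 x3 = ext_angle G
     (edge_length G e2 e3 n23 (inv (u_coord G e2) x2) (inv (u_coord G e3) x3))
     (edge_length G e1 e2 n12 (inv (u_coord G e1) x1) (inv (u_coord G e2) x2))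
     (edge_length G e1 e3 n13 (inv (u_coord G e1) x1) (inv (u_coord G e3) x3))"

lemma edge_length_quantity:
  assumes "x \<in> u_domain G e" "y \<in> u_domain G e'"
  shows "edge_length G e e' n (inv (u_coord G e) x) (inv (u_coord G e') y) = quantity_length G (quantity G e e' n x y)"
  unfolding edge_length_eq quantity_def exp_inv_u_coord[OF assms(1)] exp_inv_u_coord[OF assms(2)] ..

lemma quantity_gt:
  assumes "e \<in> {0, 1}" "e' \<in> {0, 1}" "e * e' + n > 0" "x \<in> u_domain G e" "y \<in> u_domain G e'"
  shows "quantity G e e' n x y > quantity_bound G"
  unfolding quantity_def using assms by (intro edge_quantity_gt radius_pos)

lemma tri_angle_eq:
  assumes st: "structure_triple e1 e2 e3 n12 n13 n23"
    and dom: "x1 \<in> u_domain G e1" "x2 \<in> u_domain G e2" "x3 \<in> u_domain G e3"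
  shows "tri_angle G e1 e2 e3 n12 n13 n23 x1 x2 x3 = arccos (max (- 1) (min 1
     (cos_arg G (quantity G e2 e3 n23 x2 x3) (quantity G e1 e2 n12 x1 x2) (quantity G e1 e3 n13 x1 x3))))"
  unfolding tri_angle_def edge_length_quantity[OF dom(2,3)] edge_length_quantity[OF dom(1,2)]
    edge_length_quantity[OF dom(1,3)]
  using st dom unfolding structure_triple_def by (intro ext_angle_eq quantity_gt) auto

lemma tri_angle_bounds: "0 \<le> tri_angle G e1 e2 e3 n12 n13 n23 x1 x2 x3 \<and> tri_angle G e1 e2 e3 n12 n13 n23 x1 x2 x3 \<le> pi"
  if "structure_triple e1 e2 e3 n12 n13 n23" "x1 \<in> u_domain G e1" "x2 \<in> u_domain G e2" "x3 \<in> u_domain G e3"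
  unfolding tri_angle_eq[OF that] by (intro conjI arccos_lbound arccos_ubound) auto

definition tri_det ::
  "geometry \<Rightarrow> real \<Rightarrow> real \<Rightarrow> real \<Rightarrow> real \<Rightarrow> real \<Rightarrow> real \<Rightarrow> real \<Rightarrow> real \<Rightarrow> real \<Rightarrow> real" where
  "tri_det G e1 e2 e3 n12 n13 n23 x1 x2 x3 =
     quantity_det G (quantity G e2 e3 n23 x2 x3) (quantity G e1 e2 n12 x1 x2) (quantity G e1 e3 n13 x1 x3)"

lemma tri_det_rotate: "tri_det G e2 e3 e1 n23 n12 n13 x2 x3 x1 = tri_det G e1 e2 e3 n12 n13 n23 x1 x2 x3"
  unfolding tri_det_def quantity_commute[of G e3 e1] quantity_commute[of G e2 e1]
  by (metis quantity_det_rotate quantity_det_swap)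

lemma tri_angle_degenerate:
  assumes st: "structure_triple e1 e2 e3 n12 n13 n23"
    and dom: "x1 \<in> u_domain G e1" "x2 \<in> u_domain G e2" "x3 \<in> u_domain G e3"
    and det: "\<not> tri_det G e1 e2 e3 n12 n13 n23 x1 x2 x3 > 0"
  shows "tri_angle G e1 e2 e3 n12 n13 n23 x1 x2 x3 \<in> {0, pi}"
proof -
  have "quantity G e1 e2 n12 x1 x2 > quantity_bound G" "quantity G e1 e3 n13 x1 x3 > quantity_bound G"
    using st dom unfolding structure_triple_def by (auto intro!: quantity_gt)
  from cos_arg_less_iff[OF this] have "\<not> \<bar>cos_arg G (quantity G e2 e3 n23 x2 x3) (quantity G e1 e2 n12 x1 x2) (quantity G e1 e3 n13 x1 x3)\<bar> < 1"
    using det unfolding tri_det_def by blast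
  then have "max (- 1) (min 1 (cos_arg G (quantity G e2 e3 n23 x2 x3) (quantity G e1 e2 n12 x1 x2) (quantity G e1 e3 n13 x1 x3))) \<in> {- 1, 1}"
    by (auto simp: max_def min_def)
  then show ?thesis unfolding tri_angle_eq[OF st dom] by auto
qed

lemma eventually_u_domain:
  assumes "isCont x p" "x p \<in> u_domain G e"
  shows "\<forall>\<^sub>F s in nhds p. x s \<in> u_domain G e"
proof -
  have "open (u_domain G e)" by (auto simp: u_domain_def)
  then have "\<forall>\<^sub>F s in at p. x s \<in> u_domain G e"
    using assms topological_tendstoD unfolding isCont_def by blast
  then show ?thesis using assms(2) by (auto simp: eventually_at_filter elim: eventually_mono)
qed

text \<open>Here and in the following lemmas the coordinates are functions on any normed space, so
  that one statement serves both segments and neighbourhoods in three-space.\<close>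

lemma tri_angle_isCont:
  fixes x1 x2 x3 :: "'b :: real_normed_vector \<Rightarrow> real"
  assumes st: "structure_triple e1 e2 e3 n12 n13 n23"
    and d: "(x1 has_derivative x1') (at p)" "(x2 has_derivative x2') (at p)" "(x3 has_derivative x3') (at p)"
    and dom: "x1 p \<in> u_domain G e1" "x2 p \<in> u_domain G e2" "x3 p \<in> u_domain G e3"
  shows "isCont (\<lambda>p. tri_angle G e1 e2 e3 n12 n13 n23 (x1 p) (x2 p) (x3 p)) p"
proof -
  have e: "e1 \<in> {0, 1}" "e2 \<in> {0, 1}" "e3 \<in> {0, 1}"
    and n: "e1 * e2 + n12 > 0" "e1 * e3 + n13 > 0" "e2 * e3 + n23 > 0"
    using st by (auto simp: structure_triple_def)
  define a where "a p = quantity G e2 e3 n23 (x2 p) (x3 p)" for p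
  define b where "b p = quantity G e1 e2 n12 (x1 p) (x2 p)" for p
  define c where "c p = quantity G e1 e3 n13 (x1 p) (x3 p)" for p
  have cont: "isCont a p" "isCont b p" "isCont c p"
    unfolding a_def b_def c_def
    using has_derivative_continuous[OF has_derivative_quantity[OF d(2,3) dom(2,3) e(2,3)]]
      has_derivative_continuous[OF has_derivative_quantity[OF d(1,2) dom(1,2) e(1,2)]]
      has_derivative_continuous[OF has_derivative_quantity[OF d(1,3) dom(1,3) e(1,3)]]
    by auto
  have gt: "b p > quantity_bound G" "c p > quantity_bound G"
    unfolding b_def c_def using e n dom by (auto intro!: quantity_gt)
  have z: "isCont (\<lambda>p. cos_arg G (a p) (b p) (c p)) p"
  proof (cases G)
    case Euclidean
    then show ?thesis using gt unfolding Euclidean cos_arg.simps by (intro continuous_intros cont) auto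
  next
    case Hyperbolic
    then have "(b p)\<^sup>2 > 1" "(c p)\<^sup>2 > 1" using gt by (auto simp: one_less_power)
    then show ?thesis unfolding Hyperbolic cos_arg.simps by (intro continuous_intros cont) auto
  qed
  have "isCont (\<lambda>z. arccos (max (- 1) (min 1 z))) z" for z :: real
  proof -
    have "continuous_on UNIV (\<lambda>z. arccos (max (- 1) (min 1 z :: real)))"
      by (intro continuous_on_arccos continuous_intros) auto
    then show ?thesis by (simp add: continuous_on_eq_continuous_at)
  qed
  from isCont_o2[OF z this]
  have c1: "isCont (\<lambda>p. arccos (max (- 1) (min 1 (cos_arg G (a p) (b p) (c p))))) p" .
  have "\<forall>\<^sub>F s in nhds p. x1 s \<in> u_domain G e1 \<and> x2 s \<in> u_domain G e2 \<and> x3 s \<in> u_domain G e3"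
    using d has_derivative_continuous dom by (intro eventually_conj eventually_u_domain) auto
  then have "\<forall>\<^sub>F s in nhds p. tri_angle G e1 e2 e3 n12 n13 n23 (x1 s) (x2 s) (x3 s) =
      arccos (max (- 1) (min 1 (cos_arg G (a s) (b s) (c s))))"
    by (rule eventually_mono) (simp add: tri_angle_eq[OF st] a_def b_def c_def)
  from isCont_cong[OF this] c1 show ?thesis by simp
qed

lemma tri_angle_has_derivative:
  fixes x1 x2 x3 :: "'b :: real_normed_vector \<Rightarrow> real"
  assumes st: "structure_triple e1 e2 e3 n12 n13 n23"
    and d: "(x1 has_derivative x1') (at p)" "(x2 has_derivative x2') (at p)" "(x3 has_derivative x3') (at p)"
    and dom: "x1 p \<in> u_domain G e1" "x2 p \<in> u_domain G e2" "x3 p \<in> u_domain G e3"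
    and det: "tri_det G e1 e2 e3 n12 n13 n23 (x1 p) (x2 p) (x3 p) > 0"
  defines "q12 \<equiv> quantity G e1 e2 n12 (x1 p) (x2 p)" and "q13 \<equiv> quantity G e1 e3 n13 (x1 p) (x3 p)"
    and "q23 \<equiv> quantity G e2 e3 n23 (x2 p) (x3 p)"
    and "D \<equiv> \<lambda>e e' n x y. quantity_deriv G e e' n (radius G e x) (radius G e' y)"
  shows "((\<lambda>p. tri_angle G e1 e2 e3 n12 n13 n23 (x1 p) (x2 p) (x3 p)) has_derivative
    (\<lambda>h. ((D e2 e3 n23 (x2 p) (x3 p) * x2' h + D e3 e2 n23 (x3 p) (x2 p) * x3' h)
       - (D e1 e2 n12 (x1 p) (x2 p) * x1' h + D e2 e1 n12 (x2 p) (x1 p) * x2' h) * angle_coeff G q23 q12 q13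
       - (D e1 e3 n13 (x1 p) (x3 p) * x1' h + D e3 e1 n13 (x3 p) (x1 p) * x3' h) * angle_coeff G q23 q13 q12)
      / sqrt (tri_det G e1 e2 e3 n12 n13 n23 (x1 p) (x2 p) (x3 p)))) (at p)"
proof -
  have e: "e1 \<in> {0, 1}" "e2 \<in> {0, 1}" "e3 \<in> {0, 1}"
    and n: "e1 * e2 + n12 > 0" "e1 * e3 + n13 > 0" "e2 * e3 + n23 > 0"
    using st by (auto simp: structure_triple_def)
  note da = has_derivative_quantity[OF d(2,3) dom(2,3) e(2,3), of n23]
  note db = has_derivative_quantity[OF d(1,2) dom(1,2) e(1,2), of n12]
  note dc = has_derivative_quantity[OF d(1,3) dom(1,3) e(1,3), of n13]
  have gt: "q23 > quantity_bound G" "q12 > quantity_bound G" "q13 > quantity_bound G"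
    unfolding q12_def q13_def q23_def using e n dom by (auto intro!: quantity_gt)
  note deriv = has_derivative_angle[OF da db dc gt[unfolded q12_def q13_def q23_def] det[unfolded tri_det_def]]
  \<comment> \<open>A positive determinant makes the clamping of the cosine inactive, at the point
    and nearby.\<close>
  have key: "arccos (cos_arg G (quantity G e2 e3 n23 y2 y3) (quantity G e1 e2 n12 y1 y2) (quantity G e1 e3 n13 y1 y3))
      = tri_angle G e1 e2 e3 n12 n13 n23 y1 y2 y3"
    if "tri_det G e1 e2 e3 n12 n13 n23 y1 y2 y3 > 0"
      and dm: "y1 \<in> u_domain G e1" "y2 \<in> u_domain G e2" "y3 \<in> u_domain G e3" for y1 y2 y3
  proof -
    have "quantity G e1 e2 n12 y1 y2 > quantity_bound G" "quantity G e1 e3 n13 y1 y3 > quantity_bound G"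
      using e n dm by (auto intro!: quantity_gt)
    from cos_arg_less_iff[OF this] that(1)
    have "\<bar>cos_arg G (quantity G e2 e3 n23 y2 y3) (quantity G e1 e2 n12 y1 y2) (quantity G e1 e3 n13 y1 y3)\<bar> < 1"
      unfolding tri_det_def by blast
    then show ?thesis unfolding tri_angle_eq[OF st dm] by (simp add: max_def min_def abs_less_iff)
  qed
  have "isCont (\<lambda>p. tri_det G e1 e2 e3 n12 n13 n23 (x1 p) (x2 p) (x3 p)) p"
    using has_derivative_continuous[OF da] has_derivative_continuous[OF db] has_derivative_continuous[OF dc]
    unfolding tri_det_def
    by (cases G) (auto simp: hyp_det_def intro!: continuous_intros)
  then have "\<forall>\<^sub>F s in at p. tri_det G e1 e2 e3 n12 n13 n23 (x1 s) (x2 s) (x3 s) > 0"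
    unfolding isCont_def using det by (rule order_tendstoD(1))
  moreover have "\<forall>\<^sub>F s in nhds p. x1 s \<in> u_domain G e1 \<and> x2 s \<in> u_domain G e2 \<and> x3 s \<in> u_domain G e3"
    using d has_derivative_continuous dom by (intro eventually_conj eventually_u_domain) auto
  then have "\<forall>\<^sub>F s in at p. x1 s \<in> u_domain G e1 \<and> x2 s \<in> u_domain G e2 \<and> x3 s \<in> u_domain G e3"
    by (simp add: eventually_nhds_conv_at)
  ultimately have "\<forall>\<^sub>F s in at p. arccos (cos_arg G (quantity G e2 e3 n23 (x2 s) (x3 s)) (quantity G e1 e2 n12 (x1 s) (x2 s))
      (quantity G e1 e3 n13 (x1 s) (x3 s))) = tri_angle G e1 e2 e3 n12 n13 n23 (x1 s) (x2 s) (x3 s)"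
    by eventually_elim (auto intro: key)
  from has_derivative_transform_eventually[OF deriv this key[OF det dom] UNIV_I]
  show ?thesis unfolding D_def q12_def q13_def q23_def tri_det_def .
qed

text \<open>Rotating the corners gives the other two angles with the same determinant
  \<open>B\<close>, so the pairing is the form of \<open>triangle_form_neg\<close> divided by
  \<open>sqrt B\<close>.\<close>

lemma tri_angles_form_neg:
  fixes x1 x2 x3 :: "'b :: real_normed_vector \<Rightarrow> real"
  assumes st: "structure_triple e1 e2 e3 n12 n13 n23"
    and d: "(x1 has_derivative x1') (at p)" "(x2 has_derivative x2') (at p)" "(x3 has_derivative x3') (at p)"
    and dom: "x1 p \<in> u_domain G e1" "x2 p \<in> u_domain G e2" "x3 p \<in> u_domain G e3"
    and det: "tri_det G e1 e2 e3 n12 n13 n23 (x1 p) (x2 p) (x3 p) > 0"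
  shows "\<exists>T1 T2 T3 c.
     ((\<lambda>p. tri_angle G e1 e2 e3 n12 n13 n23 (x1 p) (x2 p) (x3 p)) has_derivative T1) (at p) \<and>
     ((\<lambda>p. tri_angle G e2 e3 e1 n23 n12 n13 (x2 p) (x3 p) (x1 p)) has_derivative T2) (at p) \<and>
     ((\<lambda>p. tri_angle G e3 e1 e2 n13 n23 n12 (x3 p) (x1 p) (x2 p)) has_derivative T3) (at p) \<and>
     c > 0 \<and> (\<forall>h. x1' h * T1 h + x2' h * T2 h + x3' h * T3 h \<le> - c * dir_norm G (x1' h) (x2' h) (x3' h))"
proof -
  define r1 where "r1 = radius G e1 (x1 p)"
  define r2 where "r2 = radius G e2 (x2 p)"
  define r3 where "r3 = radius G e3 (x3 p)"
  have r: "r1 > 0" "r2 > 0" "r3 > 0" unfolding r1_def r2_def r3_def using dom radius_pos by auto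
  note st2 = structure_triple_rotate[OF st] and st3 = structure_triple_rotate[OF structure_triple_rotate[OF st]]
  define B where "B = tri_det G e1 e2 e3 n12 n13 n23 (x1 p) (x2 p) (x3 p)"
  have det2: "tri_det G e2 e3 e1 n23 n12 n13 (x2 p) (x3 p) (x1 p) = B"
    unfolding B_def by (rule tri_det_rotate)
  have det3: "tri_det G e3 e1 e2 n13 n23 n12 (x3 p) (x1 p) (x2 p) = B"
    unfolding B_def by (metis tri_det_rotate)
  have B: "B > 0" using det B_def by simp
  obtain c where c: "c > 0" and le: "\<And>h1 h2 h3 y12 y13 y23.
    y12 = quantity_deriv G e1 e2 n12 r1 r2 * h1 + quantity_deriv G e2 e1 n12 r2 r1 * h2 \<Longrightarrow>
    y13 = quantity_deriv G e1 e3 n13 r1 r3 * h1 + quantity_deriv G e3 e1 n13 r3 r1 * h3 \<Longrightarrow>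
    y23 = quantity_deriv G e2 e3 n23 r2 r3 * h2 + quantity_deriv G e3 e2 n23 r3 r2 * h3 \<Longrightarrow>
      h1 * (y23 - y12 * angle_coeff G (edge_quantity G e2 e3 n23 r2 r3) (edge_quantity G e1 e2 n12 r1 r2) (edge_quantity G e1 e3 n13 r1 r3)
          - y13 * angle_coeff G (edge_quantity G e2 e3 n23 r2 r3) (edge_quantity G e1 e3 n13 r1 r3) (edge_quantity G e1 e2 n12 r1 r2))
    + h2 * (y13 - y23 * angle_coeff G (edge_quantity G e1 e3 n13 r1 r3) (edge_quantity G e2 e3 n23 r2 r3) (edge_quantity G e1 e2 n12 r1 r2)
          - y12 * angle_coeff G (edge_quantity G e1 e3 n13 r1 r3) (edge_quantity G e1 e2 n12 r1 r2) (edge_quantity G e2 e3 n23 r2 r3))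
    + h3 * (y12 - y13 * angle_coeff G (edge_quantity G e1 e2 n12 r1 r2) (edge_quantity G e1 e3 n13 r1 r3) (edge_quantity G e2 e3 n23 r2 r3)
          - y23 * angle_coeff G (edge_quantity G e1 e2 n12 r1 r2) (edge_quantity G e2 e3 n23 r2 r3) (edge_quantity G e1 e3 n13 r1 r3))
    \<le> - c * dir_norm G h1 h2 h3"
    using triangle_form_neg[OF st r, of G] det
    unfolding tri_det_def quantity_def r1_def[symmetric] r2_def[symmetric] r3_def[symmetric] by blast
  note D1 = tri_angle_has_derivative[OF st d dom det, folded B_def]
  note D2 = tri_angle_has_derivative[OF st2 d(2,3,1) dom(2,3,1), unfolded det2, OF B]
  note D3 = tri_angle_has_derivative[OF st3 d(3,1,2) dom(3,1,2), unfolded det3, OF B]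
  show ?thesis
  proof (intro exI conjI allI)
    show "c / sqrt B > 0" using c B by simp
    fix h
    define y12 where "y12 = quantity_deriv G e1 e2 n12 r1 r2 * x1' h + quantity_deriv G e2 e1 n12 r2 r1 * x2' h"
    define y13 where "y13 = quantity_deriv G e1 e3 n13 r1 r3 * x1' h + quantity_deriv G e3 e1 n13 r3 r1 * x3' h"
    define y23 where "y23 = quantity_deriv G e2 e3 n23 r2 r3 * x2' h + quantity_deriv G e3 e2 n23 r3 r2 * x3' h"
    have y': "quantity_deriv G e2 e1 n12 r2 r1 * x2' h + quantity_deriv G e1 e2 n12 r1 r2 * x1' h = y12"
      "quantity_deriv G e3 e1 n13 r3 r1 * x3' h + quantity_deriv G e1 e3 n13 r1 r3 * x1' h = y13"
      "quantity_deriv G e3 e2 n23 r3 r2 * x3' h + quantity_deriv G e2 e3 n23 r2 r3 * x2' h = y23"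
      by (simp_all add: y12_def y13_def y23_def)
    note L = divide_right_mono[OF le[OF y12_def y13_def y23_def], of "sqrt B"]
    have sb: "sqrt B \<ge> 0" using B by simp
    have sum: "a * (u / s) + b * (v / s) + k * (w / s) = (a * u + b * v + k * w) / s" for a b k u v w s :: real
      by (simp add: add_divide_distrib)
    have rhs: "- (c / s) * n = (- c * n) / s" for s n :: real by simp
    show "x1' h * (((quantity_deriv G e2 e3 n23 (radius G e2 (x2 p)) (radius G e3 (x3 p)) * x2' h + quantity_deriv G e3 e2 n23 (radius G e3 (x3 p)) (radius G e2 (x2 p)) * x3' h)
       - (quantity_deriv G e1 e2 n12 (radius G e1 (x1 p)) (radius G e2 (x2 p)) * x1' h + quantity_deriv G e2 e1 n12 (radius G e2 (x2 p)) (radius G e1 (x1 p)) * x2' h) * angle_coeff G (quantity G e2 e3 n23 (x2 p) (x3 p)) (quantity G e1 e2 n12 (x1 p) (x2 p)) (quantity G e1 e3 n13 (x1 p) (x3 p))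
       - (quantity_deriv G e1 e3 n13 (radius G e1 (x1 p)) (radius G e3 (x3 p)) * x1' h + quantity_deriv G e3 e1 n13 (radius G e3 (x3 p)) (radius G e1 (x1 p)) * x3' h) * angle_coeff G (quantity G e2 e3 n23 (x2 p) (x3 p)) (quantity G e1 e3 n13 (x1 p) (x3 p)) (quantity G e1 e2 n12 (x1 p) (x2 p)))
      / sqrt B)
     + x2' h * (((quantity_deriv G e3 e1 n13 (radius G e3 (x3 p)) (radius G e1 (x1 p)) * x3' h + quantity_deriv G e1 e3 n13 (radius G e1 (x1 p)) (radius G e3 (x3 p)) * x1' h)
       - (quantity_deriv G e2 e3 n23 (radius G e2 (x2 p)) (radius G e3 (x3 p)) * x2' h + quantity_deriv G e3 e2 n23 (radius G e3 (x3 p)) (radius G e2 (x2 p)) * x3' h) * angle_coeff G (quantity G e3 e1 n13 (x3 p) (x1 p)) (quantity G e2 e3 n23 (x2 p) (x3 p)) (quantity G e2 e1 n12 (x2 p) (x1 p))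
       - (quantity_deriv G e2 e1 n12 (radius G e2 (x2 p)) (radius G e1 (x1 p)) * x2' h + quantity_deriv G e1 e2 n12 (radius G e1 (x1 p)) (radius G e2 (x2 p)) * x1' h) * angle_coeff G (quantity G e3 e1 n13 (x3 p) (x1 p)) (quantity G e2 e1 n12 (x2 p) (x1 p)) (quantity G e2 e3 n23 (x2 p) (x3 p)))
      / sqrt B)
     + x3' h * (((quantity_deriv G e1 e2 n12 (radius G e1 (x1 p)) (radius G e2 (x2 p)) * x1' h + quantity_deriv G e2 e1 n12 (radius G e2 (x2 p)) (radius G e1 (x1 p)) * x2' h)
       - (quantity_deriv G e3 e1 n13 (radius G e3 (x3 p)) (radius G e1 (x1 p)) * x3' h + quantity_deriv G e1 e3 n13 (radius G e1 (x1 p)) (radius G e3 (x3 p)) * x1' h) * angle_coeff G (quantity G e1 e2 n12 (x1 p) (x2 p)) (quantity G e3 e1 n13 (x3 p) (x1 p)) (quantity G e3 e2 n23 (x3 p) (x2 p))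
       - (quantity_deriv G e3 e2 n23 (radius G e3 (x3 p)) (radius G e2 (x2 p)) * x3' h + quantity_deriv G e2 e3 n23 (radius G e2 (x2 p)) (radius G e3 (x3 p)) * x2' h) * angle_coeff G (quantity G e1 e2 n12 (x1 p) (x2 p)) (quantity G e3 e2 n23 (x3 p) (x2 p)) (quantity G e3 e1 n13 (x3 p) (x1 p)))
      / sqrt B)
     \<le> - (c / sqrt B) * dir_norm G (x1' h) (x2' h) (x3' h)"
      unfolding quantity_commute[of G e2 e1] quantity_commute[of G e3 e1] quantity_commute[of G e3 e2]
      unfolding r1_def[symmetric] r2_def[symmetric] r3_def[symmetric] quantity_def
      unfolding y' y12_def[symmetric] y13_def[symmetric] y23_def[symmetric] sum rhs
      by (rule L[OF sb])
  qed (rule D1 D2 D3)+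
qed

section \<open>Monotonicity of the extended angles\<close>

text \<open>On the degenerate set the angles are locally constant, so the monotonicity along a segment only
  sees the nondegenerate part; a finite set of exceptional values encodes this without any
  description of the degenerate set.\<close>

lemma nonincreasing_off_finite_values:
  fixes f :: "real \<Rightarrow> real"
  assumes cont: "continuous_on {0..1} f" and fin: "finite A"
    and der: "\<And>s. 0 < s \<Longrightarrow> s < 1 \<Longrightarrow> f s \<notin> A \<Longrightarrow> \<exists>D\<le>0. (f has_real_derivative D) (at s)"
  shows "f 1 \<le> f 0"
proof (rule ccontr)
  assume "\<not> f 1 \<le> f 0"
  then have lt: "f 0 < f 1" by simp
  \<comment> \<open>The values between \<open>f 0\<close> and \<open>f 1\<close> are infinitely
    many, so a whole interval from \<open>y1\<close> to \<open>y2\<close> among them avoids the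
    finite set.\<close>
  have "infinite {f 0<..<f 1}" using lt by simp
  then have "\<not> {f 0<..<f 1} \<subseteq> A" using fin finite_subset by blast
  then obtain y1 where y1: "f 0 < y1" "y1 < f 1" "y1 \<notin> A" by (meson greaterThanLessThan_iff subsetI)
  have "open (- A)" using finite_imp_closed[OF fin] by (simp add: open_Compl)
  then obtain d where d: "d > 0" "ball y1 d \<subseteq> - A" using y1 unfolding open_contains_ball by auto
  define y2 where "y2 = min (y1 + d / 2) ((y1 + f 1) / 2)"
  have y2: "y1 < y2" "y2 < f 1" "\<And>y. y1 \<le> y \<Longrightarrow> y \<le> y2 \<Longrightarrow> y \<notin> A"
    using d y1 by (auto simp: y2_def dist_real_def subset_iff min_def split: if_splits)
  \<comment> \<open>\<open>b\<close> will be the first time with value at least \<open>y2\<close>,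
    and \<open>a\<close> the last time before it with value at most \<open>y1\<close>. In between f
    takes values outside \<open>A\<close> only, so it cannot rise from \<open>y1\<close> to
    \<open>y2\<close>.\<close>
  define B where "B = {s \<in> {0..1}. f s \<ge> y2}"
  have "closed B" unfolding B_def
    using continuous_closed_preimage[OF cont closed_atLeastAtMost closed_atLeast[of y2]]
    by (simp add: vimage_def Int_def)
  then have B: "compact B" "B \<noteq> {}" using y2 by (auto simp: B_def compact_eq_bounded_closed intro!: bounded_subset[OF bounded_closed_interval[of 0 1]] exI[of _ 1])
  obtain b where b: "b \<in> B" "\<And>s. s \<in> B \<Longrightarrow> b \<le> s" using compact_attains_inf[OF B] by blast
  define C where "C = {s \<in> {0..b}. f s \<le> y1}"
  have b01: "0 \<le> b" "b \<le> 1" using b by (auto simp: B_def)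
  have contb: "continuous_on {0..b} f" by (rule continuous_on_subset[OF cont]) (use b01 in auto)
  have "closed C" unfolding C_def
    using continuous_closed_preimage[OF contb closed_atLeastAtMost closed_atMost[of y1]]
    by (simp add: vimage_def Int_def)
  then have C: "compact C" "C \<noteq> {}" using y1 b01 by (auto simp: C_def compact_eq_bounded_closed intro!: bounded_subset[OF bounded_closed_interval[of 0 b]] exI[of _ 0])
  obtain a where a: "a \<in> C" "\<And>s. s \<in> C \<Longrightarrow> s \<le> a" using compact_attains_sup[OF C] by blast
  have ab: "0 \<le> a" "a \<le> b" "f a \<le> y1" "y2 \<le> f b" using a b by (auto simp: B_def C_def)
  have "f b \<le> f a"
  proof (rule DERIV_nonpos_imp_decreasing_open[where f = f and a = a and b = b])
    show "a \<le> b" by (rule ab)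
    show "continuous_on {a..b} f" by (rule continuous_on_subset[OF cont]) (use ab b01 in auto)
    fix s assume s: "a < s" "s < b"
    have "s \<notin> C" using a(2)[of s] s by auto
    moreover have "s \<notin> B" using b(2)[of s] s by auto
    ultimately have "y1 \<le> f s" "f s \<le> y2" using s ab b01 by (auto simp: B_def C_def)
    then show "\<exists>y. (f has_real_derivative y) (at s) \<and> y \<le> 0" using der[of s] y2(3) s ab b01 by auto
  qed
  then show False using ab y2 by simp
qed

lemma u_domain_convex:
  assumes "x \<in> u_domain G e" "y \<in> u_domain G e" "0 \<le> s" "s \<le> 1"
  shows "y + s * (x - y) \<in> u_domain G e"
proof -
  have "convex (u_domain G e)" by (auto simp: u_domain_def)
  from convexD_alt[OF this assms(2,1,3,4)] show ?thesis by (simp add: algebra_simps)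
qed

lemma tri_angles_monotone:
  assumes st: "structure_triple e1 e2 e3 n12 n13 n23"
    and x: "x1 \<in> u_domain G e1" "x2 \<in> u_domain G e2" "x3 \<in> u_domain G e3"
    and y: "y1 \<in> u_domain G e1" "y2 \<in> u_domain G e2" "y3 \<in> u_domain G e3"
  shows "(x1 - y1) * (tri_angle G e1 e2 e3 n12 n13 n23 x1 x2 x3 - tri_angle G e1 e2 e3 n12 n13 n23 y1 y2 y3)
       + (x2 - y2) * (tri_angle G e2 e3 e1 n23 n12 n13 x2 x3 x1 - tri_angle G e2 e3 e1 n23 n12 n13 y2 y3 y1)
       + (x3 - y3) * (tri_angle G e3 e1 e2 n13 n23 n12 x3 x1 x2 - tri_angle G e3 e1 e2 n13 n23 n12 y3 y1 y2) \<le> 0"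
proof -
  note st2 = structure_triple_rotate[OF st] and st3 = structure_triple_rotate[OF structure_triple_rotate[OF st]]
  define z1 where "z1 s = y1 + s * (x1 - y1)" for s
  define z2 where "z2 s = y2 + s * (x2 - y2)" for s
  define z3 where "z3 s = y3 + s * (x3 - y3)" for s
  define f1 where "f1 s = tri_angle G e1 e2 e3 n12 n13 n23 (z1 s) (z2 s) (z3 s)" for s
  define f2 where "f2 s = tri_angle G e2 e3 e1 n23 n12 n13 (z2 s) (z3 s) (z1 s)" for s
  define f3 where "f3 s = tri_angle G e3 e1 e2 n13 n23 n12 (z3 s) (z1 s) (z2 s)" for s
  define f where "f s = (x1 - y1) * f1 s + (x2 - y2) * f2 s + (x3 - y3) * f3 s" for s
  \<comment> \<open>All values the pairing can take when each of the three angles is 0 or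
    pi.\<close>
  define A where "A = (\<lambda>(p, q, r). (x1 - y1) * p + (x2 - y2) * q + (x3 - y3) * r) ` ({0, pi} \<times> {0, pi} \<times> {0, pi})"
  have d: "(z1 has_derivative (\<lambda>h. h * (x1 - y1))) (at s)" "(z2 has_derivative (\<lambda>h. h * (x2 - y2))) (at s)"
    "(z3 has_derivative (\<lambda>h. h * (x3 - y3))) (at s)" for s
    unfolding z1_def z2_def z3_def by (auto intro!: derivative_eq_intros)
  have dom: "z1 s \<in> u_domain G e1" "z2 s \<in> u_domain G e2" "z3 s \<in> u_domain G e3" if "0 \<le> s" "s \<le> 1" for s
    unfolding z1_def z2_def z3_def using u_domain_convex x y that by auto
  have "f 1 \<le> f 0"
  proof (rule nonincreasing_off_finite_values)
    show "finite A" by (simp add: A_def)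
    have "isCont f s" if "s \<in> {0..1}" for s
    proof -
      have "isCont f1 s" "isCont f2 s" "isCont f3 s"
        unfolding f1_def f2_def f3_def using that
        by (auto intro!: tri_angle_isCont[OF st d] tri_angle_isCont[OF st2 d(2,3,1)] tri_angle_isCont[OF st3 d(3,1,2)] dom)
      then show ?thesis unfolding f_def by (intro continuous_intros)
    qed
    then show "continuous_on {0..1} f" by (simp add: continuous_at_imp_continuous_on)
    fix s :: real assume s: "0 < s" "s < 1" "f s \<notin> A"
    note dm = dom[of s]
    have "tri_det G e1 e2 e3 n12 n13 n23 (z1 s) (z2 s) (z3 s) > 0"
    proof (rule ccontr)
      assume n: "\<not> tri_det G e1 e2 e3 n12 n13 n23 (z1 s) (z2 s) (z3 s) > 0"
      have n2: "\<not> tri_det G e2 e3 e1 n23 n12 n13 (z2 s) (z3 s) (z1 s) > 0"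
        using n by (simp add: tri_det_rotate)
      have n3: "\<not> tri_det G e3 e1 e2 n13 n23 n12 (z3 s) (z1 s) (z2 s) > 0"
        using n by (metis tri_det_rotate)
      have "f1 s \<in> {0, pi}" "f2 s \<in> {0, pi}" "f3 s \<in> {0, pi}"
        unfolding f1_def f2_def f3_def
        using tri_angle_degenerate[OF st _ _ _ n] tri_angle_degenerate[OF st2 _ _ _ n2]
          tri_angle_degenerate[OF st3 _ _ _ n3] dm s by auto
      then have "(f1 s, f2 s, f3 s) \<in> {0, pi} \<times> {0, pi} \<times> {0, pi}" by (intro SigmaI)
      then have "f s \<in> A" unfolding A_def by (rule rev_image_eqI) (simp add: f_def)
      with s show False by simp
    qed
    from tri_angles_form_neg[OF st d _ _ _ this] obtain T1 T2 T3 c where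
      T: "(f1 has_derivative T1) (at s)" "(f2 has_derivative T2) (at s)" "(f3 has_derivative T3) (at s)"
      and c: "c > 0" "\<And>h. h * (x1 - y1) * T1 h + h * (x2 - y2) * T2 h + h * (x3 - y3) * T3 h
        \<le> - c * dir_norm G (h * (x1 - y1)) (h * (x2 - y2)) (h * (x3 - y3))"
      using dm s unfolding f1_def f2_def f3_def by auto
    define D where "D h = (x1 - y1) * T1 h + (x2 - y2) * T2 h + (x3 - y3) * T3 h" for h
    have fD: "(f has_derivative D) (at s)"
      unfolding f_def D_def by (intro derivative_intros T)
    have "linear D" using has_derivative_linear[OF fD] .
    then have lin: "h * D 1 = D h" for h using linear_cmul[of D h 1] by simp
    have "D 1 \<le> 0"
    proof -
      have "- c * dir_norm G (1 * (x1 - y1)) (1 * (x2 - y2)) (1 * (x3 - y3)) \<le> 0"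
        using c(1) dir_norm_nonneg by simp
      then show ?thesis using c(2)[of 1] by (simp add: D_def)
    qed
    then show "\<exists>D\<le>0. (f has_real_derivative D) (at s)"
      using has_derivative_imp_has_field_derivative[OF fD lin] by auto
  qed
  then show ?thesis by (simp add: f_def f1_def f2_def f3_def z1_def z2_def z3_def algebra_simps)
qed

lemma norm_triple_le: "norm (x, y, z) \<le> \<bar>x\<bar> + \<bar>y\<bar> + \<bar>z\<bar>" for x y z :: real
  using norm_Pair_le[of x "(y, z)"] norm_Pair_le[of y z] by simp

text \<open>Differentiability at x alone gives the estimate, with \<open>c\<close> chosen before
  \<open>\<epsilon>\<close>. The remainder is measured in the full norm because the Euclidean
  \<open>dir_norm\<close> vanishes on common shifts; it can be absorbed only after summation over
  the faces.\<close>

lemma tri_angles_strongly_monotone: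
  assumes st: "structure_triple e1 e2 e3 n12 n13 n23"
    and x: "x1 \<in> u_domain G e1" "x2 \<in> u_domain G e2" "x3 \<in> u_domain G e3"
    and det: "tri_det G e1 e2 e3 n12 n13 n23 x1 x2 x3 > 0"
  shows "\<exists>c>0. \<forall>\<epsilon>>0. \<exists>\<delta>>0. \<forall>y1 y2 y3. \<bar>y1 - x1\<bar> < \<delta> \<longrightarrow> \<bar>y2 - x2\<bar> < \<delta> \<longrightarrow> \<bar>y3 - x3\<bar> < \<delta> \<longrightarrow>
    (y1 - x1) * (tri_angle G e1 e2 e3 n12 n13 n23 y1 y2 y3 - tri_angle G e1 e2 e3 n12 n13 n23 x1 x2 x3)
       + (y2 - x2) * (tri_angle G e2 e3 e1 n23 n12 n13 y2 y3 y1 - tri_angle G e2 e3 e1 n23 n12 n13 x2 x3 x1)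
       + (y3 - x3) * (tri_angle G e3 e1 e2 n13 n23 n12 y3 y1 y2 - tri_angle G e3 e1 e2 n13 n23 n12 x3 x1 x2)
    \<le> - c * dir_norm G (y1 - x1) (y2 - x2) (y3 - x3) + \<epsilon> * ((y1 - x1)\<^sup>2 + (y2 - x2)\<^sup>2 + (y3 - x3)\<^sup>2)"
proof -
  define p where "p = (x1, x2, x3)"
  define F1 where "F1 q = tri_angle G e1 e2 e3 n12 n13 n23 (fst q) (fst (snd q)) (snd (snd q))" for q
  define F2 where "F2 q = tri_angle G e2 e3 e1 n23 n12 n13 (fst (snd q)) (snd (snd q)) (fst q)" for q
  define F3 where "F3 q = tri_angle G e3 e1 e2 n13 n23 n12 (snd (snd q)) (fst q) (fst (snd q))" for q
  have d: "(fst has_derivative fst) (at p)" "((\<lambda>q. fst (snd q)) has_derivative (\<lambda>q. fst (snd q))) (at p)"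
    "((\<lambda>q. snd (snd q)) has_derivative (\<lambda>q. snd (snd q))) (at p)"
    by (auto intro!: derivative_eq_intros)
  obtain T1 T2 T3 c where T: "(F1 has_derivative T1) (at p)" "(F2 has_derivative T2) (at p)" "(F3 has_derivative T3) (at p)"
    and c: "c > 0" "\<And>h. fst h * T1 h + fst (snd h) * T2 h + snd (snd h) * T3 h
        \<le> - c * dir_norm G (fst h) (fst (snd h)) (snd (snd h))"
    using tri_angles_form_neg[OF st d, of G] x det unfolding F1_def F2_def F3_def p_def by auto
  show ?thesis
  proof (rule exI[of _ c], rule conjI[OF c(1)], intro allI impI)
    fix \<epsilon> :: real assume \<epsilon>: "\<epsilon> > 0"
    have "\<exists>d>0. \<forall>q. norm (q - p) < d \<longrightarrow> norm (F q - F p - T (q - p)) \<le> \<epsilon> / 3 * norm (q - p)"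
      if "(F has_derivative T) (at p)" for F T :: "real \<times> real \<times> real \<Rightarrow> real"
    proof -
      have "\<epsilon> / 3 > 0" using \<epsilon> by simp
      then show ?thesis using that unfolding has_derivative_at_alt by blast
    qed
    from this[OF T(1)] this[OF T(2)] this[OF T(3)] obtain d1 d2 d3 where d: "d1 > 0" "d2 > 0" "d3 > 0"
      and D: "\<And>q. norm (q - p) < d1 \<Longrightarrow> norm (F1 q - F1 p - T1 (q - p)) \<le> \<epsilon> / 3 * norm (q - p)"
        "\<And>q. norm (q - p) < d2 \<Longrightarrow> norm (F2 q - F2 p - T2 (q - p)) \<le> \<epsilon> / 3 * norm (q - p)"
        "\<And>q. norm (q - p) < d3 \<Longrightarrow> norm (F3 q - F3 p - T3 (q - p)) \<le> \<epsilon> / 3 * norm (q - p)"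
      by blast
    define \<delta> where "\<delta> = min d1 (min d2 d3) / 3"
    show "\<exists>\<delta>>0. \<forall>y1 y2 y3. \<bar>y1 - x1\<bar> < \<delta> \<longrightarrow> \<bar>y2 - x2\<bar> < \<delta> \<longrightarrow> \<bar>y3 - x3\<bar> < \<delta> \<longrightarrow>
    (y1 - x1) * (tri_angle G e1 e2 e3 n12 n13 n23 y1 y2 y3 - tri_angle G e1 e2 e3 n12 n13 n23 x1 x2 x3)
       + (y2 - x2) * (tri_angle G e2 e3 e1 n23 n12 n13 y2 y3 y1 - tri_angle G e2 e3 e1 n23 n12 n13 x2 x3 x1)
       + (y3 - x3) * (tri_angle G e3 e1 e2 n13 n23 n12 y3 y1 y2 - tri_angle G e3 e1 e2 n13 n23 n12 x3 x1 x2)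
    \<le> - c * dir_norm G (y1 - x1) (y2 - x2) (y3 - x3) + \<epsilon> * ((y1 - x1)\<^sup>2 + (y2 - x2)\<^sup>2 + (y3 - x3)\<^sup>2)"
    proof (intro exI[of _ \<delta>] conjI allI impI)
      show "\<delta> > 0" using d by (simp add: \<delta>_def)
      fix y1 y2 y3 assume y: "\<bar>y1 - x1\<bar> < \<delta>" "\<bar>y2 - x2\<bar> < \<delta>" "\<bar>y3 - x3\<bar> < \<delta>"
      define q where "q = (y1, y2, y3)"
      define n where "n = norm (q - p)"
      have qp: "q - p = (y1 - x1, y2 - x2, y3 - x3)" by (simp add: q_def p_def)
      have "n < 3 * \<delta>" unfolding n_def qp using norm_triple_le[of "y1 - x1" "y2 - x2" "y3 - x3"] y by linarith
      then have nd: "n < d1" "n < d2" "n < d3" by (auto simp: \<delta>_def)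
      have n2: "n\<^sup>2 = (y1 - x1)\<^sup>2 + (y2 - x2)\<^sup>2 + (y3 - x3)\<^sup>2"
        unfolding n_def qp by (simp add: norm_Pair)
      have "\<bar>a\<bar> \<le> n" if "a\<^sup>2 \<le> n\<^sup>2" for a
        using that abs_le_square_iff[of a n] by (simp add: n_def)
      then have comp: "\<bar>y1 - x1\<bar> \<le> n" "\<bar>y2 - x2\<bar> \<le> n" "\<bar>y3 - x3\<bar> \<le> n"
        by (simp_all add: n2)
      have rem: "e * (a - b) \<le> e * t + \<epsilon> / 3 * n\<^sup>2" if "norm (a - b - t) \<le> \<epsilon> / 3 * n" "\<bar>e\<bar> \<le> n" for a b t e :: real
      proof -
        have "e * (a - b) - e * t = e * (a - b - t)" by (simp add: algebra_simps)
        also have "\<dots> \<le> \<bar>e\<bar> * \<bar>a - b - t\<bar>" by (metis abs_ge_self abs_mult)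
        also have "\<dots> \<le> n * (\<epsilon> / 3 * n)" using that by (intro mult_mono) auto
        finally show ?thesis by (simp add: power2_eq_square algebra_simps)
      qed
      have "(y1 - x1) * (F1 q - F1 p) + (y2 - x2) * (F2 q - F2 p) + (y3 - x3) * (F3 q - F3 p)
        \<le> (y1 - x1) * T1 (q - p) + (y2 - x2) * T2 (q - p) + (y3 - x3) * T3 (q - p) + \<epsilon> * n\<^sup>2"
        using rem[OF D(1)[of q, folded n_def, OF nd(1)] comp(1)] rem[OF D(2)[of q, folded n_def, OF nd(2)] comp(2)]
          rem[OF D(3)[of q, folded n_def, OF nd(3)] comp(3)] by (simp add: algebra_simps)
      also have "(y1 - x1) * T1 (q - p) + (y2 - x2) * T2 (q - p) + (y3 - x3) * T3 (q - p)
        \<le> - c * dir_norm G (y1 - x1) (y2 - x2) (y3 - x3)"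
        using c(2)[of "q - p"] by (simp add: qp)
      finally show "(y1 - x1) * (tri_angle G e1 e2 e3 n12 n13 n23 y1 y2 y3 - tri_angle G e1 e2 e3 n12 n13 n23 x1 x2 x3)
       + (y2 - x2) * (tri_angle G e2 e3 e1 n23 n12 n13 y2 y3 y1 - tri_angle G e2 e3 e1 n23 n12 n13 x2 x3 x1)
       + (y3 - x3) * (tri_angle G e3 e1 e2 n13 n23 n12 y3 y1 y2 - tri_angle G e3 e1 e2 n13 n23 n12 x3 x1 x2)
    \<le> - c * dir_norm G (y1 - x1) (y2 - x2) (y3 - x3) + \<epsilon> * ((y1 - x1)\<^sup>2 + (y2 - x2)\<^sup>2 + (y3 - x3)\<^sup>2)"
        unfolding n2 by (simp add: F1_def F2_def F3_def q_def p_def)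
    qed
  qed
qed

lemma tri_angle_continuous:
  assumes st: "structure_triple e1 e2 e3 n12 n13 n23"
    and x: "x1 \<in> u_domain G e1" "x2 \<in> u_domain G e2" "x3 \<in> u_domain G e3" and \<epsilon>: "\<epsilon> > 0"
  shows "\<exists>\<delta>>0. \<forall>y1 y2 y3. \<bar>y1 - x1\<bar> < \<delta> \<longrightarrow> \<bar>y2 - x2\<bar> < \<delta> \<longrightarrow> \<bar>y3 - x3\<bar> < \<delta> \<longrightarrow>
    \<bar>tri_angle G e1 e2 e3 n12 n13 n23 y1 y2 y3 - tri_angle G e1 e2 e3 n12 n13 n23 x1 x2 x3\<bar> < \<epsilon>"
proof -
  define p where "p = (x1, x2, x3)"
  have d: "(fst has_derivative fst) (at p)" "((\<lambda>q. fst (snd q)) has_derivative (\<lambda>q. fst (snd q))) (at p)"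
    "((\<lambda>q. snd (snd q)) has_derivative (\<lambda>q. snd (snd q))) (at p)"
    by (auto intro!: derivative_eq_intros)
  have "isCont (\<lambda>q. tri_angle G e1 e2 e3 n12 n13 n23 (fst q) (fst (snd q)) (snd (snd q))) p"
    by (rule tri_angle_isCont[OF st d]) (use x in \<open>auto simp: p_def\<close>)
  then obtain d where "d > 0" and d: "\<And>q. dist q p < d \<Longrightarrow>
     dist (tri_angle G e1 e2 e3 n12 n13 n23 (fst q) (fst (snd q)) (snd (snd q)))
       (tri_angle G e1 e2 e3 n12 n13 n23 (fst p) (fst (snd p)) (snd (snd p))) < \<epsilon>"
    using \<epsilon> unfolding continuous_at_eps_delta by blast
  show ?thesis
  proof (intro exI[of _ "d / 3"] conjI allI impI)
    fix y1 y2 y3 assume y: "\<bar>y1 - x1\<bar> < d / 3" "\<bar>y2 - x2\<bar> < d / 3" "\<bar>y3 - x3\<bar> < d / 3"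
    have "dist (y1, y2, y3) p < d"
      unfolding dist_norm p_def using norm_triple_le[of "y1 - x1" "y2 - x2" "y3 - x3"] y by simp
    from d[OF this] show "\<bar>tri_angle G e1 e2 e3 n12 n13 n23 y1 y2 y3 - tri_angle G e1 e2 e3 n12 n13 n23 x1 x2 x3\<bar> < \<epsilon>"
      by (simp add: p_def dist_real_def)
  qed (use \<open>d > 0\<close> in simp)
qed

section \<open>Angle sums and angles at large circles\<close>

text \<open>The sine of \<alpha> + \<beta> is positive, which puts this sum below pi; there its
  cosine, which equals that of pi - \<gamma>, determines it.\<close>

lemma euclidean_angle_sum_lengths:
  assumes pos: "x > 0" "y > 0" "z > 0" and tri: "strict_triangle x y z"
  shows "inner_angle Euclidean x y z + inner_angle Euclidean y z x + inner_angle Euclidean z x y = pi"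
proof -
  define A where "A = 2 * x\<^sup>2 * y\<^sup>2 + 2 * x\<^sup>2 * z\<^sup>2 + 2 * y\<^sup>2 * z\<^sup>2 - (x\<^sup>2)\<^sup>2 - (y\<^sup>2)\<^sup>2 - (z\<^sup>2)\<^sup>2"
  have "A = (x + y + z) * (x + y - z) * (x - y + z) * (- x + y + z)"
    unfolding A_def by (simp add: algebra_simps power2_eq_square)
  then have A: "A > 0" using pos tri unfolding strict_triangle_def by simp
  have angle: "sin (inner_angle Euclidean a b c) = sqrt A / (2 * b * c)"
      "cos (inner_angle Euclidean a b c) = (b\<^sup>2 + c\<^sup>2 - a\<^sup>2) / (2 * b * c)"
      "0 \<le> inner_angle Euclidean a b c" "inner_angle Euclidean a b c \<le> pi"
    if "a > 0" "b > 0" "c > 0" and AA: "A = 2 * a\<^sup>2 * b\<^sup>2 + 2 * a\<^sup>2 * c\<^sup>2 + 2 * b\<^sup>2 * c\<^sup>2 - (a\<^sup>2)\<^sup>2 - (b\<^sup>2)\<^sup>2 - (c\<^sup>2)\<^sup>2" for a b c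
  proof -
    define k where "k = (b\<^sup>2 + c\<^sup>2 - a\<^sup>2) / (2 * b * c)"
    have k: "1 - k\<^sup>2 = A / (2 * b * c)\<^sup>2"
      unfolding k_def AA using that(1-3) by (simp add: power_divide divide_simps) (simp add: algebra_simps power2_eq_square power4_eq_xxxx)
    moreover have "A / (2 * b * c)\<^sup>2 > 0" using A that by simp
    ultimately have k1: "\<bar>k\<bar> \<le> 1" by (metis abs_square_le_1 diff_gt_0_iff_gt less_imp_le)
    then have k2: "-1 \<le> k" "k \<le> 1" by auto
    have "sin (arccos k) = sqrt (1 - k\<^sup>2)" using sin_arccos[OF k2] .
    then show "sin (inner_angle Euclidean a b c) = sqrt A / (2 * b * c)"
      using that unfolding k by (simp add: k_def real_sqrt_divide)
    show "cos (inner_angle Euclidean a b c) = (b\<^sup>2 + c\<^sup>2 - a\<^sup>2) / (2 * b * c)"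
      using cos_arccos[OF k2] by (simp add: k_def)
    show "0 \<le> inner_angle Euclidean a b c" "inner_angle Euclidean a b c \<le> pi"
      using arccos_lbound[OF k2] arccos_ubound[OF k2] by (simp_all add: k_def)
  qed
  define \<alpha> where "\<alpha> = inner_angle Euclidean x y z"
  define \<beta> where "\<beta> = inner_angle Euclidean y z x"
  define \<gamma> where "\<gamma> = inner_angle Euclidean z x y"
  have AA: "A = 2 * y\<^sup>2 * z\<^sup>2 + 2 * y\<^sup>2 * x\<^sup>2 + 2 * z\<^sup>2 * x\<^sup>2 - (y\<^sup>2)\<^sup>2 - (z\<^sup>2)\<^sup>2 - (x\<^sup>2)\<^sup>2"
    "A = 2 * z\<^sup>2 * x\<^sup>2 + 2 * z\<^sup>2 * y\<^sup>2 + 2 * x\<^sup>2 * y\<^sup>2 - (z\<^sup>2)\<^sup>2 - (x\<^sup>2)\<^sup>2 - (y\<^sup>2)\<^sup>2"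
    unfolding A_def by simp_all
  note a = angle[OF pos A_def, folded \<alpha>_def] and b = angle[OF pos(2,3,1) AA(1), folded \<beta>_def]
    and g = angle[OF pos(3,1,2) AA(2), folded \<gamma>_def]
  have "sin (\<alpha> + \<beta>) = sqrt A / (2 * x * y)"
    unfolding sin_add a(1,2) b(1,2) using pos by (simp add: field_simps power2_eq_square)
  moreover have "sqrt A / (2 * x * y) > 0" using A pos by simp
  ultimately have s: "sin (\<alpha> + \<beta>) > 0" by simp
  have lt: "\<alpha> + \<beta> < pi"
  proof (rule ccontr)
    assume "\<not> \<alpha> + \<beta> < pi"
    then have "pi \<le> \<alpha> + \<beta>" "\<alpha> + \<beta> \<le> 2 * pi" using a b by auto
    then have "sin (\<alpha> + \<beta> - pi) \<ge> 0" by (intro sin_ge_zero) auto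
    then show False using s by (simp add: sin_diff)
  qed
  have "cos (\<alpha> + \<beta>) = ((y\<^sup>2 + z\<^sup>2 - x\<^sup>2) * (z\<^sup>2 + x\<^sup>2 - y\<^sup>2) - sqrt A * sqrt A) / (4 * x * y * z\<^sup>2)"
    unfolding cos_add a(1,2) b(1,2) by (simp add: diff_divide_distrib[symmetric] power2_eq_square mult_ac)
  also have "(y\<^sup>2 + z\<^sup>2 - x\<^sup>2) * (z\<^sup>2 + x\<^sup>2 - y\<^sup>2) - sqrt A * sqrt A = - (2 * z\<^sup>2 * (x\<^sup>2 + y\<^sup>2 - z\<^sup>2))"
    using A by (simp add: A_def) (simp add: algebra_simps power2_eq_square power4_eq_xxxx)
  also have "- (2 * z\<^sup>2 * (x\<^sup>2 + y\<^sup>2 - z\<^sup>2)) / (4 * x * y * z\<^sup>2) = - cos \<gamma>"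
    unfolding g(2) using pos by (simp add: divide_simps)
  also have "\<dots> = cos (pi - \<gamma>)" by (simp add: cos_diff)
  finally have "\<alpha> + \<beta> = pi - \<gamma>"
    by (rule cos_inj_pi[rotated 4]) (use lt a b g in auto)
  then show ?thesis by (simp add: \<alpha>_def \<beta>_def \<gamma>_def)
qed

text \<open>For positive lengths a degenerate triangle violates exactly one of the three strict
  inequalities, so one extended angle is pi and the other two are 0.\<close>

lemma euclidean_ext_angle_sum:
  assumes pos: "x > 0" "y > 0" "z > 0"
  shows "ext_angle Euclidean x y z + ext_angle Euclidean y z x + ext_angle Euclidean z x y = pi"
proof (cases "strict_triangle x y z")
  case True
  then have "strict_triangle y z x" "strict_triangle z x y" by (auto simp: strict_triangle_def)
  then show ?thesis using True euclidean_angle_sum_lengths[OF pos True] by (simp add: ext_angle_def)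
next
  case False
  then have "\<not> strict_triangle y z x" "\<not> strict_triangle z x y" by (auto simp: strict_triangle_def)
  moreover have "(x \<ge> y + z \<and> \<not> y \<ge> z + x \<and> \<not> z \<ge> x + y) \<or> (\<not> x \<ge> y + z \<and> y \<ge> z + x \<and> \<not> z \<ge> x + y)
    \<or> (\<not> x \<ge> y + z \<and> \<not> y \<ge> z + x \<and> z \<ge> x + y)"
    using False pos unfolding strict_triangle_def by linarith
  ultimately show ?thesis using False by (auto simp: ext_angle_def)
qed

lemma ext_angle_swap: "ext_angle G a b c = ext_angle G a c b"
proof -
  have "strict_triangle a b c \<longleftrightarrow> strict_triangle a c b" by (auto simp: strict_triangle_def)
  moreover have "inner_angle G a b c = inner_angle G a c b"
    by (cases G) (simp_all add: ac_simps)
  ultimately show ?thesis by (simp add: ext_angle_def add.commute)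
qed

text \<open>Since \<open>1 - cos \<theta>\<^sub>i \<le> cosh l\<^sub>j\<^sub>k / (sinh l\<^sub>i\<^sub>j sinh l\<^sub>i\<^sub>k)\<close> and \<open>cosh l\<^sub>i\<^sub>j\<close> grows at least like
  \<open>r\<^sub>i (C\<^sub>j + r\<^sub>j)\<close>, while \<open>cosh l\<^sub>j\<^sub>k\<close> grows at most like \<open>(C\<^sub>j + r\<^sub>j) (C\<^sub>k + r\<^sub>k)\<close>, the angle at \<open>i\<close> is
  \<open>O(1 / r\<^sub>i)\<close> uniformly in \<open>j, k\<close>.\<close>

lemma hyp_c_lower:
  assumes "e' \<in> {0, 1}" "1 * e' + n > 0"
  shows "\<exists>k>0. \<forall>x>0. \<forall>y>0. k * x * (hyp_C e' y + y) \<le> hyp_c 1 e' n x y"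
proof (intro exI[of _ "min 1 (e' + n) / 2"] conjI allI impI)
  show "min 1 (e' + n) / 2 > 0" using assms by simp
  fix x y :: real assume x: "x > 0" "y > 0"
  define k where "k = min 1 (e' + n)"
  have k: "0 < k" "k \<le> 1" "k \<le> e' + n" using assms by (auto simp: k_def)
  have Cx: "hyp_C 1 x \<ge> x" by (auto simp: hyp_C_def real_le_rsqrt)
  have Cy: "hyp_C e' y \<ge> e' * y" "hyp_C e' y \<ge> 1"
    using assms x by (auto simp: hyp_C_def real_le_rsqrt)
  \<comment> \<open>For weight 1, y is at most \<open>hyp_C e' y\<close>, so the sum costs a factor
    2; this is the origin of the half in the constant.\<close>
  have B: "hyp_C e' y + y \<le> 2 * (hyp_C e' y + (1 - e') * y)"
    using assms(1) Cy x by auto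
  have "k / 2 * x * (hyp_C e' y + y) \<le> k / 2 * x * (2 * (hyp_C e' y + (1 - e') * y))"
    using B k x by (intro mult_left_mono) auto
  also have "\<dots> = k * (x * hyp_C e' y) + k * ((1 - e') * (x * y))" by (simp add: algebra_simps)
  also have "\<dots> \<le> hyp_C 1 x * hyp_C e' y + n * x * y"
  proof (cases "e' = 0")
    case True
    have "k * (x * hyp_C e' y) \<le> 1 * (hyp_C 1 x * hyp_C e' y)"
      using k Cx Cy x by (intro mult_mono) auto
    moreover have "k * (x * y) \<le> n * (x * y)" using k True x by (intro mult_right_mono) auto
    ultimately show ?thesis using True by simp
  next
    case False
    then have e: "e' = 1" using assms by simp
    have xy: "x * y \<le> x * hyp_C e' y" using Cy e x by simp
    have le: "x * hyp_C e' y \<le> hyp_C 1 x * hyp_C e' y" using Cx Cy by (intro mult_right_mono) auto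
    have "k * (x * hyp_C e' y) \<le> x * hyp_C e' y + n * (x * y)"
    proof (cases "n \<ge> 0")
      case True
      have "k * (x * hyp_C e' y) \<le> 1 * (x * hyp_C e' y)" using k x Cy by (intro mult_right_mono) auto
      moreover have "0 \<le> n * (x * y)" using True x by simp
      ultimately show ?thesis by simp
    next
      case False
      have "k * (x * hyp_C e' y) \<le> (1 + n) * (x * hyp_C e' y)" using k e x Cy by (intro mult_right_mono) auto
      moreover have "n * (x * hyp_C e' y) \<le> n * (x * y)" using False by (intro mult_left_mono_neg[OF xy]) simp
      ultimately show ?thesis by (simp add: algebra_simps)
    qed
    then show ?thesis using le e by (simp add: mult.assoc)
  qed
  finally show "min 1 (e' + n) / 2 * x * (hyp_C e' y + y) \<le> hyp_c 1 e' n x y"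
    unfolding k_def hyp_c_def .
qed

lemma hyp_c_upper:
  assumes "e \<in> {0, 1}" "e' \<in> {0, 1}" "x > 0" "y > 0"
  shows "hyp_c e e' n x y \<le> (1 + \<bar>n\<bar>) * ((hyp_C e x + x) * (hyp_C e' y + y))"
proof -
  have C: "hyp_C e x \<ge> 1" "hyp_C e' y \<ge> 1" using assms hyp_C_facts(2) by auto
  have "hyp_C e x * hyp_C e' y \<le> (hyp_C e x + x) * (hyp_C e' y + y)" using C assms by (intro mult_mono) auto
  moreover have "n * x * y \<le> \<bar>n\<bar> * ((hyp_C e x + x) * (hyp_C e' y + y))"
  proof -
    have "n * (x * y) \<le> \<bar>n\<bar> * (x * y)" using assms by (intro mult_right_mono) auto
    also have "\<dots> \<le> \<bar>n\<bar> * ((hyp_C e x + x) * (hyp_C e' y + y))" using C assms by (intro mult_left_mono mult_mono) auto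
    finally show ?thesis by (simp add: mult.assoc)
  qed
  ultimately show ?thesis by (simp add: hyp_c_def algebra_simps)
qed

lemma hyp_cos_arg_lower:
  assumes e: "e2 \<in> {0, 1}" "e3 \<in> {0, 1}" and n: "1 * e2 + n12 > 0" "1 * e3 + n13 > 0" "e2 * e3 + n23 > 0" and \<delta>: "\<delta> > 0"
  shows "\<exists>M. \<forall>x1>M. \<forall>x2>0. \<forall>x3>0. cos_arg Hyperbolic (hyp_c e2 e3 n23 x2 x3) (hyp_c 1 e2 n12 x1 x2) (hyp_c 1 e3 n13 x1 x3) > 1 - \<delta>"
proof -
  obtain k2 where k2: "k2 > 0" "\<And>x y. x > 0 \<Longrightarrow> y > 0 \<Longrightarrow> k2 * x * (hyp_C e2 y + y) \<le> hyp_c 1 e2 n12 x y"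
    using hyp_c_lower[OF e(1) n(1)] by blast
  obtain k3 where k3: "k3 > 0" "\<And>x y. x > 0 \<Longrightarrow> y > 0 \<Longrightarrow> k3 * x * (hyp_C e3 y + y) \<le> hyp_c 1 e3 n13 x y"
    using hyp_c_lower[OF e(2) n(2)] by blast
  \<comment> \<open>The 4 comes from the two bounds \<open>b / 2 \<le> sb\<close> and
    \<open>c / 2 \<le> sc\<close> below. \<open>M\<close> is chosen so that b and c are at least 2,
    where these bounds hold, and so that \<open>K / x1\<^sup>2\<close> is below
    \<open>\<delta>\<close>.\<close>
  define K where "K = 4 * (1 + \<bar>n23\<bar>) / (k2 * k3)"
  have K: "K > 0" using k2 k3 by (simp add: K_def)
  define M where "M = max (max (2 / k2) (2 / k3)) (sqrt (K / \<delta>))"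
  have "M > 0" using k2 by (simp add: M_def less_max_iff_disj)
  show ?thesis
  proof (intro exI[of _ M] allI impI)
    fix x1 x2 x3 :: real assume x: "M < x1" "0 < x2" "0 < x3"
    have x1: "x1 > 0" "2 \<le> k2 * x1" "2 \<le> k3 * x1" "K / x1\<^sup>2 < \<delta>"
    proof -
      show "x1 > 0" using \<open>M > 0\<close> x by simp
      have "2 / k2 < x1" "2 / k3 < x1" "sqrt (K / \<delta>) < x1" using x by (auto simp: M_def)
      then show "2 \<le> k2 * x1" "2 \<le> k3 * x1" using k2 k3 by (auto simp: field_simps)
      have "K / \<delta> < x1\<^sup>2"
        using \<open>sqrt (K / \<delta>) < x1\<close> real_less_rsqrt[of x1 "K / \<delta>"] \<open>x1 > 0\<close> K \<delta>
        by (metis real_sqrt_less_iff real_sqrt_unique less_imp_le)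
      then show "K / x1\<^sup>2 < \<delta>" using \<delta> \<open>x1 > 0\<close> by (simp add: field_simps)
    qed
    define B2 where "B2 = hyp_C e2 x2 + x2"
    define B3 where "B3 = hyp_C e3 x3 + x3"
    define a where "a = hyp_c e2 e3 n23 x2 x3"
    define b where "b = hyp_c 1 e2 n12 x1 x2"
    define c where "c = hyp_c 1 e3 n13 x1 x3"
    have B: "B2 \<ge> 1" "B3 \<ge> 1" using hyp_C_facts(2)[OF e(1)] hyp_C_facts(2)[OF e(2)] x
      by (auto simp: B2_def B3_def add_increasing2)
    have b: "k2 * x1 * B2 \<le> b" and c: "k3 * x1 * B3 \<le> c"
      unfolding b_def c_def B2_def B3_def using k2(2) k3(2) x1 x by auto
    have a: "a \<le> (1 + \<bar>n23\<bar>) * (B2 * B3)" unfolding a_def B2_def B3_def using hyp_c_upper[OF e x(2,3)] .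
    have "2 * 1 \<le> k2 * x1 * B2" by (rule mult_mono) (use x1 B in auto)
    moreover have "2 * 1 \<le> k3 * x1 * B3" by (rule mult_mono) (use x1 B in auto)
    ultimately have b2: "b \<ge> 2" "c \<ge> 2" using b c by auto
    have half: "y / 2 \<le> sqrt (y\<^sup>2 - 1)" "sqrt (y\<^sup>2 - 1) \<le> y" if "y \<ge> 2" for y :: real
    proof -
      have "2\<^sup>2 \<le> y\<^sup>2" using that by (intro power_mono) auto
      then show "y / 2 \<le> sqrt (y\<^sup>2 - 1)" by (intro real_le_rsqrt) (simp add: power_divide)
      show "sqrt (y\<^sup>2 - 1) \<le> y" using that by (intro real_le_lsqrt) auto
    qed
    define sb where "sb = sqrt (b\<^sup>2 - 1)"
    define sc where "sc = sqrt (c\<^sup>2 - 1)"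
    have sb: "b / 2 \<le> sb" "sb \<le> b" "sb > 0" using half[OF b2(1)] b2 by (auto simp: sb_def)
    have sc: "c / 2 \<le> sc" "sc \<le> c" "sc > 0" using half[OF b2(2)] b2 by (auto simp: sc_def)
    have "sb * sc \<le> b * c" using sb sc by (intro mult_mono) auto
    then have "1 - a / (sb * sc) \<le> (b * c - a) / (sb * sc)" using sb sc by (simp add: diff_divide_distrib)
    moreover have "a / (sb * sc) \<le> K / x1\<^sup>2"
    proof -
      have "(k2 * x1 * B2) * (k3 * x1 * B3) \<le> b * c" using b c b2 x1 k3 B by (intro mult_mono) auto
      moreover have "(b / 2) * (c / 2) \<le> sb * sc" using sb sc b2 by (intro mult_mono) auto
      ultimately have low: "(k2 * k3 * x1\<^sup>2 / 4) * (B2 * B3) \<le> sb * sc"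
        by (simp add: power2_eq_square algebra_simps)
      have "a \<le> (1 + \<bar>n23\<bar>) * (B2 * B3)" by (rule a)
      also have "\<dots> = K / x1\<^sup>2 * ((k2 * k3 * x1\<^sup>2 / 4) * (B2 * B3))"
        using x1(1) k2(1) k3(1) by (simp add: K_def field_simps)
      also have "\<dots> \<le> K / x1\<^sup>2 * (sb * sc)" using low K by (intro mult_left_mono) auto
      finally show ?thesis using sb sc by (simp add: pos_divide_le_eq)
    qed
    ultimately show "1 - \<delta> < cos_arg Hyperbolic (hyp_c e2 e3 n23 x2 x3) (hyp_c 1 e2 n12 x1 x2) (hyp_c 1 e3 n13 x1 x3)"
      using x1 unfolding cos_arg.simps a_def[symmetric] b_def[symmetric] c_def[symmetric] sb_def sc_def by linarith
  qed
qed

lemma hyp_tri_angle_small: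
  assumes st: "structure_triple 1 e2 e3 n12 n13 n23" and \<epsilon>: "\<epsilon> > 0"
  shows "\<exists>\<delta>>0. \<forall>x1 x2 x3. - \<delta> < x1 \<longrightarrow> x1 < 0 \<longrightarrow> x2 \<in> u_domain Hyperbolic e2 \<longrightarrow> x3 \<in> u_domain Hyperbolic e3 \<longrightarrow>
    tri_angle Hyperbolic 1 e2 e3 n12 n13 n23 x1 x2 x3 < \<epsilon>"
proof -
  \<comment> \<open>The cosine is monotone only up to pi.\<close>
  define \<epsilon>' where "\<epsilon>' = min \<epsilon> pi"
  have e': "0 < \<epsilon>'" "\<epsilon>' \<le> pi" "\<epsilon>' \<le> \<epsilon>" using \<epsilon> by (auto simp: \<epsilon>'_def)
  have "cos \<epsilon>' < cos 0" using e' by (intro cos_monotone_0_pi) auto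
  then have "1 - cos \<epsilon>' > 0" by simp
  from hyp_cos_arg_lower[OF _ _ _ _ _ this, of e2 e3 n12 n13 n23] st
  obtain M where M: "\<And>x1 x2 x3. x1 > M \<Longrightarrow> x2 > 0 \<Longrightarrow> x3 > 0 \<Longrightarrow>
     cos_arg Hyperbolic (hyp_c e2 e3 n23 x2 x3) (hyp_c 1 e2 n12 x1 x2) (hyp_c 1 e3 n13 x1 x3) > cos \<epsilon>'"
    unfolding structure_triple_def by auto
  define M' where "M' = max M 1"
  have M': "M' > 0" "M \<le> M'" by (auto simp: M'_def)
  show ?thesis
  \<comment> \<open>The coordinate u of a circle with \<open>radius\<close> equal to
    \<open>M'\<close> is \<open>- arsinh (1 / M')\<close>.\<close>
  proof (intro exI[of _ "arsinh (1 / M')"] conjI allI impI)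
    show "0 < arsinh (1 / M')" using M' by simp
    fix x1 x2 x3 assume x: "- arsinh (1 / M') < x1" "x1 < 0" "x2 \<in> u_domain Hyperbolic e2" "x3 \<in> u_domain Hyperbolic e3"
    have "sinh (- arsinh (1 / M')) < sinh x1" using x(1) by (simp only: sinh_real_less_iff)
    then have "- sinh x1 < 1 / M'" by simp
    moreover have s: "sinh x1 < 0" using x(2) by simp
    ultimately have "M' < - 1 / sinh x1" using M' by (simp add: field_simps)
    then have r1: "M < radius Hyperbolic 1 x1" using M' by (simp add: radius_def)
    have dom: "x1 \<in> u_domain Hyperbolic 1" using x by (simp add: u_domain_def)
    define z where "z = cos_arg Hyperbolic (quantity Hyperbolic e2 e3 n23 x2 x3) (quantity Hyperbolic 1 e2 n12 x1 x2)
       (quantity Hyperbolic 1 e3 n13 x1 x3)"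
    have z: "cos \<epsilon>' < z"
      unfolding z_def quantity_def edge_quantity.simps using M[OF r1] radius_pos x by blast
    have "arccos (max (- 1) (min 1 z)) < \<epsilon>'"
    proof -
      have c: "- 1 \<le> max (- 1) (min 1 z)" "max (- 1) (min 1 z) \<le> 1" by auto
      have "cos \<epsilon>' < max (- 1) (min 1 z)" using z \<open>1 - cos \<epsilon>' > 0\<close> by (simp add: less_max_iff_disj)
      also have "\<dots> = cos (arccos (max (- 1) (min 1 z)))" using cos_arccos[OF c] by simp
      finally show ?thesis using cos_mono_less_eq[of \<epsilon>' "arccos (max (- 1) (min 1 z))"] e'
          arccos_lbound[OF c] arccos_ubound[OF c] by auto
    qed
    then show "tri_angle Hyperbolic 1 e2 e3 n12 n13 n23 x1 x2 x3 < \<epsilon>"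
      unfolding tri_angle_eq[OF st dom x(3,4)] z_def[symmetric] using e' by simp
  qed
qed

section \<open>Flows of dissipative fields\<close>

primrec euler :: "(('i \<Rightarrow> real) \<Rightarrow> 'i \<Rightarrow> real) \<Rightarrow> real \<Rightarrow> ('i \<Rightarrow> real) \<Rightarrow> nat \<Rightarrow> 'i \<Rightarrow> real" where
  "euler F h u0 0 = u0"
| "euler F h u0 (Suc k) = (\<lambda>i. euler F h u0 k i + h * F (euler F h u0 k) i)"

text \<open>Used with \<open>c = 0\<close> for a bound on the speed of the scheme, and with
  \<open>c\<close> a value of the field at the limit for its derivative.\<close>

lemma euler_increment:
  assumes "\<And>l. j \<le> l \<Longrightarrow> l < j + m \<Longrightarrow> \<bar>F (euler F h u0 l) i - c\<bar> \<le> e" and h: "h > 0"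
  shows "\<bar>euler F h u0 (j + m) i - euler F h u0 j i - real m * h * c\<bar> \<le> real m * h * e"
  using assms(1)
proof (induction m)
  case (Suc m)
  have "\<bar>F (euler F h u0 (j + m)) i - c\<bar> \<le> e" using Suc.prems by simp
  then have "\<bar>h * (F (euler F h u0 (j + m)) i - c)\<bar> \<le> h * e" using h by (simp add: abs_mult)
  moreover have "\<bar>euler F h u0 (j + m) i - euler F h u0 j i - real m * h * c\<bar> \<le> real m * h * e"
    using Suc by simp
  ultimately have "\<bar>(euler F h u0 (j + m) i - euler F h u0 j i - real m * h * c) + h * (F (euler F h u0 (j + m)) i - c)\<bar>
     \<le> real m * h * e + h * e" by linarith
  then show ?case by (simp add: algebra_simps)
qed simp

text \<open>Dissipativity replaces a Lipschitz bound on \<open>F\<close>. Of the invariant set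
  \<open>D\<close> only this is asked: short explicit Euler steps do not leave it, and neither do
  limits taken coordinatewise on \<open>V\<close>.\<close>

locale dissipative_field =
  fixes V :: "'i set" and F :: "('i \<Rightarrow> real) \<Rightarrow> 'i \<Rightarrow> real" and D :: "('i \<Rightarrow> real) set"
    and M h0 :: real
  assumes fin: "finite V" and h0: "h0 > 0" and M: "M \<ge> 0"
    and bound: "u \<in> D \<Longrightarrow> i \<in> V \<Longrightarrow> \<bar>F u i\<bar> \<le> M"
    and diss: "u \<in> D \<Longrightarrow> w \<in> D \<Longrightarrow> (\<Sum>i\<in>V. (u i - w i) * (F u i - F w i)) \<le> 0"
    and step: "u \<in> D \<Longrightarrow> 0 \<le> h \<Longrightarrow> h \<le> h0 \<Longrightarrow> (\<lambda>i. u i + h * F u i) \<in> D"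
    and lim_closed: "(\<And>n::nat. x n \<in> D) \<Longrightarrow> (\<And>i. i \<in> V \<Longrightarrow> (\<lambda>n. x n i) \<longlonglongrightarrow> u i) \<Longrightarrow> u \<in> D"
    and cont: "u \<in> D \<Longrightarrow> e > 0 \<Longrightarrow> \<exists>d>0. \<forall>w\<in>D. (\<forall>i\<in>V. \<bar>w i - u i\<bar> < d) \<longrightarrow> (\<forall>i\<in>V. \<bar>F w i - F u i\<bar> < e)"
begin

lemma euler_in: "u0 \<in> D \<Longrightarrow> 0 \<le> h \<Longrightarrow> h \<le> h0 \<Longrightarrow> euler F h u0 k \<in> D"
  by (induction k) (auto intro: step)

text \<open>The coarse scheme is interpolated linearly so that both advance by k. By dissipativity
  the cross term of the squared distance is nonpositive, up to the offset of the interpolated point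
  from its grid point. Per step and coordinate this offset costs at most
  \<open>2 * k * (2 * h * M\<^sup>2)\<close>, and the quadratic term at most
  \<open>4 * k * h * M\<^sup>2\<close>; together they give the 8. The squared error is thus of order
  h however fine k is.\<close>

lemma euler_refine:
  assumes u0: "u0 \<in> D" and k: "k > 0" and N: "N > 0" and h: "h = real N * k" "h \<le> h0"
  shows "(\<Sum>i\<in>V. (euler F h u0 (l div N) i + real (l mod N) * k * F (euler F h u0 (l div N)) i - euler F k u0 l i)\<^sup>2)
    \<le> 8 * (real l * k) * h * M\<^sup>2 * card V"
proof (induction l)
  case 0
  then show ?case by simp
next
  case (Suc l)
  define x where "x = euler F h u0 (l div N)"
  define y where "y = euler F k u0 l"
  define q where "q = real (l mod N)"
  define a where "a i = x i + q * k * F x i - y i" for i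
  define b where "b i = F x i - F y i" for i
  have kh: "k \<le> h" "h > 0" using h k N by auto
  have "k \<le> h0" using kh(1) h(2) by (rule order_trans)
  then have inD: "x \<in> D" "y \<in> D" unfolding x_def y_def using u0 k kh(2) h(2) by (auto intro!: euler_in)
  have "real (l mod N) \<le> real N" using N by (simp add: less_imp_le)
  then have q: "0 \<le> q * k" "q * k \<le> h" using k h by (auto simp: q_def)
  have "euler F h u0 (Suc l div N) i + real (Suc l mod N) * k * F (euler F h u0 (Suc l div N)) i - euler F k u0 (Suc l) i
      = a i + k * b i" for i
  proof (cases "Suc (l mod N) = N")
    \<comment> \<open>The fine scheme completes a coarse interval, and the interpolated point
      becomes the next coarse grid point.\<close>
    case True
    then have "Suc l div N = Suc (l div N)" "Suc l mod N = 0" using N by (simp_all add: div_Suc mod_Suc)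
    moreover have "h * z = q * k * z + k * z" for z
    proof -
      have "real (Suc (l mod N)) = real N" using True by (rule arg_cong)
      then have "h = (q + 1) * k" using h(1) by (simp add: q_def add.commute)
      then show ?thesis by (simp add: algebra_simps)
    qed
    ultimately show ?thesis by (simp add: a_def b_def x_def y_def right_diff_distrib)
  next
    case False
    then have "Suc l div N = l div N" "Suc l mod N = Suc (l mod N)" using N by (simp_all add: div_Suc mod_Suc)
    then show ?thesis by (simp add: a_def b_def x_def y_def q_def algebra_simps)
  qed
  then have "(\<Sum>i\<in>V. (euler F h u0 (Suc l div N) i + real (Suc l mod N) * k * F (euler F h u0 (Suc l div N)) i - euler F k u0 (Suc l) i)\<^sup>2)
     = (\<Sum>i\<in>V. (a i + k * b i)\<^sup>2)" by simp
  also have "\<dots> = (\<Sum>i\<in>V. (a i)\<^sup>2) + 2 * k * (\<Sum>i\<in>V. a i * b i) + k\<^sup>2 * (\<Sum>i\<in>V. (b i)\<^sup>2)"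
    by (simp add: power2_sum sum.distrib sum_distrib_left power_mult_distrib mult_ac)
  also have "(\<Sum>i\<in>V. a i * b i) \<le> 2 * h * M\<^sup>2 * card V"
  proof -
    have "(\<Sum>i\<in>V. a i * b i) = (\<Sum>i\<in>V. (x i - y i) * b i) + (\<Sum>i\<in>V. q * k * F x i * b i)"
      by (simp add: a_def algebra_simps flip: sum.distrib)
    also have "(\<Sum>i\<in>V. (x i - y i) * b i) \<le> 0" unfolding b_def by (rule diss[OF inD])
    also have "(\<Sum>i\<in>V. q * k * F x i * b i) \<le> (\<Sum>i\<in>V. 2 * h * M\<^sup>2)"
    proof (rule sum_mono)
      fix i assume i: "i \<in> V"
      have "\<bar>b i\<bar> \<le> 2 * M" using bound[OF inD(1) i] bound[OF inD(2) i] by (simp add: b_def)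
      moreover have "\<bar>q * k * F x i\<bar> \<le> h * M"
        unfolding abs_mult[of "q * k"] using q bound[OF inD(1) i] by (intro mult_mono) auto
      ultimately have "\<bar>q * k * F x i\<bar> * \<bar>b i\<bar> \<le> (h * M) * (2 * M)" using kh M by (intro mult_mono) auto
      then show "q * k * F x i * b i \<le> 2 * h * M\<^sup>2"
        using abs_ge_self[of "q * k * F x i * b i"] by (simp add: abs_mult power2_eq_square mult_ac)
    qed
    finally show ?thesis by (simp add: mult_ac)
  qed
  also have "(\<Sum>i\<in>V. (b i)\<^sup>2) \<le> (\<Sum>i\<in>V. 4 * M\<^sup>2)"
  proof (rule sum_mono)
    fix i assume i: "i \<in> V"
    have "\<bar>b i\<bar> \<le> 2 * M" using bound[OF inD(1) i] bound[OF inD(2) i] by (simp add: b_def)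
    from power_mono[OF this, of 2] show "(b i)\<^sup>2 \<le> 4 * M\<^sup>2" by (simp add: power_mult_distrib)
  qed
  also have "(\<Sum>i\<in>V. (a i)\<^sup>2) \<le> 8 * (real l * k) * h * M\<^sup>2 * card V"
    using Suc by (simp add: a_def x_def y_def q_def)
  also have "k\<^sup>2 * (\<Sum>i\<in>V. 4 * M\<^sup>2) \<le> 4 * k * h * M\<^sup>2 * card V"
  proof -
    have "k * k * (4 * M\<^sup>2 * card V) \<le> k * h * (4 * M\<^sup>2 * card V)" using k kh by (intro mult_right_mono mult_left_mono) auto
    then show ?thesis by (simp add: power2_eq_square mult_ac)
  qed
  finally show ?case using k by (simp add: algebra_simps)
qed

text \<open>Dyadic, so that each mesh is an integer multiple of every finer one, as
  \<open>euler_refine\<close> requires.\<close>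

definition mesh :: "nat \<Rightarrow> real" where "mesh n = h0 / 2 ^ n"

definition euler_path :: "('i \<Rightarrow> real) \<Rightarrow> nat \<Rightarrow> real \<Rightarrow> 'i \<Rightarrow> real" where
  "euler_path u0 n t = euler F (mesh n) u0 (nat \<lfloor>t / mesh n\<rfloor>)"

lemma mesh: "mesh n > 0" "mesh n \<le> h0"
  using h0 by (auto simp: mesh_def divide_le_eq mult_left_le[of _ h0])

lemma mesh_tendsto: "mesh \<longlonglongrightarrow> 0"
proof -
  have "(\<lambda>n. h0 * (1 / 2) ^ n) \<longlonglongrightarrow> h0 * 0" by (intro tendsto_intros LIMSEQ_realpow_zero) auto
  then show ?thesis by (simp add: mesh_def[abs_def] power_divide)
qed

lemma euler_path_in: "u0 \<in> D \<Longrightarrow> euler_path u0 n t \<in> D"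
  unfolding euler_path_def using mesh[of n] by (intro euler_in) auto

lemma floor_mesh:
  assumes "t \<ge> 0"
  shows "real (nat \<lfloor>t / mesh n\<rfloor>) * mesh n \<le> t" "t < real (nat \<lfloor>t / mesh n\<rfloor>) * mesh n + mesh n"
proof -
  have "real (nat \<lfloor>t / mesh n\<rfloor>) = of_int \<lfloor>t / mesh n\<rfloor>" using assms mesh[of n] by simp
  then have "real (nat \<lfloor>t / mesh n\<rfloor>) \<le> t / mesh n" "t / mesh n < real (nat \<lfloor>t / mesh n\<rfloor>) + 1" by linarith+
  then show "real (nat \<lfloor>t / mesh n\<rfloor>) * mesh n \<le> t" "t < real (nat \<lfloor>t / mesh n\<rfloor>) * mesh n + mesh n"
    using mesh(1)[of n] by (auto simp: field_simps)
qed

lemma euler_path_close: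
  assumes u0: "u0 \<in> D" and nm: "n \<le> m" and t: "t \<ge> 0" and i: "i \<in> V"
  shows "\<bar>euler_path u0 m t i - euler_path u0 n t i\<bar> \<le> mesh n * M + sqrt (8 * t * mesh n * M\<^sup>2 * card V)"
proof -
  define N :: nat where "N = 2 ^ (m - n)"
  define l where "l = nat \<lfloor>t / mesh m\<rfloor>"
  have N: "N > 0" by (simp add: N_def)
  have hN: "mesh n = real N * mesh m"
  proof -
    have "real N = (2 :: real) ^ (m - n)" by (simp add: N_def)
    also have "\<dots> = 2 ^ m / 2 ^ n" using nm by (simp add: power_diff)
    finally show ?thesis by (simp add: mesh_def)
  qed
  \<comment> \<open>Rounding t to the coarse grid is integer division of its fine grid index by
    \<open>N\<close>.\<close>
  have "\<lfloor>t / mesh n\<rfloor> = \<lfloor>t / mesh m / real_of_int (int N)\<rfloor>" using mesh[of m] N by (simp add: hN mult.commute)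
  also have "\<dots> = \<lfloor>t / mesh m\<rfloor> div int N" by (rule floor_divide_real_eq_div) simp
  finally have ldiv: "nat \<lfloor>t / mesh n\<rfloor> = l div N"
    using t mesh(1)[of m] by (simp add: l_def nat_div_distrib)
  define x where "x = euler F (mesh n) u0 (l div N)"
  define y where "y = euler F (mesh m) u0 l"
  define r where "r = real (l mod N) * mesh m"
  have "real (l mod N) \<le> real N" using N by (simp add: less_imp_le)
  then have r: "0 \<le> r" "r \<le> mesh n" using mesh[of m] by (auto simp: r_def hN)
  have "x \<in> D" unfolding x_def using u0 mesh[of n] by (intro euler_in) auto
  have "(x i + r * F x i - y i)\<^sup>2 \<le> (\<Sum>i\<in>V. (x i + r * F x i - y i)\<^sup>2)"
    using i fin by (intro member_le_sum) auto
  also have "\<dots> \<le> 8 * (real l * mesh m) * mesh n * M\<^sup>2 * card V"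
    using euler_refine[OF u0 mesh(1) N hN mesh(2), of l] by (simp add: x_def y_def r_def)
  also have "\<dots> \<le> 8 * t * mesh n * M\<^sup>2 * card V"
    using floor_mesh(1)[OF t, of m] mesh[of n] by (intro mult_right_mono mult_left_mono) (auto simp: l_def)
  finally have "\<bar>x i + r * F x i - y i\<bar> \<le> sqrt (8 * t * mesh n * M\<^sup>2 * card V)"
    by (metis real_sqrt_abs real_sqrt_le_iff)
  moreover have "\<bar>r * F x i\<bar> \<le> mesh n * M"
    unfolding abs_mult using r bound[OF \<open>x \<in> D\<close> i] by (intro mult_mono) auto
  ultimately have "\<bar>y i - x i\<bar> \<le> mesh n * M + sqrt (8 * t * mesh n * M\<^sup>2 * card V)" by linarith
  then show ?thesis by (simp add: euler_path_def ldiv x_def y_def l_def[symmetric])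
qed

definition flow :: "('i \<Rightarrow> real) \<Rightarrow> real \<Rightarrow> 'i \<Rightarrow> real" where
  "flow u0 t i = lim (\<lambda>n. euler_path u0 n t i)"

lemma euler_path_tendsto:
  assumes u0: "u0 \<in> D" and t: "t \<ge> 0" and i: "i \<in> V"
  shows "(\<lambda>n. euler_path u0 n t i) \<longlonglongrightarrow> flow u0 t i"
proof -
  define E where "E n = mesh n * M + sqrt (8 * t * mesh n * M\<^sup>2 * card V)" for n
  have "E \<longlonglongrightarrow> 0 * M + sqrt (8 * t * 0 * M\<^sup>2 * card V)"
    unfolding E_def by (intro tendsto_intros mesh_tendsto)
  then have E: "E \<longlonglongrightarrow> 0" by simp
  have "Cauchy (\<lambda>n. euler_path u0 n t i)"
  proof (rule metric_CauchyI)
    fix e :: real assume "e > 0"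
    then have "\<forall>\<^sub>F n in sequentially. E n < e / 2" by (intro order_tendstoD(2)[OF E]) simp
    then obtain n where n: "E n < e / 2" by (meson eventually_sequentially order_refl)
    have "dist (euler_path u0 m t i) (euler_path u0 n t i) < e / 2" if "n \<le> m" for m
      using euler_path_close[OF u0 that t i] n by (simp add: dist_real_def E_def)
    then have "\<forall>m\<ge>n. \<forall>m'\<ge>n. dist (euler_path u0 m t i) (euler_path u0 m' t i) < e"
      by (meson dist_triangle_half_l)
    then show "\<exists>n. \<forall>m\<ge>n. \<forall>m'\<ge>n. dist (euler_path u0 m t i) (euler_path u0 m' t i) < e" by blast
  qed
  then show ?thesis unfolding flow_def by (simp add: Cauchy_convergent_iff convergent_LIMSEQ_iff)
qed

lemma flow_in: "u0 \<in> D \<Longrightarrow> t \<ge> 0 \<Longrightarrow> flow u0 t \<in> D"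
  by (rule lim_closed[of "\<lambda>n. euler_path u0 n t"]) (auto intro: euler_path_in euler_path_tendsto)

lemma flow_0: "u0 \<in> D \<Longrightarrow> flow u0 0 i = u0 i"
  by (simp add: flow_def euler_path_def)

text \<open>Euler points move with speed at most \<open>M\<close>, so at times near t they lie close
  to the flow at t, where \<open>F\<close> is nearly constant. Adding up the steps from a to b and
  refining the mesh yields the estimate without an integral equation for the limit.\<close>

lemma flow_increment:
  assumes u0: "u0 \<in> D" and t: "t \<ge> 0" and e: "e > 0"
  shows "\<exists>d>0. \<forall>a b i. i \<in> V \<longrightarrow> 0 \<le> a \<longrightarrow> a \<le> b \<longrightarrow> \<bar>a - t\<bar> < d \<longrightarrow> \<bar>b - t\<bar> < d \<longrightarrow>
     \<bar>flow u0 b i - flow u0 a i - (b - a) * F (flow u0 t) i\<bar> \<le> (b - a) * e"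
proof -
  obtain r where r: "r > 0" and near: "\<And>w i. w \<in> D \<Longrightarrow> (\<And>i. i \<in> V \<Longrightarrow> \<bar>w i - flow u0 t i\<bar> < r) \<Longrightarrow> i \<in> V \<Longrightarrow>
      \<bar>F w i - F (flow u0 t) i\<bar> < e"
    using cont[OF flow_in[OF u0 t] e] by blast
  \<comment> \<open>Rounding a and b costs one mesh, which will be below \<open>d\<close>, and
    \<open>lip\<close> costs another; Euler points between them then stay within
    \<open>4 * (M * d)\<close> of the path at t. The \<open>M + 1\<close> avoids division by
    zero.\<close>
  define d where "d = r / (4 * (M + 1))"
  have d: "d > 0" "4 * (M * d) < r" using r M by (auto simp: d_def field_simps)
  show ?thesis
  proof (intro exI[of _ d] conjI d(1) allI impI)
    fix a b i assume i: "i \<in> V" and ab: "0 \<le> a" "a \<le> b" "\<bar>a - t\<bar> < d" "\<bar>b - t\<bar> < d"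
    define ja where "ja n = nat \<lfloor>a / mesh n\<rfloor>" for n
    define jb where "jb n = nat \<lfloor>b / mesh n\<rfloor>" for n
    define c where "c = F (flow u0 t) i"
    have jab: "ja n \<le> jb n" for n
      using ab mesh(1)[of n] by (auto simp: ja_def jb_def intro!: nat_mono floor_mono divide_right_mono)
    have lip: "\<bar>euler F (mesh n) u0 l i - euler_path u0 n t i\<bar> \<le> M * (\<bar>real l * mesh n - t\<bar> + mesh n)"
      if i: "i \<in> V" for n l i
    proof -
      define j where "j = nat \<lfloor>t / mesh n\<rfloor>"
      have bd: "\<bar>F (euler F (mesh n) u0 k) i - 0\<bar> \<le> M" for k
        using bound[OF euler_in[OF u0] i] mesh[of n] by simp
      have jt: "\<bar>real j * mesh n - t\<bar> \<le> mesh n" using floor_mesh[OF t, of n] by (auto simp: j_def)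
      have "\<bar>euler F (mesh n) u0 l i - euler F (mesh n) u0 j i\<bar> \<le> \<bar>real l - real j\<bar> * mesh n * M"
      proof (cases "j \<le> l")
        case True
        then show ?thesis using euler_increment[of j "l - j" F "mesh n" u0 i 0 M] bd mesh(1)[of n] by simp
      next
        case False
        then show ?thesis using euler_increment[of l "j - l" F "mesh n" u0 i 0 M] bd mesh(1)[of n]
          by (simp add: abs_minus_commute)
      qed
      also have "\<bar>real l - real j\<bar> * mesh n = \<bar>real l * mesh n - real j * mesh n\<bar>"
        using mesh(1)[of n] by (simp add: abs_mult flip: left_diff_distrib)
      also have "\<dots> * M \<le> (\<bar>real l * mesh n - t\<bar> + mesh n) * M" using jt M by (intro mult_right_mono) linarith+
      finally show ?thesis by (simp add: euler_path_def j_def mult.commute)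
    qed
    have "\<forall>\<^sub>F n in sequentially. mesh n < d" by (rule order_tendstoD(2)[OF mesh_tendsto d(1)])
    moreover have "\<forall>\<^sub>F n in sequentially. \<forall>i\<in>V. \<bar>euler_path u0 n t i - flow u0 t i\<bar> < r - 4 * (M * d)"
    proof (rule eventually_ball_finite[OF fin], rule ballI)
      fix i assume "i \<in> V"
      from tendstoD[OF euler_path_tendsto[OF u0 t this], of "r - 4 * (M * d)"] d(2)
      show "\<forall>\<^sub>F n in sequentially. \<bar>euler_path u0 n t i - flow u0 t i\<bar> < r - 4 * (M * d)"
        by (simp add: dist_real_def)
    qed
    ultimately have ev: "\<forall>\<^sub>F n in sequentially.
       \<bar>euler_path u0 n b i - euler_path u0 n a i - real (jb n - ja n) * mesh n * c\<bar> \<le> real (jb n - ja n) * mesh n * e"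
    proof eventually_elim
      case (elim n)
      have "\<bar>F (euler F (mesh n) u0 l) i - c\<bar> \<le> e" if l: "ja n \<le> l" "l < jb n" for l
        unfolding c_def
      proof (rule less_imp_le[OF near[OF _ _ i]])
        show "euler F (mesh n) u0 l \<in> D" using mesh[of n] u0 by (intro euler_in) auto
        fix i assume i: "i \<in> V"
        have "real (ja n) * mesh n \<le> real l * mesh n" "real l * mesh n \<le> real (jb n) * mesh n"
          using l mesh(1)[of n] by auto
        then have "\<bar>real l * mesh n - t\<bar> < 3 * d - mesh n"
          using floor_mesh[OF ab(1), of n] floor_mesh(1)[of b n] ab elim(1) unfolding ja_def jb_def by linarith
        then have "M * (\<bar>real l * mesh n - t\<bar> + mesh n) \<le> M * (4 * d)" using M d by (intro mult_left_mono) auto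
        then show "\<bar>euler F (mesh n) u0 l i - flow u0 t i\<bar> < r"
          using lip[OF i, of n l] elim(2) i by force
      qed
      then show ?case
        using euler_increment[of "ja n" "jb n - ja n" F "mesh n" u0 i c e] jab[of n] mesh(1)[of n]
        by (simp add: euler_path_def ja_def[symmetric] jb_def[symmetric])
    qed
    have len: "(\<lambda>n. real (jb n - ja n) * mesh n) \<longlonglongrightarrow> b - a"
    proof (rule LIM_zero_cancel, rule tendsto_rabs_zero_cancel, rule tendsto_sandwich[of "\<lambda>_. 0" _ _ "\<lambda>n. 2 * mesh n"])
      show "(\<lambda>n. 2 * mesh n) \<longlonglongrightarrow> 0" using tendsto_mult_left[OF mesh_tendsto, of 2] by simp
      show "\<forall>\<^sub>F n in sequentially. \<bar>real (jb n - ja n) * mesh n - (b - a)\<bar> \<le> 2 * mesh n"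
      proof (rule always_eventually, rule allI)
        fix n
        have "real (jb n - ja n) * mesh n = real (jb n) * mesh n - real (ja n) * mesh n"
          using jab[of n] by (simp add: of_nat_diff left_diff_distrib)
        then show "\<bar>real (jb n - ja n) * mesh n - (b - a)\<bar> \<le> 2 * mesh n"
          using floor_mesh[OF ab(1), of n] floor_mesh[of b n] ab unfolding ja_def jb_def by linarith
      qed
    qed auto
    show "\<bar>flow u0 b i - flow u0 a i - (b - a) * F (flow u0 t) i\<bar> \<le> (b - a) * e"
    proof (rule tendsto_le[OF _ _ _ ev])
      show "(\<lambda>n. real (jb n - ja n) * mesh n * e) \<longlonglongrightarrow> (b - a) * e" by (intro tendsto_intros len)
      show "(\<lambda>n. \<bar>euler_path u0 n b i - euler_path u0 n a i - real (jb n - ja n) * mesh n * c\<bar>)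
        \<longlonglongrightarrow> \<bar>flow u0 b i - flow u0 a i - (b - a) * F (flow u0 t) i\<bar>"
        unfolding c_def[symmetric] using ab i u0 by (intro tendsto_intros len euler_path_tendsto) auto
    qed simp
  qed
qed

lemma flow_has_derivative:
  assumes u0: "u0 \<in> D" and t: "t \<ge> 0" and i: "i \<in> V"
  shows "((\<lambda>s. flow u0 s i) has_real_derivative F (flow u0 t) i) (at t within {0..})"
  unfolding has_field_derivative_def has_derivative_within_alt
proof (intro conjI allI impI)
  show "bounded_linear ((*) (F (flow u0 t) i))" by (rule bounded_linear_mult_right)
  fix e :: real assume "e > 0"
  from flow_increment[OF u0 t this] obtain d where d: "d > 0" and inc: "\<And>a b. 0 \<le> a \<Longrightarrow> a \<le> b \<Longrightarrow>
     \<bar>a - t\<bar> < d \<Longrightarrow> \<bar>b - t\<bar> < d \<Longrightarrow> \<bar>flow u0 b i - flow u0 a i - (b - a) * F (flow u0 t) i\<bar> \<le> (b - a) * e"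
    using i by blast
  show "\<exists>d>0. \<forall>s\<in>{0..}. norm (s - t) < d \<longrightarrow>
      norm (flow u0 s i - flow u0 t i - F (flow u0 t) i * (s - t)) \<le> e * norm (s - t)"
  proof (intro exI[of _ d] conjI d ballI impI)
    fix s :: real assume s: "s \<in> {0..}" "norm (s - t) < d"
    show "norm (flow u0 s i - flow u0 t i - F (flow u0 t) i * (s - t)) \<le> e * norm (s - t)"
    proof (cases "s \<le> t")
      case True
      have "flow u0 s i - flow u0 t i - F (flow u0 t) i * (s - t) = - (flow u0 t i - flow u0 s i - (t - s) * F (flow u0 t) i)"
        by (simp add: algebra_simps)
      then show ?thesis using inc[of s t] s True d by (simp add: mult.commute)
    next
      case False
      then show ?thesis using inc[of t s] s d t by (simp add: mult.commute)
    qed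
  qed
qed

end

section \<open>Weighted closed surfaces\<close>

lemma tri_det_pos_open:
  assumes st: "structure_triple e1 e2 e3 n12 n13 n23"
    and x: "x1 \<in> u_domain G e1" "x2 \<in> u_domain G e2" "x3 \<in> u_domain G e3"
    and det: "tri_det G e1 e2 e3 n12 n13 n23 x1 x2 x3 > 0"
  shows "\<exists>\<delta>>0. \<forall>y1 y2 y3. \<bar>y1 - x1\<bar> < \<delta> \<longrightarrow> \<bar>y2 - x2\<bar> < \<delta> \<longrightarrow> \<bar>y3 - x3\<bar> < \<delta> \<longrightarrow>
    tri_det G e1 e2 e3 n12 n13 n23 y1 y2 y3 > 0"
proof -
  have e: "e1 \<in> {0, 1}" "e2 \<in> {0, 1}" "e3 \<in> {0, 1}" using st by (auto simp: structure_triple_def)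
  define p where "p = (x1, x2, x3)"
  have d: "(fst has_derivative fst) (at p)" "((\<lambda>q. fst (snd q)) has_derivative (\<lambda>q. fst (snd q))) (at p)"
    "((\<lambda>q. snd (snd q)) has_derivative (\<lambda>q. snd (snd q))) (at p)"
    by (auto intro!: derivative_eq_intros)
  have xp: "fst p \<in> u_domain G e1" "fst (snd p) \<in> u_domain G e2" "snd (snd p) \<in> u_domain G e3"
    using x by (simp_all add: p_def)
  define T where "T q = tri_det G e1 e2 e3 n12 n13 n23 (fst q) (fst (snd q)) (snd (snd q))" for q
  have "isCont T p"
    using has_derivative_continuous[OF has_derivative_quantity[OF d(2,3) xp(2,3) e(2,3), of n23]]
      has_derivative_continuous[OF has_derivative_quantity[OF d(1,2) xp(1,2) e(1,2), of n12]]
      has_derivative_continuous[OF has_derivative_quantity[OF d(1,3) xp(1,3) e(1,3), of n13]]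
    unfolding T_def[abs_def] tri_det_def
    by (cases G) (auto simp: hyp_det_def intro!: continuous_intros)
  moreover have "T p > 0" using det by (simp add: T_def p_def)
  ultimately obtain d where "d > 0" and d: "\<And>q. dist q p < d \<Longrightarrow> dist (T q) (T p) < T p"
    unfolding continuous_at_eps_delta by blast
  show ?thesis
  proof (intro exI[of _ "d / 3"] conjI allI impI)
    fix y1 y2 y3 assume y: "\<bar>y1 - x1\<bar> < d / 3" "\<bar>y2 - x2\<bar> < d / 3" "\<bar>y3 - x3\<bar> < d / 3"
    have "dist (y1, y2, y3) p < d"
      unfolding dist_norm p_def using norm_triple_le[of "y1 - x1" "y2 - x2" "y3 - x3"] y by simp
    from d[OF this] have "T (y1, y2, y3) > 0" by (simp add: dist_real_def)
    then show "tri_det G e1 e2 e3 n12 n13 n23 y1 y2 y3 > 0" by (simp add: T_def)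
  qed (use \<open>d > 0\<close> in simp)
qed

text \<open>Makes constants found for single faces, corners or vertices uniform, for properties that
  survive a decrease of the constant.\<close>

lemma finite_common_bound:
  assumes "finite A" and ex: "\<And>a. a \<in> A \<Longrightarrow> \<exists>d>0::real. P a d"
    and mono: "\<And>a d d'. a \<in> A \<Longrightarrow> P a d \<Longrightarrow> 0 < d' \<Longrightarrow> d' \<le> d \<Longrightarrow> P a d'"
  shows "\<exists>d>0. \<forall>a\<in>A. P a d"
proof -
  from ex have "\<forall>a\<in>A. \<exists>d>0. P a d" by blast
  then obtain f where f: "\<And>a. a \<in> A \<Longrightarrow> f a > 0 \<and> P a (f a)" by metis
  \<comment> \<open>The inserted 1 gives the minimum a meaning when \<open>A\<close> is
    empty.\<close>
  define d where "d = Min (insert 1 (f ` A))"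
  have "d > 0" "\<And>a. a \<in> A \<Longrightarrow> d \<le> f a" unfolding d_def using assms(1) f by auto
  then show ?thesis using f mono by blast
qed

locale weighted_closed_surface =
  fixes S :: "'a weighted_surface"
  assumes surf: "triangulated_closed_surface S"
    and conn: "connected_surface S"
    and weights: "\<forall>i\<in>vertices S. vweight S i \<in> {0, 1}"
    and struct: "structure_conditions S"
begin

lemma finite_faces: "finite (faces S)" and faces_ne: "faces S \<noteq> {}"
  and glue_in: "d \<in> osides S \<Longrightarrow> glue S d \<in> osides S"
  and glue_glue: "d \<in> osides S \<Longrightarrow> glue S (glue S d) = d"
  and glue_flip: "d \<in> osides S \<Longrightarrow> glue S (flip d) = flip (glue S d)"
  and glue_ne: "d \<in> osides S \<Longrightarrow> glue S d \<noteq> d" "d \<in> osides S \<Longrightarrow> glue S d \<noteq> flip d"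
  using surf unfolding triangulated_closed_surface_def by auto

lemma flip_flip: "flip (flip d) = d"
  by (cases d) auto

lemma flip_in: "d \<in> osides S \<Longrightarrow> flip d \<in> osides S"
  by (cases d) (auto simp: osides_def)

lemma tail_in: "d \<in> osides S \<Longrightarrow> tail d \<in> corners S"
  by (cases d) (auto simp: osides_def corners_def)

lemma finite_corners: "finite (corners S)"
  using finite_faces by (simp add: corners_def)

lemma equiv_rtrancl_on:
  assumes "\<And>x y. (x, y) \<in> R \<Longrightarrow> (y, x) \<in> R"
  shows "equiv A (R\<^sup>* \<inter> A \<times> A)"
proof (rule equivI)
  show "R\<^sup>* \<inter> A \<times> A \<subseteq> A \<times> A" by blast
  show "refl_on A (R\<^sup>* \<inter> A \<times> A)" by (auto simp: refl_on_def)
  have "sym R" using assms by (auto simp: sym_def)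
  then have "sym (R\<^sup>*)" by (rule sym_rtrancl)
  then show "sym (R\<^sup>* \<inter> A \<times> A)" by (auto simp: sym_def)
  show "trans (R\<^sup>* \<inter> A \<times> A)" by (auto intro!: transI)
qed

lemma equiv_vertex_rel: "equiv (corners S) (vertex_rel S)"
  unfolding vertex_rel_def
proof (rule equiv_rtrancl_on)
  fix x y assume "(x, y) \<in> (\<lambda>d. (tail d, tail (glue S d))) ` osides S"
  then obtain d where "d \<in> osides S" "x = tail d" "y = tail (glue S d)" by auto
  then show "(y, x) \<in> (\<lambda>d. (tail d, tail (glue S d))) ` osides S"
    using glue_in glue_glue by (intro image_eqI[of _ _ "glue S d"]) auto
qed

lemma equiv_edge_rel: "equiv (osides S) (edge_rel S)"
  unfolding edge_rel_def
proof (rule equiv_rtrancl_on)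
  fix x y assume "(x, y) \<in> (\<lambda>d. (d, glue S d)) ` osides S \<union> (\<lambda>d. (d, flip d)) ` osides S"
  then consider d where "d \<in> osides S" "x = d" "y = glue S d" | d where "d \<in> osides S" "x = d" "y = flip d"
    by auto
  then show "(y, x) \<in> (\<lambda>d. (d, glue S d)) ` osides S \<union> (\<lambda>d. (d, flip d)) ` osides S"
  proof cases
    case 1
    then show ?thesis by (intro UnI1 image_eqI[of _ _ y]) (auto simp: glue_in glue_glue)
  next
    case 2
    then show ?thesis by (intro UnI2 image_eqI[of _ _ y]) (auto simp: flip_in flip_flip)
  qed
qed

lemma finite_vertices: "finite (vertices S)"
  unfolding vertices_def by (intro finite_quotient finite_corners) (auto simp: vertex_rel_def)

lemma vertex_class_in: "c \<in> corners S \<Longrightarrow> vertex_class S c \<in> vertices S"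
  unfolding vertex_class_def vertices_def by (rule quotientI)

lemma vertex_subset: "v \<in> vertices S \<Longrightarrow> v \<subseteq> corners S"
  using equiv_vertex_rel unfolding vertices_def by (metis Union_quotient Union_upper)

lemma vertex_class_eq: "v \<in> vertices S \<Longrightarrow> c \<in> v \<Longrightarrow> vertex_class S c = v"
  unfolding vertices_def vertex_class_def
  by (metis Image_singleton_iff equiv_class_eq equiv_vertex_rel quotientE)

lemma finite_vertex: "v \<in> vertices S \<Longrightarrow> finite v"
  using vertex_subset finite_corners finite_subset by blast

lemma vertex_ne: "v \<in> vertices S \<Longrightarrow> v \<noteq> {}"
  unfolding vertices_def using equiv_vertex_rel in_quotient_imp_non_empty by blast

definition cl :: "'a \<Rightarrow> nat \<Rightarrow> 'a corner set" where "cl t i = vertex_class S (t, i)"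

definition ew :: "'a \<Rightarrow> nat \<Rightarrow> nat \<Rightarrow> real" where "ew t i j = eweight S (edge_class S (t, i, j))"

abbreviation vw :: "'a \<Rightarrow> nat \<Rightarrow> real" where "vw t i \<equiv> vweight S (cl t i)"

lemma cl_in: "t \<in> faces S \<Longrightarrow> i < 3 \<Longrightarrow> cl t i \<in> vertices S"
  unfolding cl_def by (rule vertex_class_in) (simp add: corners_def)

lemma vertex_is_cl: "v \<in> vertices S \<Longrightarrow> \<exists>t\<in>faces S. \<exists>i<3. v = cl t i"
proof -
  assume v: "v \<in> vertices S"
  then obtain c where c: "c \<in> v" using vertex_ne by blast
  then have "c \<in> corners S" using vertex_subset v by blast
  then show ?thesis using vertex_class_eq[OF v c] unfolding cl_def corners_def by force
qed

lemma vertices_ne: "vertices S \<noteq> {}"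
  using faces_ne cl_in[of _ 0] by auto

text \<open>Each corner lies in exactly one vertex and one face, so sums over corners regroup from
  vertices to faces. The summand sees the vertex too, since a vertex coordinate gets paired with the
  angles at its corners.\<close>

lemma vertex_sum:
  fixes g :: "'a corner set \<Rightarrow> 'a corner \<Rightarrow> real"
  shows "(\<Sum>v\<in>vertices S. \<Sum>c\<in>v. g v c) =
    (\<Sum>t\<in>faces S. g (cl t 0) (t, 0) + g (cl t 1) (t, 1) + g (cl t 2) (t, 2))"
proof -
  have "(\<Sum>v\<in>vertices S. \<Sum>c\<in>v. g v c) = (\<Sum>v\<in>vertices S. \<Sum>c\<in>v. g (vertex_class S c) c)"
    by (intro sum.cong refl) (simp add: vertex_class_eq)
  also have "\<dots> = (\<Sum>c\<in>\<Union>(vertices S). g (vertex_class S c) c)"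
  proof (subst sum.Union_disjoint)
    show "\<forall>A\<in>vertices S. finite A" using finite_vertex by blast
    show "\<forall>A\<in>vertices S. \<forall>B\<in>vertices S. A \<noteq> B \<longrightarrow> A \<inter> B = {}"
      using vertex_class_eq by (metis disjoint_iff)
  qed simp
  also have "\<Union>(vertices S) = corners S"
    unfolding vertices_def by (rule Union_quotient[OF equiv_vertex_rel])
  also have "(\<Sum>c\<in>corners S. g (vertex_class S c) c) = (\<Sum>t\<in>faces S. \<Sum>i<3. g (cl t i) (t, i))"
    unfolding corners_def cl_def by (simp add: sum.cartesian_product case_prod_unfold)
  also have "\<dots> = (\<Sum>t\<in>faces S. g (cl t 0) (t, 0) + g (cl t 1) (t, 1) + g (cl t 2) (t, 2))"
    by (simp add: numeral_3_eq_3 numeral_2_eq_2)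
  finally show ?thesis .
qed

lemma ew_commute:
  assumes "t \<in> faces S" "i < 3" "j < 3" "i \<noteq> j"
  shows "ew t i j = ew t j i"
proof -
  have d: "(t, i, j) \<in> osides S" "(t, j, i) \<in> osides S" using assms by (auto simp: osides_def)
  have "((t, i, j), flip (t, i, j)) \<in> (\<lambda>d. (d, flip d)) ` osides S" using d by blast
  then have "((t, i, j), (t, j, i)) \<in> edge_rel S"
    unfolding edge_rel_def using d by (auto intro: r_into_rtrancl)
  then have "edge_class S (t, i, j) = edge_class S (t, j, i)"
    unfolding edge_class_def by (rule equiv_class_eq[OF equiv_edge_rel])
  then show ?thesis by (simp add: ew_def)
qed

lemma structure_corner:
  assumes t: "t \<in> faces S" and i: "i < 3"
  shows "structure_triple (vw t i) (vw t ((i + 1) mod 3)) (vw t ((i + 2) mod 3))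
    (ew t i ((i + 1) mod 3)) (ew t i ((i + 2) mod 3)) (ew t ((i + 1) mod 3) ((i + 2) mod 3))"
proof -
  have w: "vw t l \<in> {0, 1}" if "l < 3" for l using weights cl_in[OF t that] by blast
  have p: "vw t a * vw t b + ew t a b > 0" if "a < 3" "b < 3" "a \<noteq> b" for a b
  proof -
    have "(t, a, b) \<in> osides S" using t that by (simp add: osides_def)
    moreover have "\<And>d. d \<in> osides S \<Longrightarrow> vweight S (vertex_class S (tail d)) * vweight S (vertex_class S (tail (flip d)))
        + eweight S (edge_class S d) > 0"
      using struct unfolding structure_conditions_def by blast
    ultimately show ?thesis unfolding cl_def ew_def by fastforce
  qed
  have q: "vw t a * ew t b c + ew t a b * ew t a c \<ge> 0" if "{a, b, c} = {0, 1, 2}" for a b c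
    using struct t that unfolding structure_conditions_def cl_def ew_def by blast
  have main: "structure_triple (vw t i) (vw t j) (vw t k) (ew t i j) (ew t i k) (ew t j k)"
    if lt: "i < 3" "j < 3" "k < 3" and ne: "i \<noteq> j" "i \<noteq> k" "j \<noteq> k"
      and ijk: "{i, j, k} = {0, 1, 2}" "{j, i, k} = {0, 1, 2}" "{k, i, j} = {0, 1, 2}" for i j k
    unfolding structure_triple_def
    using w[OF lt(1)] w[OF lt(2)] w[OF lt(3)] p[OF lt(1,2) ne(1)] p[OF lt(1,3) ne(2)] p[OF lt(2,3) ne(3)]
      q[OF ijk(1)] q[OF ijk(2)] q[OF ijk(3)]
    unfolding ew_commute[OF t lt(2,1) ne(1)[symmetric]] ew_commute[OF t lt(3,1) ne(2)[symmetric]]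
      ew_commute[OF t lt(3,2) ne(3)[symmetric]]
    by (simp add: mult.commute)
  have "i = 0 \<or> i = 1 \<or> i = 2" using i by auto
  then show ?thesis by (elim disjE; hypsubst; intro main) auto
qed

definition angle :: "geometry \<Rightarrow> ('a corner set \<Rightarrow> real) \<Rightarrow> 'a corner \<Rightarrow> real" where
  "angle G u c = at_corner (ext_angle G) G S (f_of_u G S u) c"

lemma angle_eq: "angle G u (t, i) = tri_angle G (vw t i) (vw t ((i + 1) mod 3)) (vw t ((i + 2) mod 3))
    (ew t i ((i + 1) mod 3)) (ew t i ((i + 2) mod 3)) (ew t ((i + 1) mod 3) ((i + 2) mod 3))
    (u (cl t i)) (u (cl t ((i + 1) mod 3))) (u (cl t ((i + 2) mod 3)))"
  by (simp add: angle_def at_corner_def side_length_def f_of_u_def tri_angle_def cl_def ew_def Let_def)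

text \<open>Edge weights are brought to increasing indices, in the order that repeated use of
  \<open>structure_triple_rotate\<close> produces.\<close>

lemma angle_eqs:
  assumes t: "t \<in> faces S"
  shows "angle G u (t, 0) = tri_angle G (vw t 0) (vw t 1) (vw t 2) (ew t 0 1) (ew t 0 2) (ew t 1 2)
      (u (cl t 0)) (u (cl t 1)) (u (cl t 2))"
    "angle G u (t, 1) = tri_angle G (vw t 1) (vw t 2) (vw t 0) (ew t 1 2) (ew t 0 1) (ew t 0 2)
      (u (cl t 1)) (u (cl t 2)) (u (cl t 0))"
    "angle G u (t, 2) = tri_angle G (vw t 2) (vw t 0) (vw t 1) (ew t 0 2) (ew t 1 2) (ew t 0 1)
      (u (cl t 2)) (u (cl t 0)) (u (cl t 1))"
proof -
  have m: "(0 + 1) mod 3 = (1 :: nat)" "(0 + 2) mod 3 = (2 :: nat)" "(1 + 1) mod 3 = (2 :: nat)"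
    "(1 + 2) mod 3 = (0 :: nat)" "(2 + 1) mod 3 = (0 :: nat)" "(2 + 2) mod 3 = (1 :: nat)" by simp_all
  have c: "ew t 1 0 = ew t 0 1" "ew t 2 0 = ew t 0 2" "ew t 2 1 = ew t 1 2"
    by (rule ew_commute[OF t]; simp)+
  show "angle G u (t, 0) = tri_angle G (vw t 0) (vw t 1) (vw t 2) (ew t 0 1) (ew t 0 2) (ew t 1 2)
      (u (cl t 0)) (u (cl t 1)) (u (cl t 2))"
    "angle G u (t, 1) = tri_angle G (vw t 1) (vw t 2) (vw t 0) (ew t 1 2) (ew t 0 1) (ew t 0 2)
      (u (cl t 1)) (u (cl t 2)) (u (cl t 0))"
    "angle G u (t, 2) = tri_angle G (vw t 2) (vw t 0) (vw t 1) (ew t 0 2) (ew t 1 2) (ew t 0 1)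
      (u (cl t 2)) (u (cl t 0)) (u (cl t 1))"
    by (simp_all only: angle_eq m c)
qed

lemma structure_face_012: "t \<in> faces S \<Longrightarrow> structure_triple (vw t 0) (vw t 1) (vw t 2) (ew t 0 1) (ew t 0 2) (ew t 1 2)"
  using structure_corner[of t 0] by (simp add: numeral_2_eq_2)

lemma phase_domain: "u \<in> phase_space G S \<Longrightarrow> v \<in> vertices S \<Longrightarrow> u v \<in> u_domain G (vweight S v)"
  by (auto simp: phase_space_def u_domain_def)

lemma phase_domain_cl: "u \<in> phase_space G S \<Longrightarrow> t \<in> faces S \<Longrightarrow> i < 3 \<Longrightarrow> u (cl t i) \<in> u_domain G (vw t i)"
  by (rule phase_domain[OF _ cl_in])

lemma angle_bounds:
  assumes "u \<in> phase_space G S" "t \<in> faces S" "i < 3"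
  shows "0 \<le> angle G u (t, i)" "angle G u (t, i) \<le> pi"
  unfolding angle_eq using tri_angle_bounds[OF structure_corner[OF assms(2,3)]] phase_domain_cl[OF assms(1,2)] assms(3)
  by auto

definition field :: "geometry \<Rightarrow> ('a corner set \<Rightarrow> real) \<Rightarrow> 'a corner set \<Rightarrow> real" where
  "field G u v = target_curvature G S - ext_curvature G S (f_of_u G S u) v"

lemma field_eq: "field G u v = target_curvature G S - 2 * pi + (\<Sum>c\<in>v. angle G u c)"
  by (simp add: field_def ext_curvature_def angle_def)

definition face_pairing :: "geometry \<Rightarrow> ('a corner set \<Rightarrow> real) \<Rightarrow> ('a corner set \<Rightarrow> real) \<Rightarrow> 'a \<Rightarrow> real" where
  "face_pairing G u w t = (u (cl t 0) - w (cl t 0)) * (angle G u (t, 0) - angle G w (t, 0))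
     + (u (cl t 1) - w (cl t 1)) * (angle G u (t, 1) - angle G w (t, 1))
     + (u (cl t 2) - w (cl t 2)) * (angle G u (t, 2) - angle G w (t, 2))"

text \<open>The target curvature and 2 pi cancel in the difference of two fields; what remains are
  angles, which regroup by faces.\<close>

lemma field_pairing:
  "(\<Sum>v\<in>vertices S. (u v - w v) * (field G u v - field G w v)) = (\<Sum>t\<in>faces S. face_pairing G u w t)"
proof -
  have "(\<Sum>v\<in>vertices S. (u v - w v) * (field G u v - field G w v))
    = (\<Sum>v\<in>vertices S. \<Sum>c\<in>v. (u v - w v) * (angle G u c - angle G w c))"
    by (simp add: field_eq sum_distrib_left[symmetric] sum_subtractf)
  also have "\<dots> = (\<Sum>t\<in>faces S. face_pairing G u w t)"
    unfolding vertex_sum face_pairing_def ..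
  finally show ?thesis .
qed

lemma face_pairing_nonpos:
  assumes "u \<in> phase_space G S" "w \<in> phase_space G S" "t \<in> faces S"
  shows "face_pairing G u w t \<le> 0"
  unfolding face_pairing_def angle_eqs[OF assms(3)]
  using phase_domain_cl[OF assms(1,3)] phase_domain_cl[OF assms(2,3)]
  by (intro tri_angles_monotone structure_face_012 assms) auto

lemma field_monotone:
  assumes "u \<in> phase_space G S" "w \<in> phase_space G S"
  shows "(\<Sum>v\<in>vertices S. (u v - w v) * (field G u v - field G w v)) \<le> 0"
  unfolding field_pairing by (intro sum_nonpos face_pairing_nonpos assms)

lemma field_bound:
  assumes "u \<in> phase_space G S" "v \<in> vertices S"
  shows "\<bar>field G u v\<bar> \<le> \<bar>target_curvature G S\<bar> + 2 * pi + pi * card (corners S)"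
proof -
  have a: "0 \<le> angle G u c \<and> angle G u c \<le> pi" if "c \<in> v" for c
    using that vertex_subset[OF assms(2)] angle_bounds[OF assms(1)] by (cases c) (auto simp: corners_def)
  then have "0 \<le> (\<Sum>c\<in>v. angle G u c)" by (intro sum_nonneg) auto
  moreover have "(\<Sum>c\<in>v. angle G u c) \<le> pi * card v" using sum_bounded_above[of v "angle G u" pi] a by (simp add: mult.commute)
  moreover have "pi * card v \<le> pi * card (corners S)"
    using card_mono[OF finite_corners vertex_subset[OF assms(2)]] by simp
  ultimately show ?thesis unfolding field_eq using pi_gt_zero by linarith
qed

lemma angle_continuous:
  assumes "u \<in> phase_space G S" "c \<in> corners S" "e > 0"
  shows "\<exists>d>0. \<forall>w. (\<forall>v\<in>vertices S. \<bar>w v - u v\<bar> < d) \<longrightarrow> \<bar>angle G w c - angle G u c\<bar> < e"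
proof -
  obtain t i where c: "c = (t, i)" "t \<in> faces S" "i < 3" using assms(2) by (auto simp: corners_def)
  have dom: "u (cl t ((i + k) mod 3)) \<in> u_domain G (vw t ((i + k) mod 3))" for k
    using phase_domain_cl[OF assms(1) c(2)] by simp
  have dom0: "u (cl t i) \<in> u_domain G (vw t i)" using phase_domain_cl[OF assms(1) c(2,3)] .
  obtain d where "d > 0" and d: "\<And>y1 y2 y3. \<bar>y1 - u (cl t i)\<bar> < d \<Longrightarrow> \<bar>y2 - u (cl t ((i + 1) mod 3))\<bar> < d \<Longrightarrow>
     \<bar>y3 - u (cl t ((i + 2) mod 3))\<bar> < d \<Longrightarrow>
     \<bar>tri_angle G (vw t i) (vw t ((i + 1) mod 3)) (vw t ((i + 2) mod 3))
    (ew t i ((i + 1) mod 3)) (ew t i ((i + 2) mod 3)) (ew t ((i + 1) mod 3) ((i + 2) mod 3)) y1 y2 y3 - angle G u (t, i)\<bar> < e"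
    using tri_angle_continuous[OF structure_corner[OF c(2,3)] dom0 dom dom assms(3)] unfolding angle_eq by blast
  show ?thesis
  proof (intro exI[of _ d] conjI allI impI \<open>d > 0\<close>)
    fix w assume w: "\<forall>v\<in>vertices S. \<bar>w v - u v\<bar> < d"
    have "\<bar>w (cl t k) - u (cl t k)\<bar> < d" if "k < 3" for k using w cl_in[OF c(2) that] by blast
    then show "\<bar>angle G w c - angle G u c\<bar> < e" unfolding c(1) angle_eq[of G w] using c(3) by (intro d) auto
  qed
qed

lemma field_continuous:
  assumes "u \<in> phase_space G S" "e > 0"
  shows "\<exists>d>0. \<forall>w. (\<forall>v\<in>vertices S. \<bar>w v - u v\<bar> < d) \<longrightarrow> (\<forall>v\<in>vertices S. \<bar>field G w v - field G u v\<bar> < e)"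
proof -
  define n where "n = real (card (corners S))"
  have n: "n \<ge> 0" by (simp add: n_def)
  \<comment> \<open>With \<open>n + 1\<close> in place of \<open>n\<close> the total error is
    strictly below \<open>e\<close>, even for \<open>n = 0\<close>.\<close>
  have "\<exists>d>0. \<forall>c\<in>corners S. \<forall>w. (\<forall>v\<in>vertices S. \<bar>w v - u v\<bar> < d) \<longrightarrow> \<bar>angle G w c - angle G u c\<bar> < e / (n + 1)"
  proof (rule finite_common_bound[OF finite_corners])
    fix c assume "c \<in> corners S"
    then show "\<exists>d>0. \<forall>w. (\<forall>v\<in>vertices S. \<bar>w v - u v\<bar> < d) \<longrightarrow> \<bar>angle G w c - angle G u c\<bar> < e / (n + 1)"
      using assms n by (intro angle_continuous) auto
  qed (meson less_le_trans)
  then obtain d where "d > 0" and d: "\<And>c w. c \<in> corners S \<Longrightarrow> (\<forall>v\<in>vertices S. \<bar>w v - u v\<bar> < d) \<Longrightarrow> \<bar>angle G w c - angle G u c\<bar> < e / (n + 1)"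
    by blast
  show ?thesis
  proof (intro exI[of _ d] conjI allI impI ballI \<open>d > 0\<close>)
    fix w v assume w: "\<forall>v\<in>vertices S. \<bar>w v - u v\<bar> < d" and v: "v \<in> vertices S"
    have "\<bar>field G w v - field G u v\<bar> = \<bar>\<Sum>c\<in>v. angle G w c - angle G u c\<bar>"
      by (simp add: field_eq sum_subtractf)
    also have "\<dots> \<le> (\<Sum>c\<in>v. \<bar>angle G w c - angle G u c\<bar>)" by (rule sum_abs)
    also have "\<dots> \<le> (\<Sum>c\<in>v. e / (n + 1))"
      using d[OF _ w] vertex_subset[OF v] by (intro sum_mono less_imp_le) blast
    also have "\<dots> \<le> n * (e / (n + 1))"
      using card_mono[OF finite_corners vertex_subset[OF v]] assms n by (auto simp: n_def intro!: divide_right_mono mult_right_mono)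
    also have "\<dots> < e" using n assms by (simp add: field_simps)
    finally show "\<bar>field G w v - field G u v\<bar> < e" .
  qed
qed

end

text \<open>The product of \<open>exp (2 * c * s)\<close> with the squared distance has nonpositive
  derivative. With \<open>c = 0\<close> this yields uniqueness and boundedness, with
  \<open>w\<close> constant in time the approach to an equilibrium.\<close>

lemma sq_dist_decay:
  fixes u w u' w' :: "real \<Rightarrow> 'i \<Rightarrow> real"
  assumes fin: "finite V" and I: "is_interval I" "0 \<in> I" "t \<in> I" "0 \<le> t"
    and du: "\<And>i s. i \<in> V \<Longrightarrow> s \<in> I \<Longrightarrow> ((\<lambda>s. u s i) has_real_derivative u' s i) (at s within I)"
    and dw: "\<And>i s. i \<in> V \<Longrightarrow> s \<in> I \<Longrightarrow> ((\<lambda>s. w s i) has_real_derivative w' s i) (at s within I)"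
    and le: "\<And>s. s \<in> I \<Longrightarrow> 0 \<le> s \<Longrightarrow> s \<le> t \<Longrightarrow> (\<Sum>i\<in>V. (u s i - w s i) * (u' s i - w' s i)) \<le> - c * (\<Sum>i\<in>V. (u s i - w s i)\<^sup>2)"
  shows "(\<Sum>i\<in>V. (u t i - w t i)\<^sup>2) \<le> exp (- 2 * c * t) * (\<Sum>i\<in>V. (u 0 i - w 0 i)\<^sup>2)"
proof -
  define q where "q s = (\<Sum>i\<in>V. (u s i - w s i)\<^sup>2)" for s
  define q' where "q' s = (\<Sum>i\<in>V. 2 * ((u s i - w s i) * (u' s i - w' s i)))" for s
  define p where "p s = exp (2 * c * s) * q s" for s
  define p' where "p' s = exp (2 * c * s) * (2 * c * q s + q' s)" for s
  have sub: "{0..t} \<subseteq> I"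
    using mem_is_interval_1_I[OF I(1,2,3)] by auto
  have dp: "(p has_real_derivative p' s) (at s within I)" if s: "s \<in> I" for s
  proof -
    have "(q has_real_derivative q' s) (at s within I)" unfolding q_def q'_def
      by (rule DERIV_sum) (auto intro!: derivative_eq_intros du dw s)
    then show ?thesis unfolding p_def p'_def
      by (auto intro!: derivative_eq_intros simp: algebra_simps)
  qed
  have "p t \<le> p 0"
  proof (rule DERIV_nonpos_imp_decreasing_open[where f = p and a = 0 and b = t])
    show "continuous_on {0..t} p"
      by (rule continuous_on_subset[OF _ sub]) (auto simp: continuous_on_eq_continuous_within intro!: DERIV_continuous dp)
    fix s assume s: "0 < s" "s < t"
    then have "s \<in> interior I" using sub interior_mono[OF sub] by auto
    then have "at s within I = at s" by (rule at_within_interior)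
    moreover have "s \<in> I" using s sub by auto
    ultimately have "(p has_real_derivative p' s) (at s)" using dp by metis
    moreover have "p' s \<le> 0"
      unfolding p'_def using le[OF \<open>s \<in> I\<close>] s
      by (intro mult_nonneg_nonpos) (auto simp: q_def q'_def sum_distrib_left[symmetric])
    ultimately show "\<exists>y. (p has_real_derivative y) (at s) \<and> y \<le> 0" by blast
  qed (use I in auto)
  then have "exp (- (2 * c * t)) * p t \<le> exp (- (2 * c * t)) * p 0" by (intro mult_left_mono) auto
  then show ?thesis by (simp add: p_def q_def mult.assoc[symmetric] exp_add[symmetric])
qed

section \<open>Counting edges, nondegeneracy of faces, and Gauss-Bonnet\<close>

context weighted_closed_surface
begin

text \<open>An edge consists of two glued sides with two orientations each. The four are distinct
  because no side is glued to itself in either orientation.\<close>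

lemma edge_class_card: "d \<in> osides S \<Longrightarrow> card (edge_class S d) = 4"
proof -
  assume d: "d \<in> osides S"
  define A where "A = {d, flip d, glue S d, flip (glue S d)}"
  define R where "R = (\<lambda>d. (d, glue S d)) ` osides S \<union> (\<lambda>d. (d, flip d)) ` osides S"
  have A: "A \<subseteq> osides S" using d glue_in flip_in by (auto simp: A_def)
  have closed: "glue S x \<in> A \<and> flip x \<in> A" if "x \<in> A" for x
    using that d by (auto simp: A_def glue_glue glue_flip flip_flip glue_in)
  have "x \<in> A" if "(d, x) \<in> R\<^sup>*" for x
    using that
  proof (induction rule: rtrancl_induct)
    case base
    show ?case by (simp add: A_def)
  next
    case (step y z)
    then show ?case using closed by (auto simp: R_def)
  qed
  moreover have "(d, x) \<in> R\<^sup>*" if "x \<in> A" for x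
  proof -
    have "(d, flip d) \<in> R" "(d, glue S d) \<in> R" "(glue S d, flip (glue S d)) \<in> R"
      using d glue_in by (auto simp: R_def)
    then show ?thesis using that unfolding A_def by (auto intro: rtrancl_into_rtrancl)
  qed
  ultimately have "edge_class S d = A"
    using A d unfolding edge_class_def edge_rel_def R_def[symmetric] by blast
  moreover have "card A = 4"
  proof -
    have fl: "flip x \<noteq> x" if "x \<in> osides S" for x using that by (cases x) (auto simp: osides_def)
    have "flip (glue S d) \<noteq> d" "flip (glue S d) \<noteq> flip d" using glue_ne[OF d] flip_flip by metis+
    then show ?thesis
      using glue_ne[OF d] fl[OF d, symmetric] fl[OF glue_in[OF d], symmetric] unfolding A_def by simp
  qed
  ultimately show ?thesis by simp
qed

text \<open>Oriented sides are counted twice: six for each face, four for each edge.\<close>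

lemma card_edges: "2 * card (edges S) = 3 * card (faces S)"
proof -
  define P :: "(nat \<times> nat) set" where "P = {(0, 1), (0, 2), (1, 0), (1, 2), (2, 0), (2, 1)}"
  have os: "osides S = faces S \<times> P"
  proof -
    have three: "i < 3 \<longleftrightarrow> i = 0 \<or> i = 1 \<or> i = 2" for i :: nat by auto
    have "i < 3 \<and> j < 3 \<and> i \<noteq> j \<longleftrightarrow> (i, j) \<in> P" for i j :: nat
      unfolding P_def three by auto
    then show ?thesis by (auto simp: osides_def)
  qed
  have fin: "finite (osides S)" unfolding os P_def using finite_faces by simp
  have "card P = 6" by (simp add: P_def)
  then have c: "card (osides S) = card (faces S) * 6" unfolding os by (simp add: card_cartesian_product)
  have U: "\<Union>(edges S) = osides S" unfolding edges_def by (rule Union_quotient[OF equiv_edge_rel])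
  have "4 * card (edges S) = card (\<Union>(edges S))"
  proof (rule card_partition)
    show "finite (edges S)" unfolding edges_def using fin by (intro finite_quotient) (auto simp: edge_rel_def)
    show "finite (\<Union>(edges S))" using fin by (simp add: U)
    show "card e = 4" if "e \<in> edges S" for e
      using that edge_class_card unfolding edges_def edge_class_def by (auto elim!: quotientE)
    show "e \<inter> e' = {}" if "e \<in> edges S" "e' \<in> edges S" "e \<noteq> e'" for e e'
      using that quotient_disj[OF equiv_edge_rel] unfolding edges_def by blast
  qed
  then show ?thesis using c U by simp
qed

lemma quantity_length_side:
  assumes u: "u \<in> phase_space G S" and t: "t \<in> faces S" and ij: "i < 3" "j < 3" "i \<noteq> j"
  shows "side_length G S (f_of_u G S u) (t, i, j) = quantity_length G (quantity G (vw t i) (vw t j) (ew t i j) (u (cl t i)) (u (cl t j)))"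
  unfolding edge_length_quantity[OF phase_domain_cl[OF u t ij(1)] phase_domain_cl[OF u t ij(2)], symmetric]
  by (simp add: side_length_def Let_def cl_def ew_def f_of_u_def)

lemma side_length_commute:
  assumes "t \<in> faces S" "i < 3" "j < 3" "i \<noteq> j"
  shows "side_length G S f (t, i, j) = side_length G S f (t, j, i)"
  using ew_commute[OF assms] unfolding side_length_def Let_def ew_def tail.simps flip.simps edge_length_eq
  by (simp add: edge_quantity_commute)

lemma quantity_face_gt:
  assumes u: "u \<in> phase_space G S" and t: "t \<in> faces S"
  shows "quantity G (vw t 0) (vw t 1) (ew t 0 1) (u (cl t 0)) (u (cl t 1)) > quantity_bound G"
    "quantity G (vw t 0) (vw t 2) (ew t 0 2) (u (cl t 0)) (u (cl t 2)) > quantity_bound G"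
    "quantity G (vw t 1) (vw t 2) (ew t 1 2) (u (cl t 1)) (u (cl t 2)) > quantity_bound G"
proof -
  note st = structure_face_012[OF t, unfolded structure_triple_def]
    and dom = phase_domain_cl[OF u t, of 0] phase_domain_cl[OF u t, of 1] phase_domain_cl[OF u t, of 2]
  show "quantity G (vw t 0) (vw t 1) (ew t 0 1) (u (cl t 0)) (u (cl t 1)) > quantity_bound G"
    by (rule quantity_gt) (use st dom in simp_all)
  show "quantity G (vw t 0) (vw t 2) (ew t 0 2) (u (cl t 0)) (u (cl t 2)) > quantity_bound G"
    by (rule quantity_gt) (use st dom in simp_all)
  show "quantity G (vw t 1) (vw t 2) (ew t 1 2) (u (cl t 1)) (u (cl t 2)) > quantity_bound G"
    by (rule quantity_gt) (use st dom in simp_all)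
qed

definition face_det :: "geometry \<Rightarrow> ('a corner set \<Rightarrow> real) \<Rightarrow> 'a \<Rightarrow> real" where
  "face_det G u t = tri_det G (vw t 0) (vw t 1) (vw t 2) (ew t 0 1) (ew t 0 2) (ew t 1 2)
      (u (cl t 0)) (u (cl t 1)) (u (cl t 2))"

lemma dcf_iff:
  assumes u: "u \<in> phase_space G S"
  shows "dcf_u G S u \<longleftrightarrow> (\<forall>t\<in>faces S. face_det G u t > 0)"
proof -
  have "strict_triangle (side_length G S (f_of_u G S u) (t, 0, 1)) (side_length G S (f_of_u G S u) (t, 0, 2))
        (side_length G S (f_of_u G S u) (t, 1, 2)) \<longleftrightarrow> face_det G u t > 0" if t: "t \<in> faces S" for t
  proof -
    have s: "side_length G S (f_of_u G S u) (t, 0, 1) = quantity_length G (quantity G (vw t 0) (vw t 1) (ew t 0 1) (u (cl t 0)) (u (cl t 1)))"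
      "side_length G S (f_of_u G S u) (t, 0, 2) = quantity_length G (quantity G (vw t 0) (vw t 2) (ew t 0 2) (u (cl t 0)) (u (cl t 2)))"
      "side_length G S (f_of_u G S u) (t, 1, 2) = quantity_length G (quantity G (vw t 1) (vw t 2) (ew t 1 2) (u (cl t 1)) (u (cl t 2)))"
      by (rule quantity_length_side[OF u t]; simp)+
    show ?thesis unfolding s strict_triangle_iff[OF quantity_face_gt[OF u t]] face_det_def tri_det_def
      by (metis quantity_det_rotate)
  qed
  then show ?thesis using u by (simp add: dcf_u_def discrete_conformal_factor_def)
qed

lemma curvature_eq_ext:
  assumes f: "discrete_conformal_factor G S f" and v: "v \<in> vertices S"
  shows "curvature G S f v = ext_curvature G S f v"
proof -
  have "at_corner (inner_angle G) G S f c = at_corner (ext_angle G) G S f c" if cv: "c \<in> v" for c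
  proof -
    obtain t i where c: "c = (t, i)" "t \<in> faces S" "i < 3"
      using cv vertex_subset[OF v] unfolding corners_def by (cases c) auto
    have "strict_triangle (side_length G S f (t, 0, 1)) (side_length G S f (t, 0, 2)) (side_length G S f (t, 1, 2))"
      using f c unfolding discrete_conformal_factor_def by blast
    then have tri: "strict_triangle (side_length G S f (t, 1, 2)) (side_length G S f (t, 0, 1)) (side_length G S f (t, 0, 2))"
      "strict_triangle (side_length G S f (t, 0, 2)) (side_length G S f (t, 1, 2)) (side_length G S f (t, 0, 1))"
      "strict_triangle (side_length G S f (t, 0, 1)) (side_length G S f (t, 0, 2)) (side_length G S f (t, 1, 2))"
      unfolding strict_triangle_def by linarith+
    have s: "side_length G S f (t, 1, 0) = side_length G S f (t, 0, 1)"
      "side_length G S f (t, 2, 0) = side_length G S f (t, 0, 2)"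
      "side_length G S f (t, 2, 1) = side_length G S f (t, 1, 2)"
      by (rule side_length_commute[OF c(2)]; simp)+
    have m: "(0 + 1) mod 3 = (1 :: nat)" "(0 + 2) mod 3 = (2 :: nat)" "(1 + 1) mod 3 = (2 :: nat)"
      "(1 + 2) mod 3 = (0 :: nat)" "(2 + 1) mod 3 = (0 :: nat)" "(2 + 2) mod 3 = (1 :: nat)" by simp_all
    have "i = 0 \<or> i = 1 \<or> i = 2" using c by auto
    then have "strict_triangle (side_length G S f (t, (i + 1) mod 3, (i + 2) mod 3))
       (side_length G S f (t, i, (i + 1) mod 3)) (side_length G S f (t, i, (i + 2) mod 3))"
      by (elim disjE; hypsubst; simp only: m s tri)
    then show ?thesis by (simp add: at_corner_def Let_def c ext_angle_def)
  qed
  then show ?thesis by (simp add: curvature_def ext_curvature_def)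
qed

lemma field_eq_curvature:
  assumes "dcf_u G S u" "v \<in> vertices S"
  shows "target_curvature G S - curvature G S (f_of_u G S u) v = field G u v"
  using curvature_eq_ext[OF _ assms(2)] assms(1) by (simp add: field_def dcf_u_def)

lemma face_angle_sum_euclidean:
  assumes u: "u \<in> phase_space Euclidean S" and t: "t \<in> faces S"
  shows "angle Euclidean u (t, 0) + angle Euclidean u (t, 1) + angle Euclidean u (t, 2) = pi"
proof -
  define f where "f = f_of_u Euclidean S u"
  have pos: "side_length Euclidean S f (t, 1, 2) > 0" "side_length Euclidean S f (t, 0, 2) > 0" "side_length Euclidean S f (t, 0, 1) > 0"
    unfolding f_def using quantity_length_side[OF u t, of 1 2] quantity_length_side[OF u t, of 0 2] quantity_length_side[OF u t, of 0 1]
      quantity_length_pos quantity_face_gt[OF u t] by auto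
  have c: "side_length Euclidean S f (t, 1, 0) = side_length Euclidean S f (t, 0, 1)"
      "side_length Euclidean S f (t, 2, 0) = side_length Euclidean S f (t, 0, 2)"
      "side_length Euclidean S f (t, 2, 1) = side_length Euclidean S f (t, 1, 2)"
      by (rule side_length_commute[OF t]; simp)+
  have m: "(0 + 1) mod 3 = (1 :: nat)" "(0 + 2) mod 3 = (2 :: nat)" "(1 + 1) mod 3 = (2 :: nat)"
    "(1 + 2) mod 3 = (0 :: nat)" "(2 + 1) mod 3 = (0 :: nat)" "(2 + 2) mod 3 = (1 :: nat)" by simp_all
  show ?thesis
    using euclidean_ext_angle_sum[OF pos]
      ext_angle_swap[of Euclidean "side_length Euclidean S f (t, 1, 2)" "side_length Euclidean S f (t, 0, 1)" "side_length Euclidean S f (t, 0, 2)"]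
      ext_angle_swap[of Euclidean "side_length Euclidean S f (t, 0, 2)" "side_length Euclidean S f (t, 1, 2)" "side_length Euclidean S f (t, 0, 1)"]
      ext_angle_swap[of Euclidean "side_length Euclidean S f (t, 0, 1)" "side_length Euclidean S f (t, 0, 2)" "side_length Euclidean S f (t, 1, 2)"]
    unfolding angle_def at_corner_def Let_def fst_conv snd_conv m f_def[symmetric] c
    by linarith
qed

text \<open>Every face contributes the angle sum pi, degenerate or not, and twice the number of
  edges is three times the number of faces; the target curvature is exactly the average that makes
  the total vanish.\<close>

lemma gauss_bonnet:
  assumes "u \<in> phase_space Euclidean S"
  shows "(\<Sum>v\<in>vertices S. field Euclidean u v) = 0"
proof -
  have n: "real (card (vertices S)) > 0" using vertices_ne finite_vertices by (simp add: card_gt_0_iff)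
  have "(\<Sum>v\<in>vertices S. \<Sum>c\<in>v. angle Euclidean u c) = (\<Sum>t\<in>faces S. pi)"
    unfolding vertex_sum by (intro sum.cong refl face_angle_sum_euclidean assms)
  then have "(\<Sum>v\<in>vertices S. field Euclidean u v)
     = card (vertices S) * (target_curvature Euclidean S - 2 * pi) + pi * card (faces S)"
    by (simp add: field_eq sum.distrib)
  also have "\<dots> = 2 * pi * real_of_int (euler_char S) - 2 * pi * card (vertices S) + pi * card (faces S)"
    using n by (simp add: field_simps)
  also have "real_of_int (euler_char S) = real (card (vertices S)) - real (card (edges S)) + real (card (faces S))"
    by (simp add: euler_char_def)
  also have "real (card (edges S)) = 3 / 2 * real (card (faces S))"
    using card_edges by linarith
  finally show ?thesis by (simp add: algebra_simps)
qed

end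

section \<open>The extended flow\<close>

lemma ext_angle_euclidean_scale:
  assumes "k > 0"
  shows "ext_angle Euclidean (k * a) (k * b) (k * c) = ext_angle Euclidean a b c"
proof -
  have le: "k * x < k * y + k * z \<longleftrightarrow> x < y + z" for x y z
    using assms by (simp flip: distrib_left)
  have ge: "k * a \<ge> k * b + k * c \<longleftrightarrow> a \<ge> b + c" using assms by (simp flip: distrib_left)
  have "((k * b)\<^sup>2 + (k * c)\<^sup>2 - (k * a)\<^sup>2) / (2 * (k * b) * (k * c)) = (k\<^sup>2 * (b\<^sup>2 + c\<^sup>2 - a\<^sup>2)) / (k\<^sup>2 * (2 * b * c))"
    by (simp add: power_mult_distrib algebra_simps power2_eq_square)
  also have "\<dots> = (b\<^sup>2 + c\<^sup>2 - a\<^sup>2) / (2 * b * c)" using assms by simp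
  finally have "inner_angle Euclidean (k * a) (k * b) (k * c) = inner_angle Euclidean a b c" by simp
  then show ?thesis unfolding ext_angle_def strict_triangle_def le ge by simp
qed

lemma f_of_u_euclidean: "f_of_u Euclidean S u = u"
proof -
  have "u_coord Euclidean e = id" for e by (auto simp: u_coord_def)
  then show ?thesis by (auto simp: f_of_u_def)
qed

lemma f_of_u_u_coord: "f_of_u G S (\<lambda>v. u_coord G (vweight S v) (f v)) = f"
  unfolding f_of_u_def by (intro ext) (rule inv_f_f[OF inj_u_coord])

text \<open>A common shift of the Euclidean coordinates rescales all lengths and so preserves
  angles. This allows an equilibrium to be moved to the mean value of a given solution.\<close>

lemma side_length_euclidean_shift:
  "side_length Euclidean S (\<lambda>v. f v + s) d = exp s * side_length Euclidean S f d"
proof -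
  have "e * exp (2 * (x + s)) + e' * exp (2 * (y + s)) + 2 * n * exp (x + s + (y + s))
     = (exp s)\<^sup>2 * (e * exp (2 * x) + e' * exp (2 * y) + 2 * n * exp (x + y))" for e e' n x y
  proof -
    have a: "exp (2 * (z + s)) = (exp s)\<^sup>2 * exp (2 * z)" for z :: real
      unfolding exp_double exp_add power_mult_distrib by (rule mult.commute)
    have b: "exp (x + s + (y + s)) = (exp s)\<^sup>2 * exp (x + y)"
      by (simp add: exp_add exp_double)
    show ?thesis unfolding a b by (simp add: algebra_simps)
  qed
  then show ?thesis by (simp add: side_length_def Let_def real_sqrt_mult)
qed

lemma dcf_euclidean_shift:
  "discrete_conformal_factor Euclidean S (\<lambda>v. f v + s) \<longleftrightarrow> discrete_conformal_factor Euclidean S f"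
  unfolding discrete_conformal_factor_def side_length_euclidean_shift strict_triangle_def
  by (simp flip: distrib_left)

lemma ext_curvature_euclidean_shift:
  "ext_curvature Euclidean S (\<lambda>v. f v + s) v = ext_curvature Euclidean S f v"
  unfolding ext_curvature_def at_corner_def Let_def side_length_euclidean_shift
  by (simp add: ext_angle_euclidean_scale)

context weighted_closed_surface
begin

lemma u_coord_in_phase: "(\<lambda>v. u_coord G (vweight S v) (f v)) \<in> phase_space G S"
proof -
  have "u_coord Hyperbolic 1 (f v) < 0" for v
    using u_coord_in_domain[of Hyperbolic 1 "f v"] by (simp add: u_domain_def)
  then show ?thesis by (auto simp: phase_space_def)
qed

lemma ext_ricci_flow_solution_iff:
  "ext_ricci_flow_solution G S I u \<longleftrightarrow> (\<forall>t\<in>I. u t \<in> phase_space G S) \<and> C1_solution S (field G) I u"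
  unfolding ext_ricci_flow_solution_def field_def[abs_def] ..

text \<open>A vertex of weight 1 with coordinate close to 0 has a huge radius and hence small
  angles, whatever the other coordinates are. There the flow does not push the coordinate up towards
  the end 0 of the phase space.\<close>

lemma hyperbolic_trap:
  "\<exists>\<delta>>0. \<forall>u\<in>phase_space Hyperbolic S. \<forall>v\<in>vertices S. vweight S v = 1 \<longrightarrow> - \<delta> < u v \<longrightarrow> field Hyperbolic u v \<le> 0"
proof -
  \<comment> \<open>At most \<open>card (corners S)\<close> angles meet at a vertex, so angles below
    \<open>e\<close> add up to at most 2 pi.\<close>
  define e where "e = 2 * pi / (real (card (corners S)) + 1)"
  have e: "e > 0" by (simp add: e_def)
  have "\<exists>\<delta>>0. \<forall>c\<in>corners S. \<forall>u\<in>phase_space Hyperbolic S. vweight S (vertex_class S c) = 1 \<longrightarrow>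
      - \<delta> < u (vertex_class S c) \<longrightarrow> angle Hyperbolic u c < e"
  proof (rule finite_common_bound[OF finite_corners])
    fix c assume "c \<in> corners S"
    then obtain t i where c: "c = (t, i)" "t \<in> faces S" "i < 3" by (auto simp: corners_def)
    show "\<exists>\<delta>>0. \<forall>u\<in>phase_space Hyperbolic S. vweight S (vertex_class S c) = 1 \<longrightarrow>
      - \<delta> < u (vertex_class S c) \<longrightarrow> angle Hyperbolic u c < e"
    proof (cases "vw t i = 1")
      case True
      obtain \<delta> where "\<delta> > 0" and \<delta>: "\<And>x1 x2 x3. - \<delta> < x1 \<Longrightarrow> x1 < 0 \<Longrightarrow> x2 \<in> u_domain Hyperbolic (vw t ((i + 1) mod 3)) \<Longrightarrow>
        x3 \<in> u_domain Hyperbolic (vw t ((i + 2) mod 3)) \<Longrightarrow>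
        tri_angle Hyperbolic 1 (vw t ((i + 1) mod 3)) (vw t ((i + 2) mod 3))
    (ew t i ((i + 1) mod 3)) (ew t i ((i + 2) mod 3)) (ew t ((i + 1) mod 3) ((i + 2) mod 3)) x1 x2 x3 < e"
        using hyp_tri_angle_small[OF structure_corner[OF c(2,3), unfolded True] e] by blast
      show ?thesis
      proof (intro exI[of _ \<delta>] conjI ballI impI \<open>\<delta> > 0\<close>)
        fix u assume u: "u \<in> phase_space Hyperbolic S" "- \<delta> < u (vertex_class S c)"
        have "u (cl t i) < 0" using phase_domain_cl[OF u(1) c(2,3)] True by (simp add: u_domain_def)
        then show "angle Hyperbolic u c < e"
          using u(2) phase_domain_cl[OF u(1) c(2)] unfolding c(1) angle_eq True
          by (intro \<delta>) (auto simp: cl_def)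
      qed
    next
      case False
      then show ?thesis using c(1) by (intro exI[of _ 1]) (auto simp: cl_def)
    qed
  next
    fix c :: "'a corner" and d d' :: real
    assume "\<forall>u\<in>phase_space Hyperbolic S. vweight S (vertex_class S c) = 1 \<longrightarrow> - d < u (vertex_class S c) \<longrightarrow> angle Hyperbolic u c < e" "d' \<le> d"
    then show "\<forall>u\<in>phase_space Hyperbolic S. vweight S (vertex_class S c) = 1 \<longrightarrow> - d' < u (vertex_class S c) \<longrightarrow> angle Hyperbolic u c < e"
      by (meson le_less_trans neg_le_iff_le)
  qed
  then obtain \<delta> where "\<delta> > 0" and \<delta>: "\<And>c u. c \<in> corners S \<Longrightarrow> u \<in> phase_space Hyperbolic S \<Longrightarrow>
      vweight S (vertex_class S c) = 1 \<Longrightarrow> - \<delta> < u (vertex_class S c) \<Longrightarrow> angle Hyperbolic u c < e" by blast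
  show ?thesis
  proof (intro exI[of _ \<delta>] conjI ballI impI \<open>\<delta> > 0\<close>)
    fix u v assume u: "u \<in> phase_space Hyperbolic S" and v: "v \<in> vertices S" "vweight S v = 1" "- \<delta> < u v"
    have "(\<Sum>c\<in>v. angle Hyperbolic u c) \<le> (\<Sum>c\<in>v. e)"
    proof (rule sum_mono)
      fix c assume "c \<in> v"
      then show "angle Hyperbolic u c \<le> e"
        using \<delta>[of c u] vertex_subset[OF v(1)] vertex_class_eq[OF v(1)] u v by (auto intro: less_imp_le)
    qed
    also have "\<dots> \<le> real (card (corners S)) * e"
      using card_mono[OF finite_corners vertex_subset[OF v(1)]] e by simp
    also have "\<dots> \<le> 2 * pi" by (simp add: e_def field_simps)
    finally show "field Hyperbolic u v \<le> 0" by (simp add: field_eq)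
  qed
qed

lemma field_path_continuous:
  assumes "\<And>t. t \<in> I \<Longrightarrow> u t \<in> phase_space G S" "\<And>v. v \<in> vertices S \<Longrightarrow> continuous_on I (\<lambda>t. u t v)" "v \<in> vertices S"
  shows "continuous_on I (\<lambda>t :: real. field G (u t) v)"
  unfolding continuous_on_iff
proof (intro ballI allI impI)
  fix t e :: real assume t: "t \<in> I" and e: "e > 0"
  from field_continuous[OF assms(1)[OF t] e] obtain d where "d > 0"
    and d: "\<And>w. \<forall>v\<in>vertices S. \<bar>w v - u t v\<bar> < d \<Longrightarrow> \<forall>v\<in>vertices S. \<bar>field G w v - field G (u t) v\<bar> < e" by blast
  have "\<exists>r>0. \<forall>v\<in>vertices S. \<forall>s\<in>I. dist s t < r \<longrightarrow> dist (u s v) (u t v) < d"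
  proof (rule finite_common_bound[OF finite_vertices])
    fix v assume "v \<in> vertices S"
    then show "\<exists>r>0. \<forall>s\<in>I. dist s t < r \<longrightarrow> dist (u s v) (u t v) < d"
      using assms(2)[of v] t \<open>d > 0\<close> unfolding continuous_on_iff by blast
  qed (meson less_le_trans)
  then obtain r where "r > 0" "\<forall>v\<in>vertices S. \<forall>s\<in>I. dist s t < r \<longrightarrow> dist (u s v) (u t v) < d" by blast
  then show "\<exists>r>0. \<forall>s\<in>I. dist s t < r \<longrightarrow> dist (field G (u s) v) (field G (u t) v) < e"
    using d assms(3) unfolding dist_real_def by blast
qed

lemma ext_flow_exists:
  assumes u0: "u0 \<in> phase_space G S"
  shows "\<exists>w. ext_ricci_flow_solution G S {0..} w \<and> w 0 = u0"
proof -
  obtain \<delta>0 where \<delta>0: "\<delta>0 > 0" "\<And>u v. u \<in> phase_space Hyperbolic S \<Longrightarrow> v \<in> vertices S \<Longrightarrow> vweight S v = 1 \<Longrightarrow>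
     - \<delta>0 < u v \<Longrightarrow> field Hyperbolic u v \<le> 0" using hyperbolic_trap by blast
  have "\<exists>m>0. \<forall>v\<in>vertices S. G = Hyperbolic \<longrightarrow> vweight S v = 1 \<longrightarrow> u0 v \<le> - m"
  proof (rule finite_common_bound[OF finite_vertices])
    fix v assume "v \<in> vertices S"
    then show "\<exists>m>0. G = Hyperbolic \<longrightarrow> vweight S v = 1 \<longrightarrow> u0 v \<le> - m"
    proof (cases "G = Hyperbolic \<and> vweight S v = 1")
      case True
      then have "u0 v < 0" using u0 \<open>v \<in> vertices S\<close> by (auto simp: phase_space_def)
      then show ?thesis by (intro exI[of _ "- u0 v"]) simp
    next
      case False
      then show ?thesis by (intro exI[of _ 1]) auto
    qed
  qed auto
  then obtain m where m: "m > 0" "\<And>v. v \<in> vertices S \<Longrightarrow> G = Hyperbolic \<Longrightarrow> vweight S v = 1 \<Longrightarrow> u0 v \<le> - m" by blast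
  define \<delta> where "\<delta> = min (\<delta>0 / 2) m"
  have \<delta>: "\<delta> > 0" "2 * \<delta> \<le> \<delta>0" "\<delta> \<le> m" using \<delta>0 m by (auto simp: \<delta>_def)
  define M where "M = \<bar>target_curvature G S\<bar> + 2 * pi + pi * card (corners S)"
  have M: "M > 0" using pi_gt_zero mult_nonneg_nonneg[of pi "real (card (corners S))"]
    unfolding M_def by linarith
  \<comment> \<open>Invariance under Euler steps: above \<open>- (2 * \<delta>)\<close> the field is
    nonpositive at the constrained vertices by \<open>hyperbolic_trap\<close>, and below that level
    a step of length at most \<open>\<delta> / M\<close> raises a coordinate by at most
    \<open>\<delta>\<close>.\<close>
  define D where "D = {u. G = Hyperbolic \<longrightarrow> (\<forall>v\<in>vertices S. vweight S v = 1 \<longrightarrow> u v \<le> - \<delta>)}"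
  have DP: "u \<in> phase_space G S" if "u \<in> D" for u using that \<delta> by (fastforce simp: D_def phase_space_def)
  interpret F: dissipative_field "vertices S" "field G" D M "\<delta> / M"
  proof
    show "finite (vertices S)" by (rule finite_vertices)
    show "\<delta> / M > 0" "M \<ge> 0" using M \<delta> by auto
    show "\<bar>field G u v\<bar> \<le> M" if "u \<in> D" "v \<in> vertices S" for u v
      unfolding M_def by (rule field_bound[OF DP that(2)]) (rule that)
    show "(\<Sum>i\<in>vertices S. (u i - w i) * (field G u i - field G w i)) \<le> 0" if "u \<in> D" "w \<in> D" for u w
      using field_monotone DP that by blast
    show "(\<lambda>i. u i + h * field G u i) \<in> D" if u: "u \<in> D" and h: "0 \<le> h" "h \<le> \<delta> / M" for u h
      unfolding D_def
    proof (intro CollectI impI ballI)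
      fix v assume v: "G = Hyperbolic" "v \<in> vertices S" "vweight S v = 1"
      show "u v + h * field G u v \<le> - \<delta>"
      proof (cases "- (2 * \<delta>) < u v")
        case True
        then have "field G u v \<le> 0" using \<delta>0(2)[of u v] DP[OF u] v \<delta> by auto
        then have "h * field G u v \<le> 0" using h by (simp add: mult_nonneg_nonpos)
        moreover have "u v \<le> - \<delta>" using u v by (auto simp: D_def)
        ultimately show ?thesis by linarith
      next
        case False
        have "field G u v \<le> M" using field_bound[OF DP[OF u] v(2)] by (simp add: M_def)
        then have "h * field G u v \<le> \<delta> / M * M" using h M \<delta> by (meson mult_mono order_trans mult_left_mono mult_right_mono less_imp_le)
        then show ?thesis using False M by simp
      qed
    qed
    show "u \<in> D" if "\<And>n::nat. x n \<in> D" "\<And>i. i \<in> vertices S \<Longrightarrow> (\<lambda>n. x n i) \<longlonglongrightarrow> u i" for x u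
      unfolding D_def
    proof (intro CollectI impI ballI)
      fix v assume v: "G = Hyperbolic" "v \<in> vertices S" "vweight S v = 1"
      then have "\<forall>n. x n v \<le> - \<delta>" using that(1) by (auto simp: D_def)
      then show "u v \<le> - \<delta>" using LIMSEQ_le_const2[OF that(2)[OF v(2)]] by blast
    qed
    show "\<exists>d>0. \<forall>w\<in>D. (\<forall>i\<in>vertices S. \<bar>w i - u i\<bar> < d) \<longrightarrow> (\<forall>i\<in>vertices S. \<bar>field G w i - field G u i\<bar> < e)"
      if "u \<in> D" "e > 0" for u e
      using field_continuous[OF DP[OF that(1)] that(2)] by blast
  qed
  have u0D: "u0 \<in> D" using m \<delta> by (force simp: D_def)
  show ?thesis
  proof (intro exI[of _ "F.flow u0"] conjI)
    show "F.flow u0 0 = u0" using F.flow_0[OF u0D] by auto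
    have ph: "F.flow u0 t \<in> phase_space G S" if "t \<in> {0..}" for t using F.flow_in[OF u0D] that DP by auto
    have der: "((\<lambda>s. F.flow u0 s v) has_real_derivative field G (F.flow u0 t) v) (at t within {0..})"
      if "v \<in> vertices S" "t \<in> {0..}" for t v using F.flow_has_derivative[OF u0D] that by auto
    have "continuous_on {0..} (\<lambda>t. F.flow u0 t v)" if "v \<in> vertices S" for v
      unfolding continuous_on_eq_continuous_within using DERIV_continuous[OF der[OF that]] by blast
    then show "ext_ricci_flow_solution G S {0..} (F.flow u0)"
      unfolding ext_ricci_flow_solution_iff C1_solution_def using ph der field_path_continuous by blast
  qed
qed

lemma ext_flow_unique:
  assumes I: "time_interval I" and u: "ext_ricci_flow_solution G S I u" and w: "ext_ricci_flow_solution G S I w"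
    and init: "\<forall>v\<in>vertices S. u 0 v = w 0 v" and t: "t \<in> I" and v: "v \<in> vertices S"
  shows "u t v = w t v"
proof -
  note u' = u[unfolded ext_ricci_flow_solution_iff C1_solution_def]
    and w' = w[unfolded ext_ricci_flow_solution_iff C1_solution_def]
  have "(\<Sum>i\<in>vertices S. (u t i - w t i)\<^sup>2) \<le> exp (- 2 * 0 * t) * (\<Sum>i\<in>vertices S. (u 0 i - w 0 i)\<^sup>2)"
  proof (rule sq_dist_decay[OF finite_vertices])
    show "is_interval I" "0 \<in> I" "t \<in> I" "0 \<le> t" using I t by (auto simp: time_interval_def)
    show "((\<lambda>s. u s i) has_real_derivative field G (u s) i) (at s within I)"
      "((\<lambda>s. w s i) has_real_derivative field G (w s) i) (at s within I)" if "i \<in> vertices S" "s \<in> I" for i s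
      using u' w' that by auto
    show "(\<Sum>i\<in>vertices S. (u s i - w s i) * (field G (u s) i - field G (w s) i)) \<le> - 0 * (\<Sum>i\<in>vertices S. (u s i - w s i)\<^sup>2)"
      if "s \<in> I" for s using field_monotone[of "u s" G "w s"] u' w' that by simp
  qed
  then have "(\<Sum>i\<in>vertices S. (u t i - w t i)\<^sup>2) \<le> 0" using init by simp
  moreover have "(u t v - w t v)\<^sup>2 \<le> (\<Sum>i\<in>vertices S. (u t i - w t i)\<^sup>2)"
    using v finite_vertices by (intro member_le_sum) auto
  ultimately have "(u t v - w t v)\<^sup>2 \<le> 0" by linarith
  then show ?thesis by simp
qed

lemma ricci_flow_imp_ext:
  assumes "ricci_flow_solution G S I u"
  shows "ext_ricci_flow_solution G S I u"
proof -
  have d: "dcf_u G S (u t)" if "t \<in> I" for t using assms that by (simp add: ricci_flow_solution_def)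
  have eq: "target_curvature G S - curvature G S (f_of_u G S (u t)) v = field G (u t) v" if "t \<in> I" "v \<in> vertices S" for t v
    using field_eq_curvature[OF d[OF that(1)] that(2)] .
  have "continuous_on I (\<lambda>t. target_curvature G S - curvature G S (f_of_u G S (u t)) v) \<longleftrightarrow> continuous_on I (\<lambda>t. field G (u t) v)"
    if "v \<in> vertices S" for v using eq that by (intro continuous_on_cong) auto
  then show ?thesis
    using assms eq d unfolding ricci_flow_solution_def ext_ricci_flow_solution_iff C1_solution_def
    by (auto simp: dcf_u_def)
qed

lemma dcf_open:
  assumes u: "dcf_u G S u"
  shows "\<exists>r>0. \<forall>y\<in>phase_space G S. (\<forall>v\<in>vertices S. \<bar>y v - u v\<bar> < r) \<longrightarrow> dcf_u G S y"
proof -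
  have ph: "u \<in> phase_space G S" using u by (simp add: dcf_u_def)
  have det: "face_det G u t > 0" if "t \<in> faces S" for t using u dcf_iff[OF ph] that by blast
  have "\<exists>r>0. \<forall>t\<in>faces S. \<forall>y. (\<forall>v\<in>vertices S. \<bar>y v - u v\<bar> < r) \<longrightarrow> face_det G y t > 0"
  proof (rule finite_common_bound[OF finite_faces])
    fix t assume t: "t \<in> faces S"
    obtain r where "r > 0" and r: "\<And>y1 y2 y3. \<bar>y1 - u (cl t 0)\<bar> < r \<Longrightarrow> \<bar>y2 - u (cl t 1)\<bar> < r \<Longrightarrow> \<bar>y3 - u (cl t 2)\<bar> < r \<Longrightarrow>
       tri_det G (vw t 0) (vw t 1) (vw t 2) (ew t 0 1) (ew t 0 2) (ew t 1 2) y1 y2 y3 > 0"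
      using tri_det_pos_open[OF structure_face_012[OF t] phase_domain_cl[OF ph t, of 0] phase_domain_cl[OF ph t, of 1]
        phase_domain_cl[OF ph t, of 2] det[OF t, unfolded face_det_def]] by auto
    then show "\<exists>r>0. \<forall>y. (\<forall>v\<in>vertices S. \<bar>y v - u v\<bar> < r) \<longrightarrow> face_det G y t > 0"
      unfolding face_det_def using cl_in[OF t, of 0] cl_in[OF t, of 1] cl_in[OF t, of 2] by (intro exI[of _ r]) auto
  qed (meson less_le_trans)
  then show ?thesis using dcf_iff by blast
qed

text \<open>Nondegeneracy is an open condition, so the extended solution is an honest one for a
  short time.\<close>

lemma ricci_flow_exists:
  assumes u0: "dcf_u G S u0"
  shows "\<exists>T>0. \<exists>u. ricci_flow_solution G S {0..<T} u \<and> u 0 = u0"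
proof -
  obtain w where w: "ext_ricci_flow_solution G S {0..} w" "w 0 = u0"
    using ext_flow_exists[of u0 G] u0 by (auto simp: dcf_u_def)
  note w' = w(1)[unfolded ext_ricci_flow_solution_iff C1_solution_def]
  obtain r where "r > 0" and r: "\<And>y. y \<in> phase_space G S \<Longrightarrow> \<forall>v\<in>vertices S. \<bar>y v - u0 v\<bar> < r \<Longrightarrow> dcf_u G S y"
    using dcf_open[OF u0] by blast
  have "\<exists>T>0. \<forall>v\<in>vertices S. \<forall>t\<in>{0..}. dist t 0 < T \<longrightarrow> dist (w t v) (w 0 v) < r"
  proof (rule finite_common_bound[OF finite_vertices])
    fix v assume v: "v \<in> vertices S"
    have "continuous_on {0..} (\<lambda>t. w t v)"
      unfolding continuous_on_eq_continuous_within using DERIV_continuous w' v by blast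
    from this[unfolded continuous_on_iff]
    have "\<forall>e>0. \<exists>T>0. \<forall>t\<in>{0..}. dist t 0 < T \<longrightarrow> dist (w t v) (w 0 v) < e" by (rule bspec) simp
    then show "\<exists>T>0. \<forall>t\<in>{0..}. dist t 0 < T \<longrightarrow> dist (w t v) (w 0 v) < r"
      using \<open>r > 0\<close> by blast
  qed (meson less_le_trans)
  then obtain T where T: "T > 0" "\<And>v t. v \<in> vertices S \<Longrightarrow> t \<ge> 0 \<Longrightarrow> t < T \<Longrightarrow> \<bar>w t v - u0 v\<bar> < r"
    by (auto simp: dist_real_def w(2))
  have d: "dcf_u G S (w t)" if "t \<in> {0..<T}" for t using r[of "w t"] T w' that by auto
  have eq: "target_curvature G S - curvature G S (f_of_u G S (w t)) v = field G (w t) v" if "t \<in> {0..<T}" "v \<in> vertices S" for t v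
    using field_eq_curvature[OF d[OF that(1)] that(2)] .
  have "ricci_flow_solution G S {0..<T} w"
    unfolding ricci_flow_solution_def C1_solution_def
  proof (intro conjI ballI)
    fix v assume v: "v \<in> vertices S"
    have "continuous_on {0..<T} (\<lambda>t. field G (w t) v)"
      by (rule continuous_on_subset[of "{0..}"]) (use w' v in auto)
    moreover have "continuous_on {0..<T} (\<lambda>t. target_curvature G S - curvature G S (f_of_u G S (w t)) v) \<longleftrightarrow> continuous_on {0..<T} (\<lambda>t. field G (w t) v)"
      using eq v by (intro continuous_on_cong) auto
    ultimately show "continuous_on {0..<T} (\<lambda>t. target_curvature G S - curvature G S (f_of_u G S (w t)) v)" by blast
    fix t assume t: "t \<in> {0..<T}"
    have "((\<lambda>s. w s v) has_real_derivative field G (w t) v) (at t within {0..})" using w' v t by auto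
    then show "((\<lambda>s. w s v) has_real_derivative target_curvature G S - curvature G S (f_of_u G S (w t)) v) (at t within {0..<T})"
      unfolding eq[OF t v] by (rule has_field_derivative_subset) auto
  qed (rule d)
  then show ?thesis using T(1) w(2) by blast
qed

end

section \<open>Convergence\<close>

context weighted_closed_surface
begin

text \<open>In the Euclidean case this is the Dirichlet energy of e on the 1-skeleton, each edge
  being counted from both of its sides.\<close>

definition face_norm :: "geometry \<Rightarrow> ('a corner set \<Rightarrow> real) \<Rightarrow> real" where
  "face_norm G e = (\<Sum>t\<in>faces S. dir_norm G (e (cl t 0)) (e (cl t 1)) (e (cl t 2)))"

lemma face_norm_hyperbolic: "face_norm Hyperbolic e \<ge> (\<Sum>v\<in>vertices S. (e v)\<^sup>2)"
proof -
  have "(\<Sum>v\<in>vertices S. (e v)\<^sup>2) \<le> (\<Sum>v\<in>vertices S. \<Sum>c\<in>v. (e v)\<^sup>2)"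
  proof (rule sum_mono)
    fix v assume v: "v \<in> vertices S"
    have "card v \<ge> 1" using finite_vertex[OF v] vertex_ne[OF v] by (simp add: Suc_le_eq card_gt_0_iff)
    then have "1 * (e v)\<^sup>2 \<le> real (card v) * (e v)\<^sup>2" by (intro mult_right_mono) auto
    then show "(e v)\<^sup>2 \<le> (\<Sum>c\<in>v. (e v)\<^sup>2)" by simp
  qed
  also have "\<dots> = face_norm Hyperbolic e" unfolding vertex_sum face_norm_def by simp
  finally show ?thesis .
qed

lemma face_difference_le:
  assumes t: "t \<in> faces S" and ij: "i < 3" "j < 3"
  shows "\<bar>e (cl t i) - e (cl t j)\<bar> \<le> sqrt (face_norm Euclidean e)"
proof -
  have three: "k = 0 \<or> k = 1 \<or> k = 2" if "k < 3" for k :: nat using that by auto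
  note comm = power2_commute[of "e (cl t 1)" "e (cl t 0)"] power2_commute[of "e (cl t 2)" "e (cl t 0)"]
    power2_commute[of "e (cl t 2)" "e (cl t 1)"]
  have "(e (cl t i) - e (cl t j))\<^sup>2 \<le> dir_norm Euclidean (e (cl t 0)) (e (cl t 1)) (e (cl t 2))"
    using three[OF ij(1)] three[OF ij(2)] by (elim disjE; hypsubst) (simp_all only: dir_norm.simps comm, simp_all)
  also have "\<dots> \<le> face_norm Euclidean e"
    unfolding face_norm_def using t finite_faces dir_norm_nonneg by (intro member_le_sum) auto
  finally show ?thesis by (metis real_sqrt_abs real_sqrt_le_iff)
qed

text \<open>Faces glued along a side share a vertex, so each step of the chain adds one difference
  within a face. \<open>B\<close> counts the faces of the chain and does not depend on e.\<close>

lemma chain_difference_le: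
  assumes "(s, t) \<in> ((\<lambda>d. (fst d, fst (glue S d))) ` osides S)\<^sup>*" "s \<in> faces S"
  shows "t \<in> faces S \<and> (\<exists>B. \<forall>e. \<forall>i<3. \<forall>j<3. \<bar>e (cl s i) - e (cl t j)\<bar> \<le> real B * sqrt (face_norm Euclidean e))"
  using assms(1)
proof (induction rule: rtrancl_induct)
  case base
  show ?case using assms(2) face_difference_le[OF assms(2)] by (intro conjI exI[of _ 1]) auto
next
  case (step t t')
  then obtain B where t: "t \<in> faces S" and B: "\<And>e i j. i < 3 \<Longrightarrow> j < 3 \<Longrightarrow> \<bar>e (cl s i) - e (cl t j)\<bar> \<le> real B * sqrt (face_norm Euclidean e)"
    by blast
  from step(2) obtain d where d: "d \<in> osides S" "t = fst d" "t' = fst (glue S d)" by auto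
  obtain k l where k: "d = (t, k, l)" "k < 3" using d by (cases d) (auto simp: osides_def)
  obtain k' l' where k': "glue S d = (t', k', l')" "k' < 3" "t' \<in> faces S"
    using d glue_in[OF d(1)] by (cases "glue S d") (auto simp: osides_def)
  have "(tail d, tail (glue S d)) \<in> vertex_rel S"
    unfolding vertex_rel_def using d(1) tail_in glue_in by (auto intro: r_into_rtrancl)
  then have "vertex_class S (tail d) = vertex_class S (tail (glue S d))"
    unfolding vertex_class_def by (rule equiv_class_eq[OF equiv_vertex_rel])
  then have eq: "cl t k = cl t' k'" unfolding cl_def k'(1) by (simp add: k(1))
  have "\<bar>e (cl s i) - e (cl t' j)\<bar> \<le> real (Suc B) * sqrt (face_norm Euclidean e)" if "i < 3" "j < 3" for e i j
    using B[OF that(1) k(2), of e] face_difference_le[OF k'(3,2) that(2), of e] unfolding eq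
    by (simp add: algebra_simps)
  then show ?case using k'(3) by blast
qed

text \<open>When e has mean zero, \<open>n * e v\<close> is the sum of the differences
  \<open>e v - e w\<close>, and each of these is bounded along a chain of glued faces.\<close>

lemma poincare:
  "\<exists>k>0. \<forall>e. (\<Sum>v\<in>vertices S. e v) = 0 \<longrightarrow> k * (\<Sum>v\<in>vertices S. (e v)\<^sup>2) \<le> face_norm Euclidean e"
proof -
  have "\<exists>B. \<forall>e. \<forall>i<3. \<forall>j<3. \<bar>e (cl s i) - e (cl t j)\<bar> \<le> real B * sqrt (face_norm Euclidean e)"
    if "s \<in> faces S" "t \<in> faces S" for s t
    using chain_difference_le[of s t] conn that unfolding connected_surface_def by blast
  then obtain B where B: "\<And>s t e i j. s \<in> faces S \<Longrightarrow> t \<in> faces S \<Longrightarrow> i < 3 \<Longrightarrow> j < 3 \<Longrightarrow>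
      \<bar>e (cl s i) - e (cl t j)\<bar> \<le> real (B s t) * sqrt (face_norm Euclidean e)" by metis
  define M where "M = real (\<Sum>s\<in>faces S. \<Sum>t\<in>faces S. B s t)"
  have BM: "real (B s t) \<le> M" if "s \<in> faces S" "t \<in> faces S" for s t
  proof -
    have "B s t \<le> (\<Sum>t\<in>faces S. B s t)" using that finite_faces by (intro member_le_sum) auto
    also have "\<dots> \<le> (\<Sum>s\<in>faces S. \<Sum>t\<in>faces S. B s t)"
      using that finite_faces by (intro member_le_sum[of s _ "\<lambda>s. \<Sum>t\<in>faces S. B s t"]) auto
    finally show ?thesis unfolding M_def of_nat_le_iff .
  qed
  define n where "n = real (card (vertices S))"
  have n: "n > 0" using vertices_ne finite_vertices by (simp add: n_def card_gt_0_iff)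
  show ?thesis
  proof (intro exI[of _ "1 / (n * M\<^sup>2 + 1)"] conjI allI impI)
    show "0 < 1 / (n * M\<^sup>2 + 1)" using n by (simp add: add_nonneg_pos)
    fix e :: "'a corner set \<Rightarrow> real" assume e: "(\<Sum>v\<in>vertices S. e v) = 0"
    define N where "N = face_norm Euclidean e"
    have N: "N \<ge> 0" unfolding N_def face_norm_def by (intro sum_nonneg dir_norm_nonneg)
    have diff: "\<bar>e v - e w\<bar> \<le> M * sqrt N" if vw: "v \<in> vertices S" "w \<in> vertices S" for v w
    proof -
      obtain s i t j where st: "s \<in> faces S" "i < 3" "v = cl s i" "t \<in> faces S" "j < 3" "w = cl t j"
        using vertex_is_cl[OF vw(1)] vertex_is_cl[OF vw(2)] by blast
      have "\<bar>e v - e w\<bar> \<le> real (B s t) * sqrt N" using B[OF st(1,4,2,5)] st by (simp add: N_def)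
      also have "\<dots> \<le> M * sqrt N" using BM[OF st(1,4)] N by (intro mult_right_mono) auto
      finally show ?thesis .
    qed
    have bd: "(e v)\<^sup>2 \<le> M\<^sup>2 * N" if v: "v \<in> vertices S" for v
    proof -
      have "n * e v = (\<Sum>w\<in>vertices S. e v - e w)" using e by (simp add: sum_subtractf n_def)
      then have "\<bar>n * e v\<bar> \<le> (\<Sum>w\<in>vertices S. \<bar>e v - e w\<bar>)" by (simp add: sum_abs)
      also have "\<dots> \<le> (\<Sum>w\<in>vertices S. M * sqrt N)" using diff[OF v] by (intro sum_mono) auto
      finally have "n * \<bar>e v\<bar> \<le> n * (M * sqrt N)" using n by (simp add: n_def abs_mult)
      then have "\<bar>e v\<bar> \<le> M * sqrt N" using n by simp
      from power_mono[OF this, of 2] show ?thesis using N by (simp add: power_mult_distrib)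
    qed
    have "(\<Sum>v\<in>vertices S. (e v)\<^sup>2) \<le> (\<Sum>v\<in>vertices S. M\<^sup>2 * N)" using bd by (rule sum_mono)
    also have "\<dots> = n * M\<^sup>2 * N" by (simp add: n_def)
    also have "\<dots> \<le> (n * M\<^sup>2 + 1) * N" using N by (simp add: distrib_right)
    finally show "1 / (n * M\<^sup>2 + 1) * (\<Sum>v\<in>vertices S. (e v)\<^sup>2) \<le> face_norm Euclidean e"
      using n by (simp add: N_def divide_le_eq add_nonneg_pos mult.commute)
  qed
qed

text \<open>The estimates of \<open>tri_angles_strongly_monotone\<close> are summed over the faces.
  The constant \<open>c\<close> comes before \<open>\<epsilon>\<close>, so that the remainder can
  later be made small against what \<open>c\<close> gains.\<close>

lemma field_locally_coercive:
  assumes w: "dcf_u G S w"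
  shows "\<exists>c>0. \<forall>\<epsilon>>0. \<exists>r>0. \<forall>y. (\<forall>v\<in>vertices S. \<bar>y v - w v\<bar> < r) \<longrightarrow>
    (\<Sum>v\<in>vertices S. (y v - w v) * (field G y v - field G w v))
      \<le> - c * face_norm G (\<lambda>v. y v - w v) + \<epsilon> * (\<Sum>v\<in>vertices S. (y v - w v)\<^sup>2)"
proof -
  have ph: "w \<in> phase_space G S" using w by (simp add: dcf_u_def)
  have det: "face_det G w t > 0" if "t \<in> faces S" for t using w dcf_iff[OF ph] that by blast
  define P where "P t c \<longleftrightarrow> (\<forall>\<epsilon>>0. \<exists>r>0. \<forall>y. \<bar>y (cl t 0) - w (cl t 0)\<bar> < r \<longrightarrow> \<bar>y (cl t 1) - w (cl t 1)\<bar> < r \<longrightarrow> \<bar>y (cl t 2) - w (cl t 2)\<bar> < r \<longrightarrow>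
      face_pairing G y w t \<le> - c * dir_norm G (y (cl t 0) - w (cl t 0)) (y (cl t 1) - w (cl t 1)) (y (cl t 2) - w (cl t 2))
       + \<epsilon> * ((y (cl t 0) - w (cl t 0))\<^sup>2 + (y (cl t 1) - w (cl t 1))\<^sup>2 + (y (cl t 2) - w (cl t 2))\<^sup>2))" for t c
  have "\<exists>c>0. \<forall>t\<in>faces S. P t c"
  proof (rule finite_common_bound[OF finite_faces])
    fix t assume t: "t \<in> faces S"
    show "\<exists>c>0. P t c"
    proof -
      have "u (cl t 0) \<in> u_domain G (vw t 0)" "u (cl t 1) \<in> u_domain G (vw t 1)" "u (cl t 2) \<in> u_domain G (vw t 2)"
        if "u \<in> phase_space G S" for u
        using phase_domain_cl[OF that t] by simp_all
      from tri_angles_strongly_monotone[OF structure_face_012[OF t] this[OF ph] det[OF t, unfolded face_det_def]]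
      obtain c where "c > 0" and c: "\<And>\<epsilon>. \<epsilon> > 0 \<Longrightarrow> \<exists>\<delta>>0. \<forall>y1 y2 y3. \<bar>y1 - w (cl t 0)\<bar> < \<delta> \<longrightarrow> \<bar>y2 - w (cl t 1)\<bar> < \<delta> \<longrightarrow> \<bar>y3 - w (cl t 2)\<bar> < \<delta> \<longrightarrow>
        (y1 - w (cl t 0)) * (tri_angle G (vw t 0) (vw t 1) (vw t 2) (ew t 0 1) (ew t 0 2) (ew t 1 2) y1 y2 y3 - angle G w (t, 0))
       + (y2 - w (cl t 1)) * (tri_angle G (vw t 1) (vw t 2) (vw t 0) (ew t 1 2) (ew t 0 1) (ew t 0 2) y2 y3 y1 - angle G w (t, 1))
       + (y3 - w (cl t 2)) * (tri_angle G (vw t 2) (vw t 0) (vw t 1) (ew t 0 2) (ew t 1 2) (ew t 0 1) y3 y1 y2 - angle G w (t, 2))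
       \<le> - c * dir_norm G (y1 - w (cl t 0)) (y2 - w (cl t 1)) (y3 - w (cl t 2))
         + \<epsilon> * ((y1 - w (cl t 0))\<^sup>2 + (y2 - w (cl t 1))\<^sup>2 + (y3 - w (cl t 2))\<^sup>2)"
        unfolding angle_eqs[OF t] by blast
      have "P t c" unfolding P_def
      proof (intro allI impI)
        fix \<epsilon> :: real assume "\<epsilon> > 0"
        from c[OF this] obtain r where "r > 0" and r: "\<And>y1 y2 y3. \<bar>y1 - w (cl t 0)\<bar> < r \<Longrightarrow> \<bar>y2 - w (cl t 1)\<bar> < r \<Longrightarrow> \<bar>y3 - w (cl t 2)\<bar> < r \<Longrightarrow>
        (y1 - w (cl t 0)) * (tri_angle G (vw t 0) (vw t 1) (vw t 2) (ew t 0 1) (ew t 0 2) (ew t 1 2) y1 y2 y3 - angle G w (t, 0))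
       + (y2 - w (cl t 1)) * (tri_angle G (vw t 1) (vw t 2) (vw t 0) (ew t 1 2) (ew t 0 1) (ew t 0 2) y2 y3 y1 - angle G w (t, 1))
       + (y3 - w (cl t 2)) * (tri_angle G (vw t 2) (vw t 0) (vw t 1) (ew t 0 2) (ew t 1 2) (ew t 0 1) y3 y1 y2 - angle G w (t, 2))
       \<le> - c * dir_norm G (y1 - w (cl t 0)) (y2 - w (cl t 1)) (y3 - w (cl t 2))
         + \<epsilon> * ((y1 - w (cl t 0))\<^sup>2 + (y2 - w (cl t 1))\<^sup>2 + (y3 - w (cl t 2))\<^sup>2)" by blast
        show "\<exists>r>0. \<forall>y. \<bar>y (cl t 0) - w (cl t 0)\<bar> < r \<longrightarrow> \<bar>y (cl t 1) - w (cl t 1)\<bar> < r \<longrightarrow> \<bar>y (cl t 2) - w (cl t 2)\<bar> < r \<longrightarrow>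
          face_pairing G y w t \<le> - c * dir_norm G (y (cl t 0) - w (cl t 0)) (y (cl t 1) - w (cl t 1)) (y (cl t 2) - w (cl t 2))
           + \<epsilon> * ((y (cl t 0) - w (cl t 0))\<^sup>2 + (y (cl t 1) - w (cl t 1))\<^sup>2 + (y (cl t 2) - w (cl t 2))\<^sup>2)"
        proof (rule exI[of _ r], intro conjI allI impI \<open>r > 0\<close>)
          fix y assume "\<bar>y (cl t 0) - w (cl t 0)\<bar> < r" "\<bar>y (cl t 1) - w (cl t 1)\<bar> < r" "\<bar>y (cl t 2) - w (cl t 2)\<bar> < r"
          from r[OF this] show "face_pairing G y w t \<le> - c * dir_norm G (y (cl t 0) - w (cl t 0)) (y (cl t 1) - w (cl t 1)) (y (cl t 2) - w (cl t 2))
           + \<epsilon> * ((y (cl t 0) - w (cl t 0))\<^sup>2 + (y (cl t 1) - w (cl t 1))\<^sup>2 + (y (cl t 2) - w (cl t 2))\<^sup>2)"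
            unfolding face_pairing_def angle_eqs[OF t, of G y] .
        qed
      qed
      then show ?thesis using \<open>c > 0\<close> by blast
    qed
  next
    fix t c c' assume P: "P t c" "c' \<le> c"
    show "P t c'" unfolding P_def
    proof (intro allI impI)
      fix \<epsilon> :: real assume "\<epsilon> > 0"
      from P(1)[unfolded P_def, rule_format, OF this] obtain r where "r > 0"
        and r: "\<And>y. \<bar>y (cl t 0) - w (cl t 0)\<bar> < r \<Longrightarrow> \<bar>y (cl t 1) - w (cl t 1)\<bar> < r \<Longrightarrow> \<bar>y (cl t 2) - w (cl t 2)\<bar> < r \<Longrightarrow>
          face_pairing G y w t \<le> - c * dir_norm G (y (cl t 0) - w (cl t 0)) (y (cl t 1) - w (cl t 1)) (y (cl t 2) - w (cl t 2))
           + \<epsilon> * ((y (cl t 0) - w (cl t 0))\<^sup>2 + (y (cl t 1) - w (cl t 1))\<^sup>2 + (y (cl t 2) - w (cl t 2))\<^sup>2)" by blast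
      show "\<exists>r>0. \<forall>y. \<bar>y (cl t 0) - w (cl t 0)\<bar> < r \<longrightarrow> \<bar>y (cl t 1) - w (cl t 1)\<bar> < r \<longrightarrow> \<bar>y (cl t 2) - w (cl t 2)\<bar> < r \<longrightarrow>
          face_pairing G y w t \<le> - c' * dir_norm G (y (cl t 0) - w (cl t 0)) (y (cl t 1) - w (cl t 1)) (y (cl t 2) - w (cl t 2))
           + \<epsilon> * ((y (cl t 0) - w (cl t 0))\<^sup>2 + (y (cl t 1) - w (cl t 1))\<^sup>2 + (y (cl t 2) - w (cl t 2))\<^sup>2)"
      proof (rule exI[of _ r], intro conjI allI impI \<open>r > 0\<close>)
        fix y assume "\<bar>y (cl t 0) - w (cl t 0)\<bar> < r" "\<bar>y (cl t 1) - w (cl t 1)\<bar> < r" "\<bar>y (cl t 2) - w (cl t 2)\<bar> < r"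
        note r[OF this]
        also have "- c * dir_norm G (y (cl t 0) - w (cl t 0)) (y (cl t 1) - w (cl t 1)) (y (cl t 2) - w (cl t 2))
          \<le> - c' * dir_norm G (y (cl t 0) - w (cl t 0)) (y (cl t 1) - w (cl t 1)) (y (cl t 2) - w (cl t 2))"
          using P(2) dir_norm_nonneg by (intro mult_right_mono) auto
        finally show "face_pairing G y w t \<le> - c' * dir_norm G (y (cl t 0) - w (cl t 0)) (y (cl t 1) - w (cl t 1)) (y (cl t 2) - w (cl t 2))
           + \<epsilon> * ((y (cl t 0) - w (cl t 0))\<^sup>2 + (y (cl t 1) - w (cl t 1))\<^sup>2 + (y (cl t 2) - w (cl t 2))\<^sup>2)" by simp
      qed
    qed
  qed
  then obtain c where "c > 0" and c: "\<And>t. t \<in> faces S \<Longrightarrow> P t c" by blast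
  show ?thesis
  proof (rule exI[of _ c], intro conjI allI impI \<open>c > 0\<close>)
    fix \<epsilon> :: real assume \<epsilon>: "\<epsilon> > 0"
    define m where "m = real (card (faces S))"
    have m: "m \<ge> 0" by (simp add: m_def)
    \<comment> \<open>Each of the m faces contributes three squares to the remainder, each at most
      the total sum of squares.\<close>
    define \<epsilon>' where "\<epsilon>' = \<epsilon> / (3 * m + 1)"
    have \<epsilon>': "\<epsilon>' > 0" using \<epsilon> m by (simp add: \<epsilon>'_def)
    have "\<exists>r>0. \<forall>t\<in>faces S. \<forall>y. \<bar>y (cl t 0) - w (cl t 0)\<bar> < r \<longrightarrow> \<bar>y (cl t 1) - w (cl t 1)\<bar> < r \<longrightarrow> \<bar>y (cl t 2) - w (cl t 2)\<bar> < r \<longrightarrow>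
      face_pairing G y w t \<le> - c * dir_norm G (y (cl t 0) - w (cl t 0)) (y (cl t 1) - w (cl t 1)) (y (cl t 2) - w (cl t 2))
       + \<epsilon>' * ((y (cl t 0) - w (cl t 0))\<^sup>2 + (y (cl t 1) - w (cl t 1))\<^sup>2 + (y (cl t 2) - w (cl t 2))\<^sup>2)"
    proof (rule finite_common_bound[OF finite_faces])
      fix t assume "t \<in> faces S"
      from c[OF this, unfolded P_def, rule_format, OF \<epsilon>']
      show "\<exists>r>0. \<forall>y. \<bar>y (cl t 0) - w (cl t 0)\<bar> < r \<longrightarrow> \<bar>y (cl t 1) - w (cl t 1)\<bar> < r \<longrightarrow> \<bar>y (cl t 2) - w (cl t 2)\<bar> < r \<longrightarrow>
      face_pairing G y w t \<le> - c * dir_norm G (y (cl t 0) - w (cl t 0)) (y (cl t 1) - w (cl t 1)) (y (cl t 2) - w (cl t 2))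
       + \<epsilon>' * ((y (cl t 0) - w (cl t 0))\<^sup>2 + (y (cl t 1) - w (cl t 1))\<^sup>2 + (y (cl t 2) - w (cl t 2))\<^sup>2)" by blast
    qed (meson less_le_trans)
    then obtain r where "r > 0" and r: "\<And>t y. t \<in> faces S \<Longrightarrow> \<bar>y (cl t 0) - w (cl t 0)\<bar> < r \<Longrightarrow> \<bar>y (cl t 1) - w (cl t 1)\<bar> < r \<Longrightarrow> \<bar>y (cl t 2) - w (cl t 2)\<bar> < r \<Longrightarrow>
      face_pairing G y w t \<le> - c * dir_norm G (y (cl t 0) - w (cl t 0)) (y (cl t 1) - w (cl t 1)) (y (cl t 2) - w (cl t 2))
       + \<epsilon>' * ((y (cl t 0) - w (cl t 0))\<^sup>2 + (y (cl t 1) - w (cl t 1))\<^sup>2 + (y (cl t 2) - w (cl t 2))\<^sup>2)" by blast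
    show "\<exists>r>0. \<forall>y. (\<forall>v\<in>vertices S. \<bar>y v - w v\<bar> < r) \<longrightarrow>
      (\<Sum>v\<in>vertices S. (y v - w v) * (field G y v - field G w v))
      \<le> - c * face_norm G (\<lambda>v. y v - w v) + \<epsilon> * (\<Sum>v\<in>vertices S. (y v - w v)\<^sup>2)"
    proof (rule exI[of _ r], intro conjI allI impI \<open>r > 0\<close>)
      fix y assume y: "\<forall>v\<in>vertices S. \<bar>y v - w v\<bar> < r"
      define Q where "Q = (\<Sum>v\<in>vertices S. (y v - w v)\<^sup>2)"
      have Q: "Q \<ge> 0" unfolding Q_def by (intro sum_nonneg) auto
      have yc: "\<bar>y (cl t i) - w (cl t i)\<bar> < r" if "t \<in> faces S" "i < 3" for t i using y cl_in[OF that] by blast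
      have sq: "(y (cl t i) - w (cl t i))\<^sup>2 \<le> Q" if "t \<in> faces S" "i < 3" for t i
        unfolding Q_def using cl_in[OF that] finite_vertices by (intro member_le_sum[of "cl t i" _ "\<lambda>v. (y v - w v)\<^sup>2"]) auto
      have "(\<Sum>v\<in>vertices S. (y v - w v) * (field G y v - field G w v)) = (\<Sum>t\<in>faces S. face_pairing G y w t)"
        by (rule field_pairing)
      also have "\<dots> \<le> (\<Sum>t\<in>faces S. - c * dir_norm G (y (cl t 0) - w (cl t 0)) (y (cl t 1) - w (cl t 1)) (y (cl t 2) - w (cl t 2)) + \<epsilon>' * (3 * Q))"
      proof (rule sum_mono)
        fix t assume t: "t \<in> faces S"
        have "(y (cl t 0) - w (cl t 0))\<^sup>2 + (y (cl t 1) - w (cl t 1))\<^sup>2 + (y (cl t 2) - w (cl t 2))\<^sup>2 \<le> 3 * Q"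
          using sq[OF t, of 0] sq[OF t, of 1] sq[OF t, of 2] by simp
        then have "\<epsilon>' * ((y (cl t 0) - w (cl t 0))\<^sup>2 + (y (cl t 1) - w (cl t 1))\<^sup>2 + (y (cl t 2) - w (cl t 2))\<^sup>2) \<le> \<epsilon>' * (3 * Q)"
          using \<epsilon>' by (intro mult_left_mono) auto
        then show "face_pairing G y w t \<le> - c * dir_norm G (y (cl t 0) - w (cl t 0)) (y (cl t 1) - w (cl t 1)) (y (cl t 2) - w (cl t 2)) + \<epsilon>' * (3 * Q)"
          using r[OF t, of y] yc[OF t, of 0] yc[OF t, of 1] yc[OF t, of 2] by simp
      qed
      also have "\<dots> = - c * face_norm G (\<lambda>v. y v - w v) + m * (\<epsilon>' * (3 * Q))"
        unfolding face_norm_def by (simp only: sum.distrib sum_distrib_left sum_constant m_def)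
      also have "m * (\<epsilon>' * (3 * Q)) \<le> \<epsilon> * Q"
      proof -
        have "m * (\<epsilon>' * (3 * Q)) = (3 * m / (3 * m + 1)) * (\<epsilon> * Q)" by (simp add: \<epsilon>'_def)
        also have "\<dots> \<le> 1 * (\<epsilon> * Q)" using m \<epsilon> Q by (intro mult_right_mono) auto
        finally show ?thesis by simp
      qed
      finally show "(\<Sum>v\<in>vertices S. (y v - w v) * (field G y v - field G w v))
        \<le> - c * face_norm G (\<lambda>v. y v - w v) + \<epsilon> * (\<Sum>v\<in>vertices S. (y v - w v)\<^sup>2)" by (simp add: Q_def)
    qed
  qed
qed

text \<open>Monotonicity along the ray from \<open>w\<close> carries the estimate near \<open>w\<close> to a whole ball of radius \<open>R\<close>.\<close>

lemma field_coercive_on_ball: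
  assumes w: "dcf_u G S w" and k: "k > 0" and R: "R > 0"
  shows "\<exists>c>0. \<forall>y\<in>phase_space G S. (\<forall>v\<in>vertices S. \<bar>y v - w v\<bar> \<le> R) \<longrightarrow>
      (\<forall>q. face_norm G (\<lambda>v. q * (y v - w v)) \<ge> k * (\<Sum>v\<in>vertices S. (q * (y v - w v))\<^sup>2)) \<longrightarrow>
    (\<Sum>v\<in>vertices S. (y v - w v) * (field G y v - field G w v)) \<le> - c * (\<Sum>v\<in>vertices S. (y v - w v)\<^sup>2)"
proof -
  have wp: "w \<in> phase_space G S" using w by (simp add: dcf_u_def)
  obtain c where "c > 0" and c: "\<And>\<epsilon>. \<epsilon> > 0 \<Longrightarrow> \<exists>r>0. \<forall>y. (\<forall>v\<in>vertices S. \<bar>y v - w v\<bar> < r) \<longrightarrow>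
    (\<Sum>v\<in>vertices S. (y v - w v) * (field G y v - field G w v))
      \<le> - c * face_norm G (\<lambda>v. y v - w v) + \<epsilon> * (\<Sum>v\<in>vertices S. (y v - w v)\<^sup>2)"
    using field_locally_coercive[OF w] by blast
  \<comment> \<open>The remainder may use up half of what the lower bound for
    \<open>face_norm\<close> gains.\<close>
  have "c * k / 2 > 0" using \<open>c > 0\<close> k by simp
  from c[OF this] obtain r where "r > 0" and r: "\<And>y. \<forall>v\<in>vertices S. \<bar>y v - w v\<bar> < r \<Longrightarrow>
    (\<Sum>v\<in>vertices S. (y v - w v) * (field G y v - field G w v))
      \<le> - c * face_norm G (\<lambda>v. y v - w v) + c * k / 2 * (\<Sum>v\<in>vertices S. (y v - w v)\<^sup>2)" by blast
  \<comment> \<open>Moving from w only the fraction \<open>q\<close> of the way to y brings every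
    point of the ball within \<open>r\<close> of w.\<close>
  define q where "q = r / (R + r)"
  have q: "0 < q" "q < 1" "q * R < r" using R \<open>r > 0\<close> by (auto simp: q_def field_simps)
  show ?thesis
  proof (intro exI[of _ "c * k / 2 * q"] conjI ballI impI)
    show "0 < c * k / 2 * q" using \<open>c > 0\<close> k q by simp
    fix y assume y: "y \<in> phase_space G S" "\<forall>v\<in>vertices S. \<bar>y v - w v\<bar> \<le> R"
      and fn: "\<forall>q. face_norm G (\<lambda>v. q * (y v - w v)) \<ge> k * (\<Sum>v\<in>vertices S. (q * (y v - w v))\<^sup>2)"
    define z where "z v = w v + q * (y v - w v)" for v
    have zw: "z v - w v = q * (y v - w v)" for v by (simp add: z_def)
    have yz: "y v - z v = (1 - q) * (y v - w v)" for v by (simp add: z_def algebra_simps)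
    have zp: "z \<in> phase_space G S"
    proof -
      have "z v < 0" if "y v < 0" "w v < 0" for v
      proof -
        have "z v = (1 - q) * w v + q * y v" by (simp add: z_def algebra_simps)
        then show ?thesis using that q by (simp add: add_neg_neg mult_pos_neg)
      qed
      then show ?thesis using y(1) wp by (auto simp: phase_space_def)
    qed
    define E where "E = (\<Sum>v\<in>vertices S. (y v - w v)\<^sup>2)"
    have near: "\<forall>v\<in>vertices S. \<bar>z v - w v\<bar> < r"
    proof
      fix v assume "v \<in> vertices S"
      then have "q * \<bar>y v - w v\<bar> \<le> q * R" using y q by (intro mult_left_mono) auto
      moreover have "\<bar>z v - w v\<bar> = q * \<bar>y v - w v\<bar>" using q by (simp add: zw abs_mult)
      ultimately show "\<bar>z v - w v\<bar> < r" using q by linarith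
    qed
    have E2: "(\<Sum>v\<in>vertices S. (q * (y v - w v))\<^sup>2) = q\<^sup>2 * E"
      by (simp add: E_def power_mult_distrib sum_distrib_left)
    have "c * (k * (q\<^sup>2 * E)) \<le> c * face_norm G (\<lambda>v. q * (y v - w v))"
      using fn[rule_format, of q] \<open>c > 0\<close> unfolding E2 by (intro mult_left_mono) auto
    then have "(\<Sum>v\<in>vertices S. q * (y v - w v) * (field G z v - field G w v)) \<le> - (c * k / 2) * (q\<^sup>2 * E)"
      using r[OF near] unfolding zw E2 by simp
    then have "q * (\<Sum>v\<in>vertices S. (y v - w v) * (field G z v - field G w v)) \<le> q * (- (c * k / 2 * q) * E)"
      by (simp add: sum_distrib_left mult_ac power2_eq_square)
    then have 1: "(\<Sum>v\<in>vertices S. (y v - w v) * (field G z v - field G w v)) \<le> - (c * k / 2 * q) * E"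
      using mult_le_cancel_left_pos[OF q(1)] by blast
    \<comment> \<open>Between z and y plain monotonicity applies, and \<open>y - z\<close> is a
      positive multiple of \<open>y - w\<close>.\<close>
    have "(1 - q) * (\<Sum>v\<in>vertices S. (y v - w v) * (field G y v - field G z v)) \<le> 0"
      using field_monotone[OF y(1) zp] unfolding yz by (simp add: sum_distrib_left mult.assoc)
    then have 2: "(\<Sum>v\<in>vertices S. (y v - w v) * (field G y v - field G z v)) \<le> 0"
      using q by (simp add: mult_le_0_iff)
    have "(\<Sum>v\<in>vertices S. (y v - w v) * (field G y v - field G w v))
      = (\<Sum>v\<in>vertices S. (y v - w v) * (field G y v - field G z v)) + (\<Sum>v\<in>vertices S. (y v - w v) * (field G z v - field G w v))"
      by (simp add: algebra_simps flip: sum.distrib)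
    then show "(\<Sum>v\<in>vertices S. (y v - w v) * (field G y v - field G w v)) \<le> - (c * k / 2 * q) * (\<Sum>v\<in>vertices S. (y v - w v)\<^sup>2)"
      using 1 2 by (simp add: E_def)
  qed
qed

text \<open>The decay estimate is used twice: with \<open>c = 0\<close> it confines the solution to
  a ball around w, and on that ball \<open>field_coercive_on_ball\<close> supplies one positive
  \<open>c\<close>. Only w has to be nondegenerate; the solution may pass through degenerate
  triangles.\<close>

lemma ext_flow_converges:
  assumes w: "dcf_u G S w" and zero: "\<forall>v\<in>vertices S. field G w v = 0" and k: "k > 0"
    and u: "ext_ricci_flow_solution G S {0..} u"
    and fn: "\<And>t q. t \<ge> 0 \<Longrightarrow> face_norm G (\<lambda>v. q * (u t v - w v)) \<ge> k * (\<Sum>v\<in>vertices S. (q * (u t v - w v))\<^sup>2)"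
  shows "converges_exponentially G S u"
proof -
  have wp: "w \<in> phase_space G S" using w by (simp add: dcf_u_def)
  note u' = u[unfolded ext_ricci_flow_solution_iff C1_solution_def]
  define E where "E t = (\<Sum>v\<in>vertices S. (u t v - w v)\<^sup>2)" for t
  have decay: "E t \<le> exp (- 2 * c * t) * E 0"
    if t: "t \<ge> 0" and le: "\<And>s. 0 \<le> s \<Longrightarrow> (\<Sum>v\<in>vertices S. (u s v - w v) * (field G (u s) v - field G w v)) \<le> - c * E s" for t c
    unfolding E_def
  proof (rule sq_dist_decay[where I = "{0..}" and w = "\<lambda>_. w" and u' = "\<lambda>s. field G (u s)" and w' = "\<lambda>_ _. 0", OF finite_vertices])
    show "is_interval {0 :: real..}" "0 \<in> {0 :: real..}" "t \<in> {0..}" "0 \<le> t" using t by (auto simp: is_interval_ci)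
    show "((\<lambda>s. u s i) has_real_derivative field G (u s) i) (at s within {0..})" if "i \<in> vertices S" "s \<in> {0..}" for i s
      using u' that by auto
    show "((\<lambda>s. w i) has_real_derivative 0) (at s within {0..})" for i s by simp
    show "(\<Sum>i\<in>vertices S. (u s i - w i) * (field G (u s) i - 0)) \<le> - c * (\<Sum>i\<in>vertices S. (u s i - w i)\<^sup>2)" if "0 \<le> s" for s
      using le[OF that] zero by (simp add: E_def)
  qed
  \<comment> \<open>The added 1 keeps \<open>R\<close> positive when the solution starts at w;
    \<open>R\<close> also serves as the constant in front of the exponential.\<close>
  define R where "R = sqrt (E 0) + 1"
  have E0: "E 0 \<ge> 0" unfolding E_def by (intro sum_nonneg) auto
  have R: "R > 0" using E0 by (simp add: R_def add_nonneg_pos)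
  have near: "\<bar>u t v - w v\<bar> \<le> R" if t: "t \<ge> 0" and v: "v \<in> vertices S" for t v
  proof -
    have "E t \<le> exp (- 2 * 0 * t) * E 0"
      by (rule decay[OF t]) (use field_monotone wp u' in auto)
    moreover have "(u t v - w v)\<^sup>2 \<le> E t" unfolding E_def using v finite_vertices by (intro member_le_sum) auto
    ultimately have "(u t v - w v)\<^sup>2 \<le> E 0" by simp
    then have "\<bar>u t v - w v\<bar> \<le> sqrt (E 0)" by (metis real_sqrt_abs real_sqrt_le_iff)
    then show ?thesis by (simp add: R_def)
  qed
  obtain c where "c > 0" and c: "\<And>y. y \<in> phase_space G S \<Longrightarrow> (\<forall>v\<in>vertices S. \<bar>y v - w v\<bar> \<le> R) \<Longrightarrow>
      (\<forall>q. face_norm G (\<lambda>v. q * (y v - w v)) \<ge> k * (\<Sum>v\<in>vertices S. (q * (y v - w v))\<^sup>2)) \<Longrightarrow>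
    (\<Sum>v\<in>vertices S. (y v - w v) * (field G y v - field G w v)) \<le> - c * (\<Sum>v\<in>vertices S. (y v - w v)\<^sup>2)"
    using field_coercive_on_ball[OF w k R] by blast
  have main: "E t \<le> exp (- 2 * c * t) * E 0" if "t \<ge> 0" for t
    by (rule decay[OF that]) (use c near fn u' in \<open>auto simp: E_def\<close>)
  show ?thesis unfolding converges_exponentially_def
  proof (rule bexI[OF _ wp], rule exI[of _ R], rule conjI[OF R], rule exI[of _ c], rule conjI[OF \<open>c > 0\<close>],
      intro allI impI)
    fix t :: real assume t: "t \<ge> 0"
    have "L2_set (\<lambda>v. u t v - w v) (vertices S) = sqrt (E t)" by (simp add: L2_set_def E_def)
    also have "\<dots> \<le> sqrt (exp (- 2 * c * t) * E 0)" using main[OF t] by simp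
    also have "\<dots> = exp (- c * t) * sqrt (E 0)"
    proof -
      have "exp (- 2 * c * t) = (exp (- c * t))\<^sup>2" by (simp add: power2_eq_square flip: exp_add)
      then show ?thesis by (simp add: real_sqrt_mult)
    qed
    also have "\<dots> \<le> exp (- c * t) * R" by (intro mult_left_mono) (auto simp: R_def)
    finally show "L2_set (\<lambda>v. u t v - w v) (vertices S) \<le> R * exp (- c * t)" by (simp add: mult.commute)
  qed
qed

section \<open>Convergence to equilibria in the two geometries\<close>

lemma hyperbolic_convergence:
  assumes f: "discrete_conformal_factor Hyperbolic S f" and K: "\<forall>v\<in>vertices S. curvature Hyperbolic S f v = 0"
    and u: "ext_ricci_flow_solution Hyperbolic S {0..} u"
  shows "converges_exponentially Hyperbolic S u"
proof -
  define w where "w = (\<lambda>v. u_coord Hyperbolic (vweight S v) (f v))"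
  have fw: "f_of_u Hyperbolic S w = f" unfolding w_def by (rule f_of_u_u_coord)
  have w: "dcf_u Hyperbolic S w" using f u_coord_in_phase[of Hyperbolic f] by (simp add: dcf_u_def fw) (simp add: w_def)
  show ?thesis
  proof (rule ext_flow_converges[OF w _ _ u, where k = 1])
    show "\<forall>v\<in>vertices S. field Hyperbolic w v = 0"
      using K field_eq_curvature[OF w] by (simp add: fw)
    show "1 * (\<Sum>v\<in>vertices S. (q * (u t v - w v))\<^sup>2) \<le> face_norm Hyperbolic (\<lambda>v. q * (u t v - w v))" for t q
      using face_norm_hyperbolic[of "\<lambda>v. q * (u t v - w v)"] by simp
  qed simp
qed

text \<open>Gauss-Bonnet identifies the constant curvature with the target and keeps the coordinate
  sum of a solution fixed. Shifting the equilibrium by \<open>s\<close> to the same sum puts all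
  differences into the hyperplane where \<open>poincare\<close> applies.\<close>

lemma euclidean_convergence:
  assumes f: "discrete_conformal_factor Euclidean S f" and K: "\<forall>v\<in>vertices S. curvature Euclidean S f v = K"
    and u: "ext_ricci_flow_solution Euclidean S {0..} u"
  shows "converges_exponentially Euclidean S u"
proof -
  have ph: "y \<in> phase_space Euclidean S" for y by (simp add: phase_space_def)
  note u' = u[unfolded ext_ricci_flow_solution_iff C1_solution_def]
  define n where "n = real (card (vertices S))"
  have n: "n > 0" using vertices_ne finite_vertices by (simp add: n_def card_gt_0_iff)
  have fd: "dcf_u Euclidean S f" using f ph by (simp add: dcf_u_def f_of_u_euclidean)
  have "field Euclidean f v = target_curvature Euclidean S - K" if "v \<in> vertices S" for v
    using field_eq_curvature[OF fd that] K that by (simp add: f_of_u_euclidean)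
  moreover from this have "(\<Sum>v\<in>vertices S. target_curvature Euclidean S - K) = 0"
    using gauss_bonnet[OF ph[of f]] by simp
  then have "target_curvature Euclidean S - K = 0" using n by (simp add: n_def)
  ultimately have f0: "field Euclidean f v = 0" if "v \<in> vertices S" for v using that by simp
  define s where "s = (\<Sum>v\<in>vertices S. u 0 v - f v) / n"
  define w where "w = (\<lambda>v. f v + s)"
  have w: "dcf_u Euclidean S w"
    using f ph unfolding dcf_u_def f_of_u_euclidean w_def dcf_euclidean_shift by blast
  have w0: "field Euclidean w v = 0" if "v \<in> vertices S" for v
    using f0[OF that] unfolding field_def f_of_u_euclidean w_def ext_curvature_euclidean_shift .
  have "((\<lambda>t. \<Sum>v\<in>vertices S. u t v) has_real_derivative 0) (at t within {0..})" if "t \<in> {0..}" for t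
  proof -
    have "((\<lambda>t. \<Sum>v\<in>vertices S. u t v) has_real_derivative (\<Sum>v\<in>vertices S. field Euclidean (u t) v)) (at t within {0..})"
      by (rule DERIV_sum) (use u' that in auto)
    then show ?thesis by (simp add: gauss_bonnet[OF ph])
  qed
  then obtain b where b: "\<And>t. t \<in> {0..} \<Longrightarrow> (\<Sum>v\<in>vertices S. u t v) = b"
    using has_field_derivative_zero_constant[of "{0 :: real..}" "\<lambda>t. \<Sum>v\<in>vertices S. u t v"] by (auto simp: convex_real_interval)
  have sum0: "(\<Sum>v\<in>vertices S. u t v - w v) = 0" if "t \<ge> 0" for t
  proof -
    have "(\<Sum>v\<in>vertices S. u t v - w v) = (\<Sum>v\<in>vertices S. u t v) - (\<Sum>v\<in>vertices S. f v) - n * s"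
      by (simp add: w_def sum_subtractf sum.distrib n_def)
    also have "n * s = (\<Sum>v\<in>vertices S. u 0 v) - (\<Sum>v\<in>vertices S. f v)" using n by (simp add: s_def sum_subtractf)
    finally show ?thesis using b[of t] b[of 0] that by simp
  qed
  obtain k where k: "k > 0" "\<And>e. (\<Sum>v\<in>vertices S. e v) = 0 \<Longrightarrow> k * (\<Sum>v\<in>vertices S. (e v)\<^sup>2) \<le> face_norm Euclidean e"
    using poincare by blast
  show ?thesis
  proof (rule ext_flow_converges[OF w _ k(1) u])
    show "\<forall>v\<in>vertices S. field Euclidean w v = 0" using w0 by blast
    show "k * (\<Sum>v\<in>vertices S. (q * (u t v - w v))\<^sup>2) \<le> face_norm Euclidean (\<lambda>v. q * (u t v - w v))" if "t \<ge> 0" for t q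
      by (rule k(2)) (simp add: sum0[OF that] flip: sum_distrib_left)
  qed
qed

end

theorem theorem1p6:
  fixes S :: "'a weighted_surface"
  assumes "triangulated_closed_surface S"
    and "connected_surface S"
    and "\<forall>i\<in>vertices S. vweight S i \<in> {0, 1}"
    and "structure_conditions S"
  shows
    "(\<forall>G u0. dcf_u G S u0 \<longrightarrow>
        (\<exists>T>0. \<exists>u. ricci_flow_solution G S {0..<T} u \<and> (\<forall>i\<in>vertices S. u 0 i = u0 i)) \<and>
        (\<forall>I u. time_interval I \<and> ricci_flow_solution G S I u \<and>
            (\<forall>i\<in>vertices S. u 0 i = u0 i) \<longrightarrow>
            (\<exists>w. ext_ricci_flow_solution G S {0..} w \<and>
              (\<forall>t\<in>I. \<forall>i\<in>vertices S. w t i = u t i))))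
     \<and> (\<forall>G u0 I u w. dcf_u G S u0 \<and> time_interval I \<and>
          ext_ricci_flow_solution G S I u \<and> (\<forall>i\<in>vertices S. u 0 i = u0 i) \<and>
          ext_ricci_flow_solution G S I w \<and> (\<forall>i\<in>vertices S. w 0 i = u0 i) \<longrightarrow>
          (\<forall>t\<in>I. \<forall>i\<in>vertices S. u t i = w t i))
     \<and> ((\<exists>f K. discrete_conformal_factor Euclidean S f \<and>
            (\<forall>i\<in>vertices S. curvature Euclidean S f i = K)) \<longrightarrow>
          (\<forall>u. ext_ricci_flow_solution Euclidean S {0..} u \<and> dcf_u Euclidean S (u 0) \<longrightarrow>
            converges_exponentially Euclidean S u))
     \<and> ((\<exists>f. discrete_conformal_factor Hyperbolic S f \<and>
            (\<forall>i\<in>vertices S. curvature Hyperbolic S f i = 0)) \<longrightarrow>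
          (\<forall>u. ext_ricci_flow_solution Hyperbolic S {0..} u \<and> dcf_u Hyperbolic S (u 0) \<longrightarrow>
            converges_exponentially Hyperbolic S u))"
proof -
  interpret weighted_closed_surface S by unfold_locales (fact assms)+
  show ?thesis
  proof (intro conjI allI impI)
    fix G u0 assume u0: "dcf_u G S u0"
    then show "\<exists>T>0. \<exists>u. ricci_flow_solution G S {0..<T} u \<and> (\<forall>i\<in>vertices S. u 0 i = u0 i)"
      using ricci_flow_exists by metis
    fix I u assume "time_interval I \<and> ricci_flow_solution G S I u \<and> (\<forall>i\<in>vertices S. u 0 i = u0 i)"
    then have I: "time_interval I" and u: "ext_ricci_flow_solution G S I u" and init: "\<forall>i\<in>vertices S. u 0 i = u0 i"
      using ricci_flow_imp_ext by blast+
    obtain w where w: "ext_ricci_flow_solution G S {0..} w" "w 0 = u0"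
      using ext_flow_exists[of u0 G] u0 by (auto simp: dcf_u_def)
    have "I \<subseteq> {0..}" using I by (simp add: time_interval_def)
    \<comment> \<open>Restricted to \<open>I\<close>, the global solution is a second extended
      solution with the same initial values, so uniqueness makes it an extension of u.\<close>
    have wI: "ext_ricci_flow_solution G S I w"
      unfolding ext_ricci_flow_solution_iff C1_solution_def
    proof (intro conjI ballI)
      note w' = w(1)[unfolded ext_ricci_flow_solution_iff C1_solution_def]
      show "w t \<in> phase_space G S" if "t \<in> I" for t using w' that \<open>I \<subseteq> {0..}\<close> by blast
      fix v assume v: "v \<in> vertices S"
      show "((\<lambda>s. w s v) has_real_derivative field G (w t) v) (at t within I)" if "t \<in> I" for t
        using w' v that \<open>I \<subseteq> {0..}\<close> by (intro has_field_derivative_subset[OF _ \<open>I \<subseteq> {0..}\<close>]) blast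
      show "continuous_on I (\<lambda>t. field G (w t) v)"
        using w' v by (intro continuous_on_subset[OF _ \<open>I \<subseteq> {0..}\<close>]) blast
    qed
    show "\<exists>w. ext_ricci_flow_solution G S {0..} w \<and> (\<forall>t\<in>I. \<forall>i\<in>vertices S. w t i = u t i)"
      using ext_flow_unique[OF I wI u] init w by auto
  next
    fix G u0 I u w
    assume "dcf_u G S u0 \<and> time_interval I \<and> ext_ricci_flow_solution G S I u \<and> (\<forall>i\<in>vertices S. u 0 i = u0 i) \<and>
          ext_ricci_flow_solution G S I w \<and> (\<forall>i\<in>vertices S. w 0 i = u0 i)"
    then show "\<forall>t\<in>I. \<forall>i\<in>vertices S. u t i = w t i" using ext_flow_unique[of I G u w] by simp
  next
    fix u assume "\<exists>f K. discrete_conformal_factor Euclidean S f \<and> (\<forall>i\<in>vertices S. curvature Euclidean S f i = K)"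
      "ext_ricci_flow_solution Euclidean S {0..} u \<and> dcf_u Euclidean S (u 0)"
    then show "converges_exponentially Euclidean S u" using euclidean_convergence by blast
  next
    fix u assume "\<exists>f. discrete_conformal_factor Hyperbolic S f \<and> (\<forall>i\<in>vertices S. curvature Hyperbolic S f i = 0)"
      "ext_ricci_flow_solution Hyperbolic S {0..} u \<and> dcf_u Hyperbolic S (u 0)"
    then show "converges_exponentially Hyperbolic S u" using hyperbolic_convergence by blast
  qed
qed

end
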